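(* There exists a smooth vector field $X_{0,1}:E_{0,1}\to TE_{0,1}$ whose integral curves define a foliation by circles of $E_{0,1}$, with unbounded periods. Likewise, there exists a smooth vector field on $E_{1,0}$ whose integral curves define a foliation by circles of $E_{1,0}$, with unbounded periods.
   Context: Identify $\mathbb{R}^4$ with the quaternion algebra $\mathbb{H}$ and $S^3$ with the multiplicative group $\mathbb{H}_1$ of quaternions of modulus one. For integers $h,j$ with $h+j=1$, let $\xi_{h,j}$ be the $S^3$-bundle over $S^4$ with total space $$E_{h,j}=\big((\mathbb{R}^4\times S^3)\coprod(\mathbb{R}^4\times S^3)\big)/\simeq ,$$ where, for $v\in\mathbb{R}^4\setminus\{0\}$ and $w\in S^3$, the point $(v,w)$ of the first copy is identified with the point $$\Big(\frac{v}{\|v\|^2},\ \frac{v^h\,w\,v^j}{\|v\|}\Big)$$ of the second copy (quaternion multiplication being understood), and the base $S^4$ is obtained by gluing the two copies of $\mathbb{R}^4$ via $v\simeq v/\|v\|^2$, $v\neq0$. Thus $E_{0,1}$ and $E_{1,0}$ are the total spaces of $\xi_{0,1}$ and $\xi_{1,0}$ (the two quaternionic Hopf bundles), closed smooth $7$-manifolds. Smooth means $C^\infty$. The integral curves define a foliation by circles if the vector field is nowhere vanishing and all its integral curves are closed; the period of a point is the minimal period $T(p)>0$ of the integral curve through it, and unbounded periods means that the function $T$ is unbounded on the manifold. *)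

theory Defs
  imports "HOL-Analysis.Analysis"
begin

section \<open>Quaternions\<close>

text \<open>The vector \<open>(a, b, c, d)\<close> stands for the quaternion \<open>a + b i + c j + d k\<close>; the norm
  of \<^typ>\<open>real^4\<close> is then the quaternion modulus.\<close>

type_synonym quat = "real^4"

definition qmul :: "quat \<Rightarrow> quat \<Rightarrow> quat"  (infixl \<open>\<bullet>\<^sub>H\<close> 70) where
  "p \<bullet>\<^sub>H q = vector
     [p$1 * q$1 - p$2 * q$2 - p$3 * q$3 - p$4 * q$4,
      p$1 * q$2 + p$2 * q$1 + p$3 * q$4 - p$4 * q$3,
      p$1 * q$3 - p$2 * q$4 + p$3 * q$1 + p$4 * q$2,
      p$1 * q$4 + p$2 * q$3 - p$3 * q$2 + p$4 * q$1]"

definition qone :: quat where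
  "qone = vector [1, 0, 0, 0]"

definition qinv :: "quat \<Rightarrow> quat" where
  "qinv p = (1 / (norm p)\<^sup>2) *\<^sub>R vector [p$1, - p$2, - p$3, - p$4]"

definition qpow :: "quat \<Rightarrow> int \<Rightarrow> quat" where
  "qpow p n = (if n \<ge> 0 then ((\<bullet>\<^sub>H) p ^^ nat n) qone else ((\<bullet>\<^sub>H) (qinv p) ^^ nat (- n)) qone)"

section \<open>Smooth maps\<close>

primrec Ck_on ::
    "nat \<Rightarrow> 'a::real_normed_vector set \<Rightarrow> ('a \<Rightarrow> 'b::real_normed_vector) \<Rightarrow> bool" where
  "Ck_on 0 U f \<longleftrightarrow> continuous_on U f"
| "Ck_on (Suc k) U f \<longleftrightarrow>
     (\<forall>x\<in>U. f differentiable (at x)) \<and> (\<forall>v. Ck_on k U (\<lambda>x. frechet_derivative f (at x) v))"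

text \<open>Smoothness on a subset that need not be open (below: the submanifold
  \<open>\<real>\<^sup>4 \<times> S\<^sup>3\<close> of \<open>\<real>\<^sup>8\<close>) means that the map extends, locally around each point of the subset, to a
  \<open>C\<^sup>\<infinity>\<close> map on an open set of the ambient space.\<close>

definition smooth_on :: "'a::real_normed_vector set \<Rightarrow> ('a \<Rightarrow> 'b::real_normed_vector) \<Rightarrow> bool" where
  "smooth_on S f \<longleftrightarrow>
     (\<forall>x\<in>S. \<exists>U g. open U \<and> x \<in> U \<and> (\<forall>k. Ck_on k U g) \<and> (\<forall>y \<in> U \<inter> S. g y = f y))"

section \<open>The manifolds \<open>E\<^bsub>h,j\<^esub>\<close> and their tangent bundles\<close>

definition R4xS3 :: "(quat \<times> quat) set" where
  "R4xS3 = UNIV \<times> sphere 0 1"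

text \<open>The tangent bundle of \<open>\<real>\<^sup>4 \<times> S\<^sup>3\<close>, as a subset of \<open>\<real>\<^sup>8 \<times> \<real>\<^sup>8\<close>.\<close>

definition T_R4xS3 :: "((quat \<times> quat) \<times> (quat \<times> quat)) set" where
  "T_R4xS3 = {((v, w), (a, b)). (v, w) \<in> R4xS3 \<and> w \<bullet> b = 0}"

text \<open>The gluing map, given by its formula on all of \<open>(\<real>\<^sup>4 - {0}) \<times> \<real>\<^sup>4\<close>. It maps
  \<open>(\<real>\<^sup>4 - {0}) \<times> S\<^sup>3\<close> bijectively onto itself if \<open>h + j = 1\<close>; only this case is meaningful below.\<close>

definition trans_map :: "int \<Rightarrow> int \<Rightarrow> quat \<times> quat \<Rightarrow> quat \<times> quat" where
  "trans_map h j = (\<lambda>(v, w).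
     ((1 / (norm v)\<^sup>2) *\<^sub>R v, (1 / norm v) *\<^sub>R (qpow v h \<bullet>\<^sub>H w \<bullet>\<^sub>H qpow v j)))"

definition T_trans_map ::
    "int \<Rightarrow> int \<Rightarrow> (quat \<times> quat) \<times> (quat \<times> quat) \<Rightarrow> (quat \<times> quat) \<times> (quat \<times> quat)" where
  "T_trans_map h j = (\<lambda>(x, d). (trans_map h j x, frechet_derivative (trans_map h j) (at x) d))"

datatype copy = First | Second

text \<open>Two disjoint copies of \<open>M\<close>, glued along a bijection \<open>\<phi>\<close> of a subset \<open>D\<close> of \<open>M\<close> onto itself,
  a point \<open>x\<close> of \<open>D\<close> in the first copy being identified with \<open>\<phi> x\<close> in the second copy.\<close>

definition glue_rel :: "'a set \<Rightarrow> 'a set \<Rightarrow> ('a \<Rightarrow> 'a) \<Rightarrow> ((copy \<times> 'a) \<times> (copy \<times> 'a)) set" where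
  "glue_rel M D \<phi> = Id_on (UNIV \<times> M) \<union> {((First, x), (Second, \<phi> x)) |x. x \<in> D}
                                     \<union> {((Second, \<phi> x), (First, x)) |x. x \<in> D}"

type_synonym pnt = "(copy \<times> (quat \<times> quat)) set"
type_synonym tangent = "(copy \<times> ((quat \<times> quat) \<times> (quat \<times> quat))) set"

definition E_rel :: "int \<Rightarrow> int \<Rightarrow> ((copy \<times> (quat \<times> quat)) \<times> (copy \<times> (quat \<times> quat))) set" where
  "E_rel h j = glue_rel R4xS3 {x \<in> R4xS3. fst x \<noteq> 0} (trans_map h j)"

definition E :: "int \<Rightarrow> int \<Rightarrow> pnt set" where
  "E h j = (UNIV \<times> R4xS3) // E_rel h j"

definition TE_rel :: "int \<Rightarrow> int \<Rightarrow>
    ((copy \<times> ((quat \<times> quat) \<times> (quat \<times> quat))) \<times> (copy \<times> ((quat \<times> quat) \<times> (quat \<times> quat)))) set" where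
  "TE_rel h j = glue_rel T_R4xS3 {(x, d) \<in> T_R4xS3. fst x \<noteq> 0} (T_trans_map h j)"

definition TE :: "int \<Rightarrow> int \<Rightarrow> tangent set" where
  "TE h j = (UNIV \<times> T_R4xS3) // TE_rel h j"

text \<open>The point and the tangent vector with given coordinates in copy \<open>i\<close>.\<close>

definition E_pt :: "int \<Rightarrow> int \<Rightarrow> copy \<Rightarrow> quat \<times> quat \<Rightarrow> pnt" where
  "E_pt h j i x = E_rel h j `` {(i, x)}"

definition TE_vec :: "int \<Rightarrow> int \<Rightarrow> copy \<Rightarrow> quat \<times> quat \<Rightarrow> quat \<times> quat \<Rightarrow> tangent" where
  "TE_vec h j i x d = TE_rel h j `` {(i, (x, d))}"

text \<open>The bundle projection \<open>TE \<rightarrow> E\<close>: forgetting the vector component in every representative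
  of a class.\<close>

definition TE_proj :: "tangent \<Rightarrow> pnt" where
  "TE_proj \<zeta> = (\<lambda>(i, (x, d)). (i, x)) ` \<zeta>"

section \<open>Vector fields, integral curves, periods\<close>

definition smooth_vector_field :: "int \<Rightarrow> int \<Rightarrow> (pnt \<Rightarrow> tangent) \<Rightarrow> bool" where
  "smooth_vector_field h j X \<longleftrightarrow>
     (\<forall>p \<in> E h j. X p \<in> TE h j \<and> TE_proj (X p) = p) \<and>
     (\<forall>i. \<exists>V. smooth_on R4xS3 V \<and>
        (\<forall>x\<in>R4xS3. (x, V x) \<in> T_R4xS3 \<and> X (E_pt h j i x) = TE_vec h j i x (V x)))"

definition nowhere_vanishing :: "int \<Rightarrow> int \<Rightarrow> (pnt \<Rightarrow> tangent) \<Rightarrow> bool" where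
  "nowhere_vanishing h j X \<longleftrightarrow>
     (\<forall>i. \<forall>x\<in>R4xS3. X (E_pt h j i x) \<noteq> TE_vec h j i x 0)"

text \<open>The velocity at time \<open>t\<close> of a curve \<open>\<gamma>\<close> in \<open>E\<close>, computed in a copy of
  \<open>\<real>\<^sup>4 \<times> S\<^sup>3\<close> containing \<open>\<gamma>\<close> near \<open>t\<close>.\<close>

definition has_velocity :: "int \<Rightarrow> int \<Rightarrow> (real \<Rightarrow> pnt) \<Rightarrow> tangent \<Rightarrow> real \<Rightarrow> bool" where
  "has_velocity h j \<gamma> \<zeta> t \<longleftrightarrow>
     (\<exists>i c d. (\<forall>\<^sub>F s in nhds t. c s \<in> R4xS3 \<and> \<gamma> s = E_pt h j i (c s)) \<and>
        (c has_vector_derivative d) (at t) \<and> \<zeta> = TE_vec h j i (c t) d)"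

definition integral_curve :: "int \<Rightarrow> int \<Rightarrow> (pnt \<Rightarrow> tangent) \<Rightarrow> (real \<Rightarrow> pnt) \<Rightarrow> bool" where
  "integral_curve h j X \<gamma> \<longleftrightarrow> (\<forall>t. has_velocity h j \<gamma> (X (\<gamma> t)) t)"

definition closed_curve :: "(real \<Rightarrow> 'a) \<Rightarrow> bool" where
  "closed_curve \<gamma> \<longleftrightarrow> (\<exists>T>0. \<forall>t. \<gamma> (t + T) = \<gamma> t)"

text \<open>Integral curves are parametrised by all of \<open>\<real>\<close>; that there is one through every point
  (automatic, by compactness of \<open>E\<close>) is required explicitly, so that the condition on all integral
  curves also covers the maximal ones.\<close>

definition foliation_by_circles :: "int \<Rightarrow> int \<Rightarrow> (pnt \<Rightarrow> tangent) \<Rightarrow> bool" where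
  "foliation_by_circles h j X \<longleftrightarrow>
     nowhere_vanishing h j X \<and>
     (\<forall>p \<in> E h j. \<exists>\<gamma>. integral_curve h j X \<gamma> \<and> \<gamma> 0 = p) \<and>
     (\<forall>\<gamma>. integral_curve h j X \<gamma> \<longrightarrow> closed_curve \<gamma>)"

text \<open>For a smooth nowhere vanishing field with closed integral curves the following \<open>THE\<close> and
  \<open>LEAST\<close> exist, by uniqueness of integral curves and since these are continuous and not constant.\<close>

definition minimal_period :: "(real \<Rightarrow> 'a) \<Rightarrow> real" where
  "minimal_period \<gamma> = (LEAST T. 0 < T \<and> (\<forall>t. \<gamma> (t + T) = \<gamma> t))"

definition period :: "int \<Rightarrow> int \<Rightarrow> (pnt \<Rightarrow> tangent) \<Rightarrow> pnt \<Rightarrow> real" where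
  "period h j X p = minimal_period (THE \<gamma>. integral_curve h j X \<gamma> \<and> \<gamma> 0 = p)"

definition unbounded_periods :: "int \<Rightarrow> int \<Rightarrow> (pnt \<Rightarrow> tangent) \<Rightarrow> bool" where
  "unbounded_periods h j X \<longleftrightarrow> \<not> bdd_above (period h j X ` E h j)"

end

theory Submission
  imports Defs
begin

text \<open>The field is a perturbation of a free circle action, following Thurston's form of Sullivan's
  counterexample to the periodic orbit conjecture.

  Left multiplication of \<open>w\<close> by \<open>e\<^sup>i\<^sup>t\<close> commutes with the gluing map of \<open>E\<^bsub>0,1\<^esub>\<close>, so it is a free circle
  action there. It is changed inside one invariant open set only, the set of all points of the
  first copy where the complex numbers \<open>v\<^sub>1, v\<^sub>2, w\<^sub>1\<close> in \<open>v = v\<^sub>1 + v\<^sub>2 j\<close>, \<open>w = w\<^sub>1 + w\<^sub>2 j\<close> are nonzero. With the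
  angles \<open>2 \<pi> x, y, \<phi>\<close> of these numbers and \<open>\<eta> = (ln \<bar>v\<^sub>1\<bar>, ln \<bar>v\<^sub>2\<bar>, w\<^sub>2 / w\<^sub>1)\<close> as coordinates, this set
  is \<open>T\<^sup>3 \<times> \<real>\<^sup>4\<close>, and the action moves only \<open>\<phi>\<close>.

  On the universal cover put \<open>\<zeta> = g(x, y) \<eta>\<close>, where \<open>g\<close> takes values in the unit quaternions, has
  period \<open>2 \<pi>\<close> in \<open>y\<close> and satisfies \<open>g(x + 1, y) = e\<^sup>2\<^sup>i\<^sup>y g(x, y)\<close>; such a \<open>g\<close> exists because the loop
  \<open>e\<^sup>2\<^sup>i\<^sup>y\<close> is contractible in \<open>S\<^sup>3\<close>. For \<open>r, s\<close> depending only on \<open>\<bar>\<zeta>\<bar>\<^sup>2\<close> the field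
  \<open>\<phi>' = r\<^sup>2\<close>, \<open>x' = r s cos \<phi>\<close>, \<open>y' = r s sin \<phi>\<close>, \<open>\<zeta>' = (2 x y' - s\<^sup>2) i \<zeta>\<close>
  is invariant under the deck transformations, since the shift of \<open>x\<close> rotates \<open>\<zeta>\<close> by \<open>e\<^sup>2\<^sup>i\<^sup>y\<close>. If \<open>r\<close> is not
  \<open>0\<close>, the point \<open>(x, y)\<close> runs through a circle of radius \<open>s / r\<close> while \<open>\<phi>\<close> makes one turn. The term
  \<open>2 x y'\<close> then turns \<open>\<zeta>\<close> by twice the enclosed area, that is, by \<open>2 \<pi> s\<^sup>2 / r\<^sup>2\<close>, and the term \<open>s\<^sup>2\<close> turns it back
  by the same angle during the time \<open>2 \<pi> / r\<^sup>2\<close>. So the orbit closes up, with minimal period \<open>2 \<pi> / r\<^sup>2\<close>.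
  If \<open>r = 0\<close> and \<open>s = 1\<close>, only \<open>\<zeta>\<close> rotates, with period \<open>2 \<pi>\<close>. Taking \<open>s\<close> to be a bump function
  of \<open>\<bar>\<zeta>\<bar>\<^sup>2\<close> with maximum \<open>1\<close>, attained at \<open>\<bar>\<zeta>\<bar> = 1\<close> only, and \<open>r = 1 - s\<close>, all orbits are closed, their periods tend to
  infinity as \<open>\<bar>\<zeta>\<bar>\<close> tends to \<open>1\<close>, and the field is the original one for \<open>\<bar>\<zeta>\<bar>\<^sup>2 \<ge> 2\<close>.

  Closed orbits and smoothness on the chart are \<open>chart_flow_closed\<close>, \<open>chart_flow_unbounded\<close> and
  \<open>chart_field_smooth\<close>. The locale \<open>glued_flow\<close> carries a flow on the first copy that agrees with a circle action
  on the zero fibre and near infinity over to the glued manifold; the uniqueness of integral curves,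
  on which both the closedness of all of them and the value of the period rest, is
  \<open>integral_curve_unique\<close>. Quaternion conjugation interchanges the two orders of multiplication and
  turns the result for \<open>E\<^bsub>0,1\<^esub>\<close> into that for \<open>E\<^bsub>1,0\<^esub>\<close>.\<close>

section \<open>Smooth maps on open sets\<close>

lemma Ck_on_cong:
  assumes "open U" "\<And>x. x \<in> U \<Longrightarrow> f x = g x"
  shows "Ck_on k U f \<longleftrightarrow> Ck_on k U g"
  using assms(2)
proof (induction k arbitrary: f g)
  case 0
  then show ?case using continuous_on_cong[of U U f g] by simp
next
  case (Suc k)
  have hd: "(f has_derivative D) (at x) \<longleftrightarrow> (g has_derivative D) (at x)" if "x \<in> U" for x D
    using has_derivative_transform_within_open[of f D x UNIV U g] has_derivative_transform_within_open[of g D x UNIV U f]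
      that assms(1) Suc.prems by auto
  have fd: "frechet_derivative f (at x) = frechet_derivative g (at x)" if "x \<in> U" for x
    unfolding frechet_derivative_def using hd[OF that] by simp
  have 1: "f differentiable (at x) \<longleftrightarrow> g differentiable (at x)" if "x \<in> U" for x
    unfolding differentiable_def using hd[OF that] by simp
  have 2: "Ck_on k U (\<lambda>x. frechet_derivative f (at x) v) \<longleftrightarrow> Ck_on k U (\<lambda>x. frechet_derivative g (at x) v)" for v
    by (rule Suc.IH) (simp add: fd)
  show ?case unfolding Ck_on.simps using 1 2 by blast
qed

lemma Ck_on_subset: "Ck_on k U f \<Longrightarrow> W \<subseteq> U \<Longrightarrow> Ck_on k W f"
  by (induction k arbitrary: f) (auto intro: continuous_on_subset)

lemma Ck_on_SucI:
  assumes "open U" "\<And>x. x \<in> U \<Longrightarrow> (f has_derivative f' x) (at x)"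
    and "\<And>v. Ck_on k U (\<lambda>x. f' x v)"
  shows "Ck_on (Suc k) U f"
proof -
  have "frechet_derivative f (at x) = f' x" if "x \<in> U" for x
    using frechet_derivative_at[OF assms(2)[OF that]] by simp
  then have "Ck_on k U (\<lambda>x. frechet_derivative f (at x) v)" for v
    using Ck_on_cong[OF assms(1), of "\<lambda>x. frechet_derivative f (at x) v" "\<lambda>x. f' x v"] assms(3) by metis
  then show ?thesis using assms(2) by (auto simp: differentiable_def)
qed

lemma Ck_on_Suc_hd:
  "Ck_on (Suc k) U f \<Longrightarrow> x \<in> U \<Longrightarrow> (f has_derivative frechet_derivative f (at x)) (at x)"
  by (simp add: frechet_derivative_works[symmetric])

lemma Ck_on_pred: "Ck_on (Suc k) U f \<Longrightarrow> Ck_on k U f"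
proof (induction k arbitrary: f)
  case 0
  then show ?case
    by (auto intro!: continuous_at_imp_continuous_on differentiable_imp_continuous_within)
next
  case (Suc k)
  have "Ck_on k U (\<lambda>x. frechet_derivative f (at x) v)" for v
    using iffD1[OF Ck_on.simps(2) Suc.prems] by (intro Suc.IH) blast
  then show ?case using iffD1[OF Ck_on.simps(2) Suc.prems] iffD2[OF Ck_on.simps(2)[of k U f]] by blast
qed

lemma Ck_on_const [simp]: "Ck_on k U (\<lambda>x. c)"
  by (induction k arbitrary: c) auto

lemma Ck_on_add:
  assumes "open U" "Ck_on k U f" "Ck_on k U g"
  shows "Ck_on k U (\<lambda>x. f x + g x)"
  using assms(2,3)
proof (induction k arbitrary: f g)
  case (Suc k)
  show ?case
    by (rule Ck_on_SucI[OF assms(1), where f' = "\<lambda>x v. frechet_derivative f (at x) v + frechet_derivative g (at x) v"])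
       (rule has_derivative_add[OF Ck_on_Suc_hd[OF Suc.prems(1)] Ck_on_Suc_hd[OF Suc.prems(2)]], assumption, assumption,
        rule Suc.IH, use Suc.prems in auto)
qed (auto intro: continuous_on_add)

lemma Ck_on_sum:
  assumes "open U" "\<And>i. i \<in> I \<Longrightarrow> Ck_on k U (f i)"
  shows "Ck_on k U (\<lambda>x. \<Sum>i\<in>I. f i x)"
  using assms(2) by (induction I rule: infinite_finite_induct) (auto intro: Ck_on_add assms(1))

lemma Ck_on_bilinear:
  assumes "open U" "bounded_bilinear h" "Ck_on k U f" "Ck_on k U g"
  shows "Ck_on k U (\<lambda>x. h (f x) (g x))"
  using assms(3,4)
proof (induction k arbitrary: f g)
  case 0
  then show ?case using bounded_bilinear.continuous_on[OF assms(2)] by auto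
next
  case (Suc k)
  have D: "Ck_on k U (\<lambda>x. frechet_derivative f (at x) v)" "Ck_on k U (\<lambda>x. frechet_derivative g (at x) v)" for v
    using Suc.prems by simp_all
  show ?case
    by (rule Ck_on_SucI[OF assms(1), where f' = "\<lambda>x v. h (f x) (frechet_derivative g (at x) v) + h (frechet_derivative f (at x) v) (g x)"])
       (rule bounded_bilinear.FDERIV[OF assms(2) Ck_on_Suc_hd[OF Suc.prems(1)] Ck_on_Suc_hd[OF Suc.prems(2)]], assumption, assumption,
        rule Ck_on_add[OF assms(1) Suc.IH[OF Ck_on_pred[OF Suc.prems(1)] D(2)] Suc.IH[OF D(1) Ck_on_pred[OF Suc.prems(2)]]])
qed

lemma Ck_on_linear:
  assumes "open U" "bounded_linear h" "Ck_on k U f"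
  shows "Ck_on k U (\<lambda>x. h (f x))"
  using assms(3)
proof (induction k arbitrary: f)
  case 0
  then show ?case using bounded_linear.continuous_on[OF assms(2)] by auto
next
  case (Suc k)
  show ?case
    by (rule Ck_on_SucI[OF assms(1), where f' = "\<lambda>x v. h (frechet_derivative f (at x) v)"])
       (rule bounded_linear.has_derivative[OF assms(2) Ck_on_Suc_hd[OF Suc.prems]], assumption,
        rule Suc.IH, use Suc.prems in auto)
qed

lemma Ck_on_id [simp]: "Ck_on k U (\<lambda>x. x)"
proof (cases k)
  case (Suc n)
  have "Ck_on n U (\<lambda>x. frechet_derivative (\<lambda>x. x) (at x) v)" for v :: 'a
    by (simp add: frechet_derivative_ident)
  then show ?thesis using Suc by simp
qed simp

lemma linear_eq_sum_Basis:
  fixes f :: "'a::euclidean_space \<Rightarrow> 'b::real_vector"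
  assumes "linear f"
  shows "f w = (\<Sum>b\<in>Basis. (w \<bullet> b) *\<^sub>R f b)"
proof -
  have "f w = f (\<Sum>b\<in>Basis. (w \<bullet> b) *\<^sub>R b)" by (simp only: euclidean_representation)
  then show ?thesis by (simp add: linear_sum[OF assms] linear_cmul[OF assms])
qed

text \<open>Expanding the derivative of the composite in a basis of the intermediate space writes it as a
  finite sum of products, in which the directions at which the derivative of \<open>g\<close> is taken are constant.
  This is the form to which the induction hypothesis applies.\<close>

lemma Ck_on_compose:
  fixes g :: "'b::euclidean_space \<Rightarrow> 'c::real_normed_vector" and f :: "'a::real_normed_vector \<Rightarrow> 'b"
  assumes "open U" "Ck_on k W g" "Ck_on k U f" "f ` U \<subseteq> W"
  shows "Ck_on k U (\<lambda>x. g (f x))"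
  using assms(2,3)
proof (induction k arbitrary: g)
  case 0
  then show ?case using continuous_on_compose2[of W g U f] assms(4) by auto
next
  case (Suc k)
  let ?f' = "\<lambda>x v. \<Sum>b\<in>Basis. (frechet_derivative f (at x) v \<bullet> b) *\<^sub>R frechet_derivative g (at (f x)) b"
  have "((\<lambda>x. g (f x)) has_derivative ?f' x) (at x)" if x: "x \<in> U" for x
  proof -
    have fx: "f x \<in> W" using x assms(4) by auto
    have g: "(g has_derivative frechet_derivative g (at (f x))) (at (f x))"
      using Ck_on_Suc_hd[OF Suc.prems(1) fx] .
    have "((\<lambda>x. g (f x)) has_derivative (\<lambda>v. frechet_derivative g (at (f x)) (frechet_derivative f (at x) v))) (at x)"
      using has_derivative_compose[OF Ck_on_Suc_hd[OF Suc.prems(2) x] g] .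
    moreover have "(\<lambda>v. frechet_derivative g (at (f x)) (frechet_derivative f (at x) v)) = ?f' x"
      using linear_eq_sum_Basis[OF has_derivative_linear[OF g]] by (intro ext) blast
    ultimately show ?thesis by argo
  qed
  moreover have "Ck_on k U (\<lambda>x. ?f' x v)" for v
  proof (rule Ck_on_sum[OF assms(1)], rule Ck_on_bilinear[OF assms(1) bounded_bilinear_scaleR])
    fix b :: 'b
    show "Ck_on k U (\<lambda>x. frechet_derivative f (at x) v \<bullet> b)"
      by (rule Ck_on_linear[OF assms(1) bounded_linear_inner_left]) (use Suc.prems(2) in simp)
    show "Ck_on k U (\<lambda>x. frechet_derivative g (at (f x)) b)"
    proof (rule Suc.IH[of "\<lambda>y. frechet_derivative g (at y) b", OF _ Ck_on_pred[OF Suc.prems(2)]])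
      show "Ck_on k W (\<lambda>y. frechet_derivative g (at y) b)" using Suc.prems(1) by simp
    qed
  qed
  ultimately show ?case using Ck_on_SucI[OF assms(1), of "\<lambda>x. g (f x)" ?f'] by blast
qed

definition open_smooth :: "'a::real_normed_vector set \<Rightarrow> ('a \<Rightarrow> 'b::real_normed_vector) \<Rightarrow> bool" where
  "open_smooth U f \<longleftrightarrow> open U \<and> (\<forall>k. Ck_on k U f)"

named_theorems open_smooth_intros

lemma open_smooth_open: "open_smooth U f \<Longrightarrow> open U" by (simp add: open_smooth_def)
lemma open_smooth_subset: "open_smooth U f \<Longrightarrow> W \<subseteq> U \<Longrightarrow> open W \<Longrightarrow> open_smooth W f"
  by (auto simp: open_smooth_def intro: Ck_on_subset)
lemma open_smooth_cong: "open_smooth U f \<Longrightarrow> (\<And>x. x \<in> U \<Longrightarrow> f x = g x) \<Longrightarrow> open_smooth U g"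
  unfolding open_smooth_def using Ck_on_cong[of U f g] by blast
lemma open_smooth_const [open_smooth_intros]: "open U \<Longrightarrow> open_smooth U (\<lambda>x. c)" by (simp add: open_smooth_def)
lemma open_smooth_id [open_smooth_intros]: "open U \<Longrightarrow> open_smooth U (\<lambda>x. x)" by (simp add: open_smooth_def)
lemma open_smooth_linear: "bounded_linear h \<Longrightarrow> open_smooth U f \<Longrightarrow> open_smooth U (\<lambda>x. h (f x))"
  by (auto simp: open_smooth_def intro: Ck_on_linear)
lemma open_smooth_bilinear: "bounded_bilinear h \<Longrightarrow> open_smooth U f \<Longrightarrow> open_smooth U g \<Longrightarrow> open_smooth U (\<lambda>x. h (f x) (g x))"
  by (auto simp: open_smooth_def intro: Ck_on_bilinear)
lemma open_smooth_compose:
  fixes g :: "'b::euclidean_space \<Rightarrow> 'c::real_normed_vector"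
  assumes "open_smooth W g" "open_smooth U f" "\<And>x. x \<in> U \<Longrightarrow> f x \<in> W"
  shows "open_smooth U (\<lambda>x. g (f x))"
  unfolding open_smooth_def
proof (intro conjI allI)
  show "open U" using assms(2) by (rule open_smooth_open)
  show "Ck_on k U (\<lambda>x. g (f x))" for k
    by (rule Ck_on_compose[of U k W g f]) (use assms in \<open>auto simp only: open_smooth_def\<close>)
qed
lemma open_smooth_sum [open_smooth_intros]: "open U \<Longrightarrow> (\<And>i. i \<in> I \<Longrightarrow> open_smooth U (f i)) \<Longrightarrow> open_smooth U (\<lambda>x. \<Sum>i\<in>I. f i x)"
  by (auto simp: open_smooth_def intro: Ck_on_sum)
lemma open_smooth_add [open_smooth_intros]: "open_smooth U f \<Longrightarrow> open_smooth U g \<Longrightarrow> open_smooth U (\<lambda>x. f x + g x)"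
  by (auto simp: open_smooth_def intro: Ck_on_add)
lemmas open_smooth_scaleR [open_smooth_intros] = open_smooth_bilinear[OF bounded_bilinear_scaleR]
  and open_smooth_mult [open_smooth_intros] = open_smooth_bilinear[OF bounded_bilinear_mult]
  and open_smooth_inner [open_smooth_intros] = open_smooth_bilinear[OF bounded_bilinear_inner]
  and open_smooth_uminus [open_smooth_intros] = open_smooth_linear[OF bounded_linear_minus[OF bounded_linear_ident]]
  and open_smooth_fst [open_smooth_intros] = open_smooth_linear[OF bounded_linear_fst]
  and open_smooth_snd [open_smooth_intros] = open_smooth_linear[OF bounded_linear_snd]
  and open_smooth_nth [open_smooth_intros] = open_smooth_linear[OF bounded_linear_vec_nth]
lemma open_smooth_diff [open_smooth_intros]: "open_smooth U f \<Longrightarrow> open_smooth U g \<Longrightarrow> open_smooth U (\<lambda>x. f x - g x)"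
  using open_smooth_add[OF _ open_smooth_uminus, of U f g] by simp
lemma open_smooth_Pair [open_smooth_intros]: assumes "open_smooth U f" "open_smooth U g" shows "open_smooth U (\<lambda>x. (f x, g x))"
proof -
  have "bounded_linear (\<lambda>a::'b. (a, 0::'c))" "bounded_linear (\<lambda>a::'c. (0::'b, a))"
    by (auto intro!: bounded_linear_Pair)
  from open_smooth_add[OF open_smooth_linear[OF this(1) assms(1)] open_smooth_linear[OF this(2) assms(2)]] show ?thesis by simp
qed
lemma open_smooth_power [open_smooth_intros]:
  fixes f :: "'a::real_normed_vector \<Rightarrow> 'b::{real_normed_algebra_1}"
  assumes "open_smooth U f" shows "open_smooth U (\<lambda>x. f x ^ n)"
proof (induction n)
  case 0 show ?case using open_smooth_const[OF open_smooth_open[OF assms], of 1] by simp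
next
  case (Suc n) show ?case using open_smooth_mult[OF assms Suc] by simp
qed

lemma Ck_on_Suc_realI:
  fixes f :: "real \<Rightarrow> 'b::real_normed_vector"
  assumes "open U" "\<And>x. x \<in> U \<Longrightarrow> (f has_vector_derivative f' x) (at x)" "Ck_on k U f'"
  shows "Ck_on (Suc k) U f"
  using assms
  by (intro Ck_on_SucI[where f' = "\<lambda>x v. v *\<^sub>R f' x"])
     (simp_all del: Ck_on.simps add: has_vector_derivative_def Ck_on_bilinear[OF assms(1) bounded_bilinear_scaleR])

text \<open>For \<open>exp\<close>, \<open>sin\<close>, \<open>cos\<close> and \<open>inverse\<close> the derivative is built from the function itself, so these are
  treated by induction on the order; \<open>ln\<close> and \<open>arctan\<close> are then antiderivatives of smooth functions.\<close>

lemma open_smooth_realI: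
  fixes f :: "real \<Rightarrow> 'b::real_normed_vector"
  assumes "\<And>x. x \<in> U \<Longrightarrow> (f has_vector_derivative f' x) (at x)" "open_smooth U f'"
  shows "open_smooth U f"
proof -
  have "Ck_on k U f" for k
  proof (rule Ck_on_pred, rule Ck_on_Suc_realI)
    show "open U" "Ck_on k U f'" using assms(2) unfolding open_smooth_def by simp_all
  qed (rule assms(1))
  then show ?thesis using assms unfolding open_smooth_def by blast
qed

lemma open_smooth_exp_aux: "open_smooth UNIV (exp :: real \<Rightarrow> real)"
proof -
  have D: "((exp :: real \<Rightarrow> real) has_vector_derivative exp x) (at x)" for x
    unfolding has_real_derivative_iff_has_vector_derivative[symmetric] by (rule DERIV_exp)
  have "Ck_on k UNIV (exp :: real \<Rightarrow> real)" for k
  proof (induction k)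
    case (Suc k)
    show ?case by (rule Ck_on_Suc_realI[OF open_UNIV D Suc])
  qed (auto intro!: continuous_intros)
  then show ?thesis by (simp add: open_smooth_def)
qed

lemma open_smooth_sin_cos_aux: "open_smooth UNIV (sin :: real \<Rightarrow> real)" "open_smooth UNIV (cos :: real \<Rightarrow> real)"
proof -
  have Ds: "((sin :: real \<Rightarrow> real) has_vector_derivative cos x) (at x)"
    and Dc: "((cos :: real \<Rightarrow> real) has_vector_derivative - sin x) (at x)" for x
    unfolding has_real_derivative_iff_has_vector_derivative[symmetric] by (auto intro!: derivative_eq_intros)
  have "Ck_on k UNIV (sin :: real \<Rightarrow> real) \<and> Ck_on k UNIV (cos :: real \<Rightarrow> real)" for k
  proof (induction k)
    case (Suc k)
    have "Ck_on k UNIV (\<lambda>x::real. - sin x)"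
      by (rule Ck_on_linear[OF open_UNIV bounded_linear_minus[OF bounded_linear_ident] conjunct1[OF Suc]])
    then show ?case
      using Ck_on_Suc_realI[OF open_UNIV Ds, of k] Ck_on_Suc_realI[OF open_UNIV Dc, of k] Suc by simp
  qed (auto intro!: continuous_intros)
  then show "open_smooth UNIV (sin :: real \<Rightarrow> real)" "open_smooth UNIV (cos :: real \<Rightarrow> real)" by (auto simp add: open_smooth_def)
qed

lemma open_smooth_inverse_aux: "open_smooth (-{0}) (inverse :: real \<Rightarrow> real)"
proof -
  have o: "open (-{0::real})" by (simp add: open_Compl)
  have D: "((inverse :: real \<Rightarrow> real) has_vector_derivative - (inverse x * inverse x)) (at x)" if "x \<in> - {0}" for x
    unfolding has_real_derivative_iff_has_vector_derivative[symmetric] using that by (auto intro!: derivative_eq_intros)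
  have "Ck_on k (-{0}) (inverse :: real \<Rightarrow> real)" for k
  proof (induction k)
    case (Suc k)
    have "Ck_on k (-{0}) (\<lambda>x::real. - (inverse x * inverse x))"
      by (rule Ck_on_linear[OF o bounded_linear_minus[OF bounded_linear_ident]
        Ck_on_bilinear[OF o bounded_bilinear_mult Suc Suc]])
    then show ?case by (intro Ck_on_Suc_realI[where f' = "\<lambda>x. - (inverse x * inverse x)"] o D)
  qed (auto intro!: continuous_intros)
  then show ?thesis using o by (simp add: open_smooth_def)
qed

lemmas open_smooth_exp [open_smooth_intros] = open_smooth_compose[OF open_smooth_exp_aux _ UNIV_I]
  and open_smooth_sin [open_smooth_intros] = open_smooth_compose[OF open_smooth_sin_cos_aux(1) _ UNIV_I]
  and open_smooth_cos [open_smooth_intros] = open_smooth_compose[OF open_smooth_sin_cos_aux(2) _ UNIV_I]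

lemma open_smooth_inverse [open_smooth_intros]:
  "open_smooth U f \<Longrightarrow> (\<And>x. x \<in> U \<Longrightarrow> f x \<noteq> 0) \<Longrightarrow> open_smooth U (\<lambda>x. inverse (f x :: real))"
  by (rule open_smooth_compose[OF open_smooth_inverse_aux]) auto

lemma open_smooth_divide [open_smooth_intros]:
  "open_smooth U g \<Longrightarrow> open_smooth U f \<Longrightarrow> (\<And>x. x \<in> U \<Longrightarrow> f x \<noteq> 0) \<Longrightarrow> open_smooth U (\<lambda>x. g x / (f x :: real))"
  unfolding divide_inverse by (intro open_smooth_intros)

lemma open_smooth_ln [open_smooth_intros]:
  assumes "open_smooth U f" "\<And>x. x \<in> U \<Longrightarrow> f x > 0" shows "open_smooth U (\<lambda>x. ln (f x :: real))"
proof -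
  have "open_smooth {0<..} (ln :: real \<Rightarrow> real)"
    by (rule open_smooth_realI[where f' = inverse])
       (use DERIV_ln in \<open>auto simp: has_real_derivative_iff_has_vector_derivative[symmetric] intro!: open_smooth_subset[OF open_smooth_inverse_aux]\<close>)
  from open_smooth_compose[OF this assms(1)] assms(2) show ?thesis by auto
qed

lemma open_smooth_arctan [open_smooth_intros]:
  assumes "open_smooth U f" shows "open_smooth U (\<lambda>x. arctan (f x :: real))"
proof -
  have "1 + x * x \<noteq> 0" for x :: real using zero_le_square[of x] by linarith
  then have "open_smooth UNIV (\<lambda>x::real. inverse (1 + x * x))" by (intro open_smooth_intros) auto
  then have "open_smooth UNIV (arctan :: real \<Rightarrow> real)"
    by (rule open_smooth_realI[rotated])
       (use DERIV_arctan in \<open>simp add: has_real_derivative_iff_has_vector_derivative[symmetric] power2_eq_square\<close>)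
  from open_smooth_compose[OF this assms(1)] show ?thesis by auto
qed

lemma open_smooth_sqrt [open_smooth_intros]:
  assumes "open_smooth U f" "\<And>x. x \<in> U \<Longrightarrow> f x > 0" shows "open_smooth U (\<lambda>x. sqrt (f x :: real))"
proof (rule open_smooth_cong)
  show "open_smooth U (\<lambda>x. exp (ln (f x) * (1/2)))" using assms by (intro open_smooth_intros open_smooth_open[OF assms(1)]) auto
  show "exp (ln (f x) * (1/2)) = sqrt (f x)" if "x \<in> U" for x
    using assms(2)[OF that] by (simp add: powr_half_sqrt[symmetric] powr_def mult.commute)
qed

lemma open_smooth_norm [open_smooth_intros]:
  fixes f :: "'a::real_normed_vector \<Rightarrow> 'b::real_inner"
  assumes "open_smooth U f" "\<And>x. x \<in> U \<Longrightarrow> f x \<noteq> 0" shows "open_smooth U (\<lambda>x. norm (f x))"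
  unfolding norm_eq_sqrt_inner using assms by (intro open_smooth_intros) auto

lemma open_smooth_has_derivative:
  "open_smooth U f \<Longrightarrow> x \<in> U \<Longrightarrow> (f has_derivative frechet_derivative f (at x)) (at x)"
  unfolding open_smooth_def using Ck_on_Suc_hd[of 0] by blast

text \<open>The tool for pushing a vector field forward along a map that has a smooth local section \<open>s\<close>: the
  base point and the direction of the derivative vary together.\<close>

lemma open_smooth_frechet:
  fixes f :: "'a::euclidean_space \<Rightarrow> 'b::real_normed_vector"
  assumes f: "open_smooth W f" and s: "open_smooth U s" and v: "open_smooth U v" and sW: "\<And>x. x \<in> U \<Longrightarrow> s x \<in> W"
  shows "open_smooth U (\<lambda>x. frechet_derivative f (at (s x)) (v x))"
proof (rule open_smooth_cong)
  have "Ck_on k W (\<lambda>x. frechet_derivative f (at x) b)" for k b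
  proof -
    have "Ck_on (Suc k) W f" using f by (simp only: open_smooth_def)
    then show ?thesis by simp
  qed
  then have "open_smooth W (\<lambda>x. frechet_derivative f (at x) b)" for b
    using open_smooth_open[OF f] by (simp add: open_smooth_def)
  from open_smooth_compose[OF this s sW] have "open_smooth U (\<lambda>x. frechet_derivative f (at (s x)) b)" for b .
  then show "open_smooth U (\<lambda>x. \<Sum>b\<in>Basis. (v x \<bullet> b) *\<^sub>R frechet_derivative f (at (s x)) b)"
    by (intro open_smooth_sum open_smooth_scaleR open_smooth_inner open_smooth_const v open_smooth_open[OF v])
  fix x assume "x \<in> U"
  then have "linear (frechet_derivative f (at (s x)))"
    using open_smooth_has_derivative[OF f sW] has_derivative_linear by blast
  then show "(\<Sum>b\<in>Basis. (v x \<bullet> b) *\<^sub>R frechet_derivative f (at (s x)) b) = frechet_derivative f (at (s x)) (v x)"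
    using linear_eq_sum_Basis[of "frechet_derivative f (at (s x))" "v x"] by simp
qed

lemma open_smooth_locally:
  assumes "open U" "\<And>x. x \<in> U \<Longrightarrow> \<exists>W. x \<in> W \<and> W \<subseteq> U \<and> open_smooth W f"
  shows "open_smooth U f"
proof -
  have "Ck_on k U f" if "\<And>x. x \<in> U \<Longrightarrow> \<exists>W. x \<in> W \<and> W \<subseteq> U \<and> open W \<and> Ck_on k W f" for k and f :: "'a \<Rightarrow> 'b"
    using that
  proof (induction k arbitrary: f)
    case 0
    have "isCont f x" if "x \<in> U" for x
    proof -
      obtain W where "x \<in> W" "open W" "Ck_on 0 W f" using 0[OF \<open>x \<in> U\<close>] by (elim exE conjE)
      then show ?thesis by (simp add: continuous_on_eq_continuous_at)
    qed
    then show ?case by (simp add: continuous_at_imp_continuous_on)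
  next
    case (Suc k)
    have "f differentiable (at x)" if "x \<in> U" for x
    proof -
      obtain W where "x \<in> W" "Ck_on (Suc k) W f" using Suc.prems[OF \<open>x \<in> U\<close>] by (elim exE conjE)
      then show ?thesis by simp
    qed
    moreover have "Ck_on k U (\<lambda>x. frechet_derivative f (at x) v)" for v
    proof (rule Suc.IH)
      fix x assume "x \<in> U"
      obtain W where "x \<in> W" "W \<subseteq> U" "open W" "Ck_on (Suc k) W f" using Suc.prems[OF \<open>x \<in> U\<close>] by (elim exE conjE)
      then show "\<exists>W. x \<in> W \<and> W \<subseteq> U \<and> open W \<and> Ck_on k W (\<lambda>x. frechet_derivative f (at x) v)"
        by (intro exI[of _ W]) simp
    qed
    ultimately show ?case by simp
  qed
  moreover have "\<exists>W. x \<in> W \<and> W \<subseteq> U \<and> open W \<and> Ck_on k W f" if x: "x \<in> U" for x k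
  proof -
    obtain W where "x \<in> W" "W \<subseteq> U" "open_smooth W f" using assms(2)[OF x] by (elim exE conjE)
    then show ?thesis by (intro exI[of _ W]) (simp add: open_smooth_def)
  qed
  ultimately show ?thesis using assms(1) by (simp add: open_smooth_def)
qed

lemma smooth_onI:
  assumes "\<And>x. x \<in> S \<Longrightarrow> \<exists>U g. x \<in> U \<and> open_smooth U g \<and> (\<forall>y\<in>U \<inter> S. g y = f y)"
  shows "smooth_on S f"
  unfolding smooth_on_def using assms[unfolded open_smooth_def] by blast

lemma smooth_onE:
  assumes "smooth_on S f" "x \<in> S"
  obtains U g where "x \<in> U" "open_smooth U g" "\<And>y. y \<in> U \<Longrightarrow> y \<in> S \<Longrightarrow> g y = f y"
proof -
  obtain U g where "open U" "x \<in> U" "\<forall>k. Ck_on k U g" "\<forall>y\<in>U \<inter> S. g y = f y"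
    using bspec[OF assms(1)[unfolded smooth_on_def] assms(2)] by (elim exE conjE)
  then show thesis by (intro that[of U g]) (simp_all add: open_smooth_def)
qed

section \<open>Local uniqueness of integral curves\<close>

lemma open_smooth_continuous_on: "open_smooth U f \<Longrightarrow> continuous_on U f"
  unfolding open_smooth_def using Ck_on.simps(1) by metis

text \<open>Since \<open>\<parallel>DG(x) v\<parallel> \<le> \<parallel>v\<parallel> \<Sum>\<^sub>b \<parallel>DG(x) b\<parallel>\<close> over the standard basis, the operator norm of the derivative is
  bounded near a point as soon as its values at the basis vectors are.\<close>

lemma open_smooth_local_lipschitz:
  fixes G :: "'a::euclidean_space \<Rightarrow> 'b::real_normed_vector"
  assumes G: "open_smooth U G" and x0: "x0 \<in> U"
  obtains e L where "e > 0" "L \<ge> 0" "ball x0 e \<subseteq> U"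
    "\<And>x y. x \<in> ball x0 e \<Longrightarrow> y \<in> ball x0 e \<Longrightarrow> norm (G x - G y) \<le> L * norm (x - y)"
proof -
  let ?D = "\<lambda>x. frechet_derivative G (at x)"
  have U: "open U" using G by (rule open_smooth_open)
  have "continuous_on U (\<lambda>x. ?D x b)" for b
    by (rule open_smooth_continuous_on, rule open_smooth_frechet[OF G])
       (auto intro: open_smooth_id open_smooth_const U)
  then have "isCont (\<lambda>x. ?D x b) x0" for b
    using x0 U continuous_on_eq_continuous_at by blast
  then have "((\<lambda>x. ?D x b) \<longlongrightarrow> ?D x0 b) (nhds x0)" for b
    using tendsto_at_iff_tendsto_nhds[of "\<lambda>x. ?D x b" x0 for b] unfolding isCont_def by blast
  then have "((\<lambda>x. norm (?D x b)) \<longlongrightarrow> norm (?D x0 b)) (nhds x0)" for b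
    by (rule tendsto_norm)
  then have "\<forall>\<^sub>F x in nhds x0. norm (?D x b) < norm (?D x0 b) + 1" for b
    by (rule order_tendstoD) simp
  then have "\<forall>\<^sub>F x in nhds x0. (\<forall>b\<in>Basis. norm (?D x b) < norm (?D x0 b) + 1) \<and> x \<in> U"
    using U x0 by (auto intro!: eventually_conj eventually_ball_finite eventually_nhds_in_open)
  then obtain e where e: "e > 0"
    and eb: "\<And>x. x \<in> ball x0 e \<Longrightarrow> (\<forall>b\<in>Basis. norm (?D x b) < norm (?D x0 b) + 1) \<and> x \<in> U"
    by (force simp: eventually_nhds_metric dist_commute)
  define L where "L = (\<Sum>b\<in>Basis. norm (?D x0 b) + 1)"
  have on: "onorm (?D x) \<le> L" if x: "x \<in> ball x0 e" for x
  proof (rule onorm_bound)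
    show "0 \<le> L" by (auto simp: L_def intro!: sum_nonneg)
    fix v
    have lin: "linear (?D x)" using open_smooth_has_derivative[OF G, of x] eb[OF x] has_derivative_linear by metis
    have "norm (?D x v) \<le> (\<Sum>b\<in>Basis. norm ((v \<bullet> b) *\<^sub>R ?D x b))"
      using linear_eq_sum_Basis[OF lin, of v] norm_sum by metis
    also have "\<dots> \<le> (\<Sum>b\<in>Basis. norm v * (norm (?D x0 b) + 1))"
      using eb[OF x] by (intro sum_mono) (force intro!: mult_mono Basis_le_norm)
    finally show "norm (?D x v) \<le> L * norm v"
      by (simp add: L_def sum_distrib_left mult.commute)
  qed
  show thesis
  proof (rule that[OF e])
    show "0 \<le> L" by (auto simp: L_def intro!: sum_nonneg)
    show "ball x0 e \<subseteq> U" using eb by auto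
    show "norm (G x - G y) \<le> L * norm (x - y)" if "x \<in> ball x0 e" "y \<in> ball x0 e" for x y
    proof (rule differentiable_bound[OF convex_ball _ on that])
      show "(G has_derivative ?D x) (at x within ball x0 e)" if "x \<in> ball x0 e" for x
        using open_smooth_has_derivative[OF G, of x] eb[OF that] has_derivative_at_withinI by metis
    qed
  qed
qed

text \<open>Gronwall's argument: the squared distance \<open>D\<close> of two solutions satisfies \<open>\<bar>D'\<bar> \<le> 2 L D\<close>, so
  \<open>e\<^sup>-\<^sup>2\<^sup>L\<^sup>t D\<close> is nonincreasing and \<open>e\<^sup>2\<^sup>L\<^sup>t D\<close> is nondecreasing, and \<open>D\<close> vanishes at \<open>t\<^sub>0\<close>.\<close>

lemma ode_local_unique:
  fixes c1 c2 :: "real \<Rightarrow> 'a::euclidean_space"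
  assumes G: "open_smooth U G" and U: "c1 t0 \<in> U" and eq: "c1 t0 = c2 t0"
    and c1: "\<forall>\<^sub>F t in nhds t0. (c1 has_vector_derivative G (c1 t)) (at t)"
    and c2: "\<forall>\<^sub>F t in nhds t0. (c2 has_vector_derivative G (c2 t)) (at t)"
  shows "\<forall>\<^sub>F t in nhds t0. c1 t = c2 t"
proof -
  obtain e L where e: "e > 0" and L: "L \<ge> 0" and lip:
    "\<And>x y. x \<in> ball (c1 t0) e \<Longrightarrow> y \<in> ball (c1 t0) e \<Longrightarrow> norm (G x - G y) \<le> L * norm (x - y)"
    using open_smooth_local_lipschitz[OF G U] by metis
  have near: "\<forall>\<^sub>F t in nhds t0. c t \<in> ball (c1 t0) e"
    if "c t0 = c1 t0" "\<forall>\<^sub>F t in nhds t0. (c has_vector_derivative G (c t)) (at t)" for c :: "real \<Rightarrow> 'a"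
  proof -
    have "isCont c t0"
      using eventually_nhds_x_imp_x[OF that(2)] has_vector_derivative_continuous by blast
    then have "(c \<longlongrightarrow> c t0) (nhds t0)" by (simp only: isCont_def tendsto_at_iff_tendsto_nhds)
    then have "(c \<longlongrightarrow> c1 t0) (nhds t0)" by (simp only: that(1))
    then show ?thesis by (rule topological_tendstoD) (use e in auto)
  qed
  have "\<forall>\<^sub>F t in nhds t0. (c1 has_vector_derivative G (c1 t)) (at t) \<and> (c2 has_vector_derivative G (c2 t)) (at t)
      \<and> c1 t \<in> ball (c1 t0) e \<and> c2 t \<in> ball (c1 t0) e"
    using c1 c2 near[of c1] near[of c2] eq by (intro eventually_conj) auto
  then obtain d where d: "d > 0" and
    H: "\<And>t. dist t t0 < d \<Longrightarrow> (c1 has_vector_derivative G (c1 t)) (at t) \<and> (c2 has_vector_derivative G (c2 t)) (at t)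
      \<and> c1 t \<in> ball (c1 t0) e \<and> c2 t \<in> ball (c1 t0) e"
    unfolding eventually_nhds_metric by metis
  define D where "D t = (c1 t - c2 t) \<bullet> (c1 t - c2 t)" for t
  define D' where "D' t = 2 * ((c1 t - c2 t) \<bullet> (G (c1 t) - G (c2 t)))" for t
  have DD: "(D has_real_derivative D' t) (at t)" if "dist t t0 < d" for t
  proof -
    have "((\<lambda>t. c1 t - c2 t) has_vector_derivative G (c1 t) - G (c2 t)) (at t)"
      using H[OF that] by (auto intro!: derivative_intros)
    from bounded_bilinear.has_vector_derivative[OF bounded_bilinear_inner this this]
    show ?thesis unfolding D_def[abs_def] D'_def
      by (simp add: has_real_derivative_iff_has_vector_derivative inner_commute)
  qed
  have D'D: "\<bar>D' t\<bar> \<le> 2 * L * D t" if "dist t t0 < d" for t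
  proof -
    have "\<bar>(c1 t - c2 t) \<bullet> (G (c1 t) - G (c2 t))\<bar> \<le> norm (c1 t - c2 t) * norm (G (c1 t) - G (c2 t))"
      by (rule Cauchy_Schwarz_ineq2)
    also have "\<dots> \<le> norm (c1 t - c2 t) * (L * norm (c1 t - c2 t))"
      using H[OF that] by (intro mult_left_mono lip) auto
    also have "\<dots> = L * D t" by (simp add: D_def dot_square_norm power2_eq_square)
    finally show ?thesis by (simp add: D'_def abs_mult)
  qed
  have punctured: "D t0 = 0" by (simp add: D_def eq)
  have "c1 t = c2 t" if t: "dist t t0 < d" for t
  proof -
    have "D t \<le> 0"
    proof (cases "t0 \<le> t")
      case True
      have "exp (- 2 * L * t) * D t \<le> exp (- 2 * L * t0) * D t0"
      proof (rule DERIV_nonpos_imp_nonincreasing[OF True])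
        fix x assume "t0 \<le> x" "x \<le> t"
        then have x: "dist x t0 < d" using t by (auto simp: dist_real_def)
        have "((\<lambda>t. exp (- 2 * L * t) * D t) has_real_derivative exp (- 2 * L * x) * (D' x - 2 * L * D x)) (at x)"
          by (auto intro!: derivative_eq_intros DD[OF x] simp: algebra_simps)
        moreover have "exp (- 2 * L * x) * (D' x - 2 * L * D x) \<le> 0"
          using D'D[OF x] by (intro mult_nonneg_nonpos) auto
        ultimately show "\<exists>y. ((\<lambda>t. exp (- 2 * L * t) * D t) has_real_derivative y) (at x) \<and> y \<le> 0" by blast
      qed
      then show ?thesis by (simp add: punctured mult_le_0_iff)
    next
      case False
      then have le: "t \<le> t0" by simp
      have "exp (2 * L * t) * D t \<le> exp (2 * L * t0) * D t0"
      proof (rule DERIV_nonneg_imp_nondecreasing[OF le])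
        fix x assume "t \<le> x" "x \<le> t0"
        then have x: "dist x t0 < d" using t by (auto simp: dist_real_def)
        have "((\<lambda>t. exp (2 * L * t) * D t) has_real_derivative exp (2 * L * x) * (D' x + 2 * L * D x)) (at x)"
          by (auto intro!: derivative_eq_intros DD[OF x] simp: algebra_simps)
        moreover have "exp (2 * L * x) * (D' x + 2 * L * D x) \<ge> 0"
          using D'D[OF x] by (intro mult_nonneg_nonneg) auto
        ultimately show "\<exists>y. ((\<lambda>t. exp (2 * L * t) * D t) has_real_derivative y) (at x) \<and> y \<ge> 0" by blast
      qed
      then show ?thesis by (simp add: punctured mult_le_0_iff)
    qed
    then show ?thesis unfolding D_def by (metis inner_ge_zero inner_eq_zero_iff antisym right_minus_eq)
  qed
  then show ?thesis unfolding eventually_nhds_metric using d by blast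
qed

section \<open>Flows on the glued manifold\<close>

abbreviation punctured :: "(quat \<times> quat) set" where "punctured \<equiv> {x. fst x \<noteq> 0}"

lemma open_punctured: "open punctured"
  by (intro open_Collect_neq continuous_intros)

fun other :: "copy \<Rightarrow> copy" where "other First = Second" | "other Second = First"

lemma other_other [simp]: "other (other i) = i" by (cases i) auto
lemma other_neq [simp]: "other i \<noteq> i" "i \<noteq> other i" by (cases i; simp)+
lemma other_cases: "k = i \<or> k = other i" by (cases i; cases k) auto

text \<open>The data on the first copy from which a field on the glued manifold is made. \<open>S\<close> is the inverse
  of the gluing map and \<open>F\<close> a flow with velocity field \<open>V\<close>. The gluing map sends the points near infinity of the first copy to
  points near the zero fibre of the second, so \<open>F\<close> extends over that fibre if it agrees
  near infinity with a flow \<open>R\<close> that commutes with the gluing map. Agreement over \<open>v = 0\<close> ensures that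
  \<open>F\<close> preserves the part of the first copy that is glued.

  A flow is given, and not just a field, because the group law then yields integral curves through
  every point from the velocity at time \<open>0\<close> alone.\<close>

locale glued_flow =
  fixes h j :: int
    and S :: "quat \<times> quat \<Rightarrow> quat \<times> quat"
    and F R :: "real \<Rightarrow> quat \<times> quat \<Rightarrow> quat \<times> quat"
    and V J :: "quat \<times> quat \<Rightarrow> quat \<times> quat"
    and K :: real
  assumes T_open_smooth: "open_smooth punctured (trans_map h j)" and S_open_smooth: "open_smooth punctured S"
    and fst_S: "fst x \<noteq> 0 \<Longrightarrow> fst (S x) = (1 / (norm (fst x))\<^sup>2) *\<^sub>R fst x"
    and T_S: "fst x \<noteq> 0 \<Longrightarrow> trans_map h j (S x) = x"
    and S_T: "fst x \<noteq> 0 \<Longrightarrow> S (trans_map h j x) = x"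
    and norm_snd_T: "fst x \<noteq> 0 \<Longrightarrow> norm (snd (trans_map h j x)) = norm (snd x)"
    and F0: "x \<in> R4xS3 \<Longrightarrow> F 0 x = x"
    and F_add: "x \<in> R4xS3 \<Longrightarrow> F s (F t x) = F (s + t) x"
    and F_M: "x \<in> R4xS3 \<Longrightarrow> F t x \<in> R4xS3"
    and F_V: "x \<in> R4xS3 \<Longrightarrow> ((\<lambda>t. F t x) has_vector_derivative V x) (at 0)"
    and V_smooth: "smooth_on R4xS3 V"
    and V_nz: "x \<in> R4xS3 \<Longrightarrow> V x \<noteq> 0"
    and F_closed: "x \<in> R4xS3 \<Longrightarrow> \<exists>\<tau>>0. F \<tau> x = x"
    and F_unbounded: "\<exists>x\<in>R4xS3. \<exists>\<tau>>B. \<tau> > 0 \<and> F \<tau> x = x \<and> (\<forall>\<tau>'>0. F \<tau>' x = x \<longrightarrow> \<tau> \<le> \<tau>')"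
    and R0: "x \<in> R4xS3 \<Longrightarrow> R 0 x = x"
    and R_add: "x \<in> R4xS3 \<Longrightarrow> R s (R t x) = R (s + t) x"
    and R_M: "x \<in> R4xS3 \<Longrightarrow> R t x \<in> R4xS3"
    and R_J: "x \<in> R4xS3 \<Longrightarrow> ((\<lambda>t. R t x) has_vector_derivative J x) (at 0)"
    and J_open_smooth: "open_smooth UNIV J"
    and J_nz: "x \<in> R4xS3 \<Longrightarrow> J x \<noteq> 0"
    and R_closed: "x \<in> R4xS3 \<Longrightarrow> \<exists>\<tau>>0. R \<tau> x = x"
    and fst_R: "fst (R t x) = fst x"
    and T_R: "fst x \<noteq> 0 \<Longrightarrow> trans_map h j (R t x) = R t (trans_map h j x)"
    and K: "K > 0"
    and F_R: "x \<in> R4xS3 \<Longrightarrow> fst x = 0 \<or> norm (fst x) \<ge> K \<Longrightarrow> F t x = R t x"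
begin

abbreviation "M \<equiv> R4xS3"

text \<open>The coordinate change out of each copy. The two directions enjoy the same properties, so that
  most arguments below treat both copies at once.\<close>

fun change where "change First = trans_map h j" | "change Second = S"

lemma fst_change: "fst x \<noteq> 0 \<Longrightarrow> fst (change i x) = (1 / (norm (fst x))\<^sup>2) *\<^sub>R fst x"
  by (cases i) (auto simp: fst_S trans_map_def split: prod.splits)

lemma fst_change_nz: "fst x \<noteq> 0 \<Longrightarrow> fst (change i x) \<noteq> 0"
  by (simp add: fst_change)

lemma norm_fst_change: "fst x \<noteq> 0 \<Longrightarrow> norm (fst (change i x)) = 1 / norm (fst x)"
  by (simp add: fst_change power2_eq_square)

lemma change_change: "fst x \<noteq> 0 \<Longrightarrow> change (other i) (change i x) = x"
  by (cases i) (auto simp: T_S S_T)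

lemma norm_snd_change: "fst x \<noteq> 0 \<Longrightarrow> norm (snd (change i x)) = norm (snd x)"
  using norm_snd_T[of x] norm_snd_T[of "S x"] T_S[of x] fst_change_nz[of x Second] by (cases i) auto

lemma change_M: "fst x \<noteq> 0 \<Longrightarrow> x \<in> M \<Longrightarrow> change i x \<in> M"
  using norm_snd_change[of x i] by (auto simp: R4xS3_def mem_Times_iff)

lemma change_open_smooth: "open_smooth punctured (change i)" by (cases i) (auto simp: T_open_smooth S_open_smooth)

lemma change_hd: "fst x \<noteq> 0 \<Longrightarrow> (change i has_derivative frechet_derivative (change i) (at x)) (at x)"
  by (rule open_smooth_has_derivative[OF change_open_smooth]) simp

abbreviation "dchange i x \<equiv> frechet_derivative (change i) (at x)"

lemma dchange_dchange: assumes "fst x \<noteq> 0" shows "dchange (other i) (change i x) (dchange i x d) = d"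
proof -
  have 1: "((\<lambda>y. change (other i) (change i y)) has_derivative (\<lambda>d. dchange (other i) (change i x) (dchange i x d))) (at x)"
    using has_derivative_compose[OF change_hd[OF assms] change_hd[OF fst_change_nz[OF assms]]] .
  have 2: "((\<lambda>y. change (other i) (change i y)) has_derivative (\<lambda>d. d)) (at x)"
    by (rule has_derivative_transform_within_open[OF has_derivative_ident open_punctured])
       (use assms in \<open>auto simp: change_change\<close>)
  show ?thesis by (rule fun_cong[OF has_derivative_unique[OF 1 2]])
qed

lemma T_M_iff: "(x, d) \<in> T_R4xS3 \<longleftrightarrow> x \<in> M \<and> snd x \<bullet> snd d = 0"
  by (cases x; cases d) (auto simp: T_R4xS3_def)

text \<open>The coordinate changes preserve the norm of the second component, not only on the sphere; differentiating
  this identity shows that they preserve tangency.\<close>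

lemma dchange_tangent: assumes "(x, d) \<in> T_R4xS3" "fst x \<noteq> 0" shows "(change i x, dchange i x d) \<in> T_R4xS3"
proof -
  have x: "x \<in> M" "snd x \<bullet> snd d = 0" using assms by (auto simp: T_M_iff)
  have 1: "((\<lambda>y. snd (change i y)) has_derivative (\<lambda>d. snd (dchange i x d))) (at x)"
    by (intro derivative_intros change_hd assms)
  have 2: "((\<lambda>y. snd (change i y) \<bullet> snd (change i y)) has_derivative (\<lambda>d. snd (change i x) \<bullet> snd (dchange i x d) + snd (dchange i x d) \<bullet> snd (change i x))) (at x)"
    using has_derivative_inner[OF 1 1] .
  have 3: "((\<lambda>y. snd (change i y) \<bullet> snd (change i y)) has_derivative (\<lambda>d. snd x \<bullet> snd d + snd d \<bullet> snd x)) (at x)"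
  proof (rule has_derivative_transform_within_open[OF _ open_punctured])
    show "((\<lambda>y. snd y \<bullet> snd y) has_derivative (\<lambda>d. snd x \<bullet> snd d + snd d \<bullet> snd x)) (at x)"
      by (intro derivative_eq_intros) auto
  qed (use assms norm_snd_change in \<open>auto simp: dot_square_norm\<close>)
  have "snd (change i x) \<bullet> snd (dchange i x d) + snd (dchange i x d) \<bullet> snd (change i x) = snd x \<bullet> snd d + snd d \<bullet> snd x"
    by (rule fun_cong[OF has_derivative_unique[OF 2 3]])
  then have "snd (change i x) \<bullet> snd (dchange i x d) = 0" using x by (simp add: inner_commute)
  then show ?thesis using x change_M assms by (simp add: T_M_iff)
qed

lemma glue_class_First:
  assumes "x \<in> A"
  shows "glue_rel A D \<phi> `` {(First, x)} = insert (First, x) (if x \<in> D then {(Second, \<phi> x)} else {})"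
  using assms by (auto simp: glue_rel_def)

lemma glue_class_Second:
  assumes "x \<in> A"
  shows "glue_rel A D \<phi> `` {(Second, x)} = insert (Second, x) (Pair First ` {y \<in> D. \<phi> y = x})"
  using assms by (auto simp: glue_rel_def)

lemma E_pt_eq:
  assumes "x \<in> M"
  shows "E_pt h j i x = insert (i, x) (if fst x \<noteq> 0 then {(other i, change i x)} else {})"
proof (cases i)
  case First
  then show ?thesis unfolding E_pt_def E_rel_def First glue_class_First[OF assms] using assms by simp
next
  case Second
  have "{y \<in> {x \<in> M. fst x \<noteq> 0}. trans_map h j y = x} = (if fst x \<noteq> 0 then {S x} else {})"
  proof (cases "fst x = 0")
    case True
    have "fst y = 0" if "trans_map h j y = x" for y
      using fst_change_nz[of y First] that True by (cases "fst y = 0") simp_all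
    then have "{y \<in> {x \<in> M. fst x \<noteq> 0}. trans_map h j y = x} = {}" by blast
    then show ?thesis using True by simp
  next
    case False
    have "y = S x" if "trans_map h j y = x" "fst y \<noteq> 0" for y using S_T[of y] that by simp
    moreover have "S x \<in> M" "fst (S x) \<noteq> 0"
      using change_M[OF False assms, of Second] fst_change_nz[OF False, of Second] by simp_all
    ultimately have "y \<in> {x \<in> M. fst x \<noteq> 0} \<and> trans_map h j y = x \<longleftrightarrow> y = S x" for y
      using T_S[OF False] by blast
    then have "{y \<in> {x \<in> M. fst x \<noteq> 0}. trans_map h j y = x} = {S x}" by blast
    then show ?thesis using False by simp
  qed
  then show ?thesis unfolding E_pt_def E_rel_def Second glue_class_Second[OF assms] by simp
qed

lemma TE_vec_eq:
  assumes "(x, d) \<in> T_R4xS3"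
  shows "TE_vec h j i x d = insert (i, (x, d)) (if fst x \<noteq> 0 then {(other i, (change i x, dchange i x d))} else {})"
proof (cases i)
  case First
  then show ?thesis
    unfolding TE_vec_def TE_rel_def First glue_class_First[OF assms] using assms by (simp add: T_trans_map_def)
next
  case Second
  have "{y \<in> {(x, d) \<in> T_R4xS3. fst x \<noteq> 0}. T_trans_map h j y = (x, d)}
      = (if fst x \<noteq> 0 then {(S x, dchange Second x d)} else {})"
  proof (cases "fst x = 0")
    case True
    have "fst y = 0" if "trans_map h j y = x" for y
      using fst_change_nz[of y First] that True by (cases "fst y = 0") simp_all
    then have "{y \<in> {(x, d) \<in> T_R4xS3. fst x \<noteq> 0}. T_trans_map h j y = (x, d)} = {}"
      unfolding T_trans_map_def by fast
    then show ?thesis using True by simp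
  next
    case False
    have iff: "(y, e) \<in> T_R4xS3 \<and> fst y \<noteq> 0 \<and> trans_map h j y = x \<and> frechet_derivative (trans_map h j) (at y) e = d
        \<longleftrightarrow> y = S x \<and> e = dchange Second x d" (is "?L \<longleftrightarrow> ?R") for y e
    proof
      assume ?L
      then show ?R using S_T[of y] dchange_dchange[of y First e] by simp
    next
      assume ?R
      then show ?L
        using T_S[OF False] dchange_dchange[OF False, of Second d] dchange_tangent[OF assms False, of Second] fst_change_nz[OF False, of Second]
        by simp
    qed
    have "{y \<in> {(x, d) \<in> T_R4xS3. fst x \<noteq> 0}. T_trans_map h j y = (x, d)} = {(S x, dchange Second x d)}"
    proof (rule set_eqI)
      fix z show "z \<in> {y \<in> {(x, d) \<in> T_R4xS3. fst x \<noteq> 0}. T_trans_map h j y = (x, d)} \<longleftrightarrow> z \<in> {(S x, dchange Second x d)}"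
        using iff[of "fst z" "snd z"] by (cases z) (simp add: T_trans_map_def)
    qed
    then show ?thesis using False by simp
  qed
  then show ?thesis unfolding TE_vec_def TE_rel_def Second glue_class_Second[OF assms] by simp
qed

lemma TE_vec_mem: "(i, (x, d')) \<in> TE_vec h j i x d \<Longrightarrow> d' = d"
  by (cases i) (auto simp: TE_vec_def TE_rel_def glue_rel_def)

lemma E_pt_other: "x \<in> M \<Longrightarrow> fst x \<noteq> 0 \<Longrightarrow> E_pt h j (other i) (change i x) = E_pt h j i x"
  by (auto simp: E_pt_eq change_M change_change fst_change_nz)

lemma TE_vec_other: "(x, d) \<in> T_R4xS3 \<Longrightarrow> fst x \<noteq> 0 \<Longrightarrow> TE_vec h j (other i) (change i x) (dchange i x d) = TE_vec h j i x d"
  by (auto simp: TE_vec_eq dchange_tangent change_change dchange_dchange fst_change_nz)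

lemma E_pt_mem: "x \<in> M \<Longrightarrow> (k, y) \<in> E_pt h j i x \<Longrightarrow> k = i \<and> y = x \<or> k = other i \<and> fst x \<noteq> 0 \<and> y = change i x"
  unfolding E_pt_eq by (cases "fst x = 0") simp_all

lemma E_pt_self: "x \<in> M \<Longrightarrow> (i, x) \<in> E_pt h j i x"
  by (simp add: E_pt_eq)

lemma E_pt_same: assumes "x \<in> M" "y \<in> M" shows "E_pt h j i x = E_pt h j i y \<longleftrightarrow> x = y"
proof
  assume "E_pt h j i x = E_pt h j i y"
  then have "(i, y) \<in> E_pt h j i x" using E_pt_self[OF assms(2), of i] by simp
  from E_pt_mem[OF assms(1) this] show "x = y" by simp
qed simp

lemma E_pt_diff: assumes "x \<in> M" "y \<in> M" "E_pt h j (other i) y = E_pt h j i x" shows "fst x \<noteq> 0 \<and> y = change i x"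
proof -
  have "(other i, y) \<in> E_pt h j i x" using E_pt_self[OF assms(2), of "other i"] assms(3) by simp
  from E_pt_mem[OF assms(1) this] show ?thesis by simp
qed

lemma E_cases: assumes "p \<in> E h j" obtains i x where "x \<in> M" "p = E_pt h j i x"
  using assms unfolding E_def E_pt_def by (auto elim!: quotientE)

text \<open>The zero fibre of the second copy has no counterpart in the first, and \<open>R\<close> supplies the flow there.\<close>

fun flow_in where "flow_in First t x = F t x" | "flow_in Second t x = (if fst x = 0 then R t x else trans_map h j (F t (S x)))"
fun field_in where "field_in First x = V x" | "field_in Second x = (if fst x = 0 then J x else frechet_derivative (trans_map h j) (at (S x)) (V (S x)))"

lemma fst_F_nz: assumes "x \<in> M" "fst x \<noteq> 0" shows "fst (F t x) \<noteq> 0"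
proof
  assume 0: "fst (F t x) = 0"
  have "x = F (-t) (F t x)" using assms by (simp add: F_add F0)
  also have "\<dots> = R (-t) (F t x)" using F_R[OF F_M[OF assms(1)]] 0 by simp
  finally have "fst x = fst (F t x)" using fst_R by metis
  then show False using 0 assms by simp
qed

lemma SM: "x \<in> M \<Longrightarrow> fst x \<noteq> 0 \<Longrightarrow> S x \<in> M" "fst x \<noteq> 0 \<Longrightarrow> fst (S x) \<noteq> 0"
  using change_M[of x Second] fst_change_nz[of x Second] by auto

lemma fst_flow_in_nz: "x \<in> M \<Longrightarrow> fst x \<noteq> 0 \<Longrightarrow> fst (flow_in i t x) \<noteq> 0"
  using fst_F_nz SM fst_change_nz[of "F t (S x)" First] by (cases i) auto

lemma flow_in_change: "x \<in> M \<Longrightarrow> fst x \<noteq> 0 \<Longrightarrow> flow_in (other i) t (change i x) = change i (flow_in i t x)"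
  using fst_change_nz[of x First] change_change[of x First] change_change[of "F t (S x)" First] fst_F_nz[of "S x" t] SM[of x] by (cases i) auto

lemma FF0: "x \<in> M \<Longrightarrow> flow_in i 0 x = x"
  using F0[of "S x"] T_S[of x] SM[of x] by (cases i) (auto simp: F0 R0)

lemma flow_in_M: "x \<in> M \<Longrightarrow> flow_in i t x \<in> M"
  using change_M[of "F t (S x)" First] fst_F_nz[of "S x" t] SM[of x] by (cases i) (auto simp: F_M R_M)

lemma flow_in_add: "x \<in> M \<Longrightarrow> flow_in i s (flow_in i t x) = flow_in i (s + t) x"
  using SM[of x] fst_F_nz[of "S x" t] fst_change_nz[of "F t (S x)" First] S_T[of "F t (S x)"]
  by (cases i) (auto simp: F_add R_add fst_R)

lemma flow_in_closed: assumes "x \<in> M" shows "\<exists>\<tau>>0. flow_in i \<tau> x = x"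
proof (cases i)
  case Second
  then show ?thesis using assms R_closed[OF assms] F_closed[of "S x"] SM[of x] T_S[of x] by (cases "fst x = 0") force+
qed (use F_closed[OF assms] in auto)

lemma flow_in_VV0: assumes "x \<in> M" shows "((\<lambda>t. flow_in i t x) has_vector_derivative field_in i x) (at 0)"
proof (cases "i = First \<or> fst x = 0")
  case True
  then show ?thesis using F_V[OF assms] R_J[OF assms] by (cases i) auto
next
  case False
  then have i: "i = Second" "fst x \<noteq> 0" by (cases i; auto)+
  have "((\<lambda>t. F t (S x)) has_derivative (\<lambda>t. t *\<^sub>R V (S x))) (at 0)"
    using F_V[of "S x"] SM assms i by (auto simp: has_vector_derivative_def)
  moreover have "(trans_map h j has_derivative dchange First (S x)) (at (F 0 (S x)))"
    using change_hd[of "S x" First] F0 SM assms i by simp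
  ultimately have "((\<lambda>t. trans_map h j (F t (S x))) has_derivative (\<lambda>t. dchange First (S x) (t *\<^sub>R V (S x)))) (at 0)"
    by (rule has_derivative_compose)
  then show ?thesis using i linear_cmul[OF has_derivative_linear[OF change_hd[OF SM(2)[OF i(2)], of First]]]
    by (simp add: has_vector_derivative_def)
qed

lemma field_in_change: assumes "x \<in> M" "fst x \<noteq> 0" shows "field_in (other i) (change i x) = dchange i x (field_in i x)"
  using assms fst_change_nz[of x First] change_change[of x First] dchange_dchange[of "S x" First "V (S x)"] SM[of x] T_S[of x] by (cases i) auto

lemma flow_in_field_in: assumes "x \<in> M" shows "((\<lambda>t. flow_in i t x) has_vector_derivative field_in i (flow_in i t x)) (at t)"
proof -
  have 1: "((\<lambda>s. flow_in i s (flow_in i t x)) has_vector_derivative field_in i (flow_in i t x)) (at (t - t))"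
    using flow_in_VV0[OF flow_in_M[OF assms]] by simp
  have "((\<lambda>s. s - t) has_vector_derivative 1) (at t)" by (auto intro!: derivative_eq_intros)
  from vector_diff_chain_at[OF this 1] show ?thesis
    by (simp add: o_def flow_in_add[OF assms])
qed

lemma field_in_tangent: assumes "x \<in> M" shows "(x, field_in i x) \<in> T_R4xS3"
proof -
  have "((\<lambda>t. snd (flow_in i t x)) has_vector_derivative snd (field_in i x)) (at 0)"
    using bounded_linear.has_vector_derivative[OF bounded_linear_snd flow_in_VV0[OF assms]] .
  from bounded_bilinear.has_vector_derivative[OF bounded_bilinear_inner this this]
  have "((\<lambda>t. snd (flow_in i t x) \<bullet> snd (flow_in i t x)) has_vector_derivative (2 * (snd x \<bullet> snd (field_in i x)))) (at 0)"
    by (simp add: FF0[OF assms] inner_commute)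
  moreover have "(\<lambda>t. snd (flow_in i t x) \<bullet> snd (flow_in i t x)) = (\<lambda>t. 1)"
    using flow_in_M[OF assms] by (auto simp: R4xS3_def mem_Times_iff dot_square_norm)
  ultimately have "((\<lambda>t::real. 1::real) has_vector_derivative (2 * (snd x \<bullet> snd (field_in i x)))) (at 0)" by simp
  from vector_derivative_unique_at[OF this has_vector_derivative_const] show ?thesis
    using assms by (simp add: T_M_iff)
qed

lemma field_in_nz: assumes "x \<in> M" shows "field_in i x \<noteq> 0"
proof
  assume 0: "field_in i x = 0"
  show False
  proof (cases "i = First \<or> fst x = 0")
    case True then show False using 0 assms V_nz J_nz by (cases i) auto
  next
    case False
    then have i: "i = Second" "fst x \<noteq> 0" by (cases i; auto)+
    have "V (S x) = dchange Second x (field_in Second x)" using field_in_change[OF assms i(2), of Second] by simp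
    also have "\<dots> = 0" using 0 i linear_0[OF has_derivative_linear[OF change_hd[OF i(2), of Second]]] by simp
    finally show False using V_nz SM assms i by metis
  qed
qed

text \<open>The case of interest is the second copy near its zero fibre: a point with \<open>\<parallel>v\<parallel> < 1 / K\<close> comes
  from a point of the first copy with \<open>\<parallel>v\<parallel> > K\<close>, where the flow is \<open>R\<close>, so that the field is \<open>J\<close> there.\<close>

lemma field_in_smooth: "smooth_on M (field_in i)"
proof (cases i)
  case First
  have "field_in First = V" by auto
  then show ?thesis using V_smooth First by simp
next
  case Second
  have near: "field_in Second x = J x" if x: "x \<in> M" "norm (fst x) < 1 / K" for x
  proof (cases "fst x = 0")
    case False
    have "norm (fst (S x)) = 1 / norm (fst x)" using norm_fst_change[OF False, of Second] by simp
    moreover have "K * norm (fst x) \<le> 1" using x(2) K by (simp add: pos_less_divide_eq mult.commute)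
    ultimately have "norm (fst (S x)) \<ge> K" using False by (simp add: pos_le_divide_eq)
    then have "flow_in Second t x = R t x" for t
      using False F_R[of "S x" t] SM(1)[OF x(1) False] T_R[OF SM(2)[OF False], of t] T_S[OF False] by simp
    then have "((\<lambda>t. R t x) has_vector_derivative field_in Second x) (at 0)"
      using flow_in_VV0[OF x(1), of Second] by (simp only:)
    from vector_derivative_unique_at[OF this R_J[OF x(1)]] show ?thesis .
  qed simp
  show ?thesis
  proof (rule smooth_onI)
    fix x assume x: "x \<in> M"
    show "\<exists>U g. x \<in> U \<and> open_smooth U g \<and> (\<forall>y\<in>U \<inter> M. g y = field_in i y)"
    proof (cases "norm (fst x) < 1 / K")
      case True
      have "open {x::quat \<times> quat. norm (fst x) < 1 / K}" by (intro open_Collect_less continuous_intros)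
      from open_smooth_subset[OF J_open_smooth subset_UNIV this]
      show ?thesis using True near Second
        by (intro exI[of _ "{x. norm (fst x) < 1 / K}"] exI[of _ J]) auto
    next
      case False
      moreover have "norm (fst x) \<noteq> 0" using False K by (intro notI) simp
      ultimately have nz: "fst x \<noteq> 0" by simp
      obtain U g where U: "S x \<in> U" "open_smooth U g" "\<And>y. y \<in> U \<Longrightarrow> y \<in> M \<Longrightarrow> g y = V y"
        using smooth_onE[OF V_smooth SM(1)[OF x nz]] by metis
      have o: "open (S -` U \<inter> punctured)"
        using continuous_on_open_vimage[OF open_punctured, of S] open_smooth_continuous_on[OF S_open_smooth] open_smooth_open[OF U(2)] by blast
      have S': "open_smooth (S -` U \<inter> punctured) S" by (rule open_smooth_subset[OF S_open_smooth _ o]) auto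
      have "open_smooth (S -` U \<inter> punctured) (\<lambda>y. frechet_derivative (trans_map h j) (at (S y)) (g (S y)))"
      proof (rule open_smooth_frechet[OF T_open_smooth S'])
        show "open_smooth (S -` U \<inter> punctured) (\<lambda>y. g (S y))" by (rule open_smooth_compose[OF U(2) S']) auto
      qed (use SM in auto)
      moreover have "\<forall>y\<in>(S -` U \<inter> punctured) \<inter> M. frechet_derivative (trans_map h j) (at (S y)) (g (S y)) = field_in i y"
        using Second SM U(3) by auto
      moreover have "x \<in> S -` U \<inter> punctured" using U nz by auto
      ultimately show ?thesis by meson
    qed
  qed
qed

text \<open>Flow and field are read off from an arbitrary representative of the class; \<open>Phi_pt\<close> and \<open>X_pt\<close> show
  that every representative gives the same value.\<close>

definition Phi :: "real \<Rightarrow> pnt \<Rightarrow> pnt" where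
  "Phi t p = (case (SOME z. z \<in> p) of (i, x) \<Rightarrow> E_pt h j i (flow_in i t x))"

definition X :: "pnt \<Rightarrow> tangent" where
  "X p = (case (SOME z. z \<in> p) of (i, x) \<Rightarrow> TE_vec h j i x (field_in i x))"

lemma some_rep:
  assumes "x \<in> M"
  shows "(SOME z. z \<in> E_pt h j i x) = (i, x) \<or> (fst x \<noteq> 0 \<and> (SOME z. z \<in> E_pt h j i x) = (other i, change i x))"
proof -
  obtain k y where ky: "(SOME z. z \<in> E_pt h j i x) = (k, y)" by (rule prod.exhaust)
  have "(SOME z. z \<in> E_pt h j i x) \<in> E_pt h j i x"
    by (rule someI[of _ "(i, x)"]) (rule E_pt_self[OF assms])
  then show ?thesis using E_pt_mem[OF assms, of k y i] unfolding ky by auto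
qed

lemma Phi_pt: assumes "x \<in> M" shows "Phi t (E_pt h j i x) = E_pt h j i (flow_in i t x)"
  using some_rep[OF assms, of i]
proof (elim disjE conjE)
  assume "fst x \<noteq> 0" "(SOME z. z \<in> E_pt h j i x) = (other i, change i x)"
  then show ?thesis
    using flow_in_change[OF assms, of i t] E_pt_other[OF flow_in_M[OF assms, of i t] fst_flow_in_nz[OF assms], of i]
    by (simp add: Phi_def)
qed (simp add: Phi_def)

lemma X_pt: assumes "x \<in> M" shows "X (E_pt h j i x) = TE_vec h j i x (field_in i x)"
  using some_rep[OF assms, of i]
proof (elim disjE conjE)
  assume "fst x \<noteq> 0" "(SOME z. z \<in> E_pt h j i x) = (other i, change i x)"
  then show ?thesis
    using field_in_change[OF assms, of i] TE_vec_other[OF field_in_tangent[OF assms, of i], of i] by (simp add: X_def)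
qed (simp add: X_def)

lemma E_pt_E: "x \<in> M \<Longrightarrow> E_pt h j i x \<in> E h j"
  unfolding E_def E_pt_def by (auto intro!: quotientI)

lemma Phi_add: "p \<in> E h j \<Longrightarrow> Phi s (Phi t p) = Phi (s + t) p"
  by (erule E_cases) (simp add: Phi_pt flow_in_M flow_in_add)

lemma Phi_0: "p \<in> E h j \<Longrightarrow> Phi 0 p = p"
  by (erule E_cases) (simp add: Phi_pt FF0)

lemma smooth_vector_field_X: "smooth_vector_field h j X"
  unfolding smooth_vector_field_def
proof (intro conjI ballI allI)
  fix p assume "p \<in> E h j"
  then obtain i x where x: "x \<in> M" and p: "p = E_pt h j i x" by (rule E_cases)
  show "X p \<in> TE h j"
    unfolding p X_pt[OF x] TE_def TE_vec_def using field_in_tangent[OF x] by (auto intro!: quotientI)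
  show "TE_proj (X p) = p"
    unfolding p X_pt[OF x] TE_proj_def by (simp add: TE_vec_eq[OF field_in_tangent[OF x]] E_pt_eq[OF x])
next
  fix i
  show "\<exists>V. smooth_on M V \<and> (\<forall>x\<in>M. (x, V x) \<in> T_R4xS3 \<and> X (E_pt h j i x) = TE_vec h j i x (V x))"
    using field_in_smooth field_in_tangent X_pt by (intro exI[of _ "field_in i"]) simp
qed

lemma nowhere_vanishing_X: "nowhere_vanishing h j X"
  unfolding nowhere_vanishing_def
proof (intro allI ballI notI)
  fix i x assume x: "x \<in> M" and eq: "X (E_pt h j i x) = TE_vec h j i x 0"
  have "(i, (x, field_in i x)) \<in> TE_vec h j i x 0"
    using eq X_pt[OF x] TE_vec_eq[OF field_in_tangent[OF x], of i] by auto
  then show False using TE_vec_mem field_in_nz[OF x] by metis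
qed

lemma integral_curve_Phi: assumes "p \<in> E h j" shows "integral_curve h j X (\<lambda>t. Phi t p)"
  unfolding integral_curve_def has_velocity_def
proof
  fix t
  obtain i x where x: "x \<in> M" and p: "p = E_pt h j i x" using assms by (rule E_cases)
  show "\<exists>i c d. (\<forall>\<^sub>F s in nhds t. c s \<in> M \<and> Phi s p = E_pt h j i (c s)) \<and>
        (c has_vector_derivative d) (at t) \<and> X (Phi t p) = TE_vec h j i (c t) d"
    using flow_in_M[OF x] flow_in_field_in[OF x, of i t] X_pt[OF flow_in_M[OF x, of i t]] unfolding p Phi_pt[OF x]
    by (intro exI[of _ i] exI[of _ "\<lambda>s. flow_in i s x"] exI[of _ "field_in i (flow_in i t x)"]) simp
qed

text \<open>The velocity of a curve in \<open>E\<close> is witnessed by a chart representative that may change from one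
  time to the next. Any representative \<open>c\<close> of the curve near \<open>t\<close> is nevertheless differentiable with
  the right velocity, because it differs from the witness by a coordinate change at most.\<close>

lemma chart_velocity:
  assumes \<gamma>: "integral_curve h j X \<gamma>"
    and c: "\<forall>\<^sub>F s in nhds t. c s \<in> M \<and> \<gamma> s = E_pt h j i (c s)"
  shows "(c has_vector_derivative field_in i (c t)) (at t)"
proof -
  have ct: "c t \<in> M" "\<gamma> t = E_pt h j i (c t)" using eventually_nhds_x_imp_x[OF c] by auto
  obtain k b d where b: "\<forall>\<^sub>F s in nhds t. b s \<in> M \<and> \<gamma> s = E_pt h j k (b s)"
    and d: "(b has_vector_derivative d) (at t)" and X: "X (\<gamma> t) = TE_vec h j k (b t) d"
    using \<gamma> unfolding integral_curve_def has_velocity_def by blast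
  have bt: "b t \<in> M" "\<gamma> t = E_pt h j k (b t)" using eventually_nhds_x_imp_x[OF b] by auto
  have "(k, (b t, field_in k (b t))) \<in> TE_vec h j k (b t) d"
    using X bt X_pt[OF bt(1), of k] TE_vec_eq[OF field_in_tangent[OF bt(1)], of k] by auto
  then have d: "(b has_vector_derivative field_in k (b t)) (at t)" using d TE_vec_mem by metis
  have trans: "(c has_vector_derivative v) (at t)"
    if f: "(f has_vector_derivative v) (at t)" and fc: "\<forall>\<^sub>F s in nhds t. f s = c s" for f v
  proof -
    obtain U where "open U" "t \<in> U" "\<And>s. s \<in> U \<Longrightarrow> f s = c s"
      using fc unfolding eventually_nhds by blast
    then show ?thesis using has_vector_derivative_transform_within_open[OF f] by blast
  qed
  show ?thesis
  proof (cases "k = i")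
    case True
    have bc: "\<forall>\<^sub>F s in nhds t. b s = c s"
      using b c
    proof eventually_elim
      case (elim s)
      then show ?case using E_pt_same[of "b s" "c s" i] True by simp
    qed
    from trans[OF d bc] eventually_nhds_x_imp_x[OF bc] True show ?thesis by simp
  next
    case False
    then have i: "i = other k" using other_cases[of i k] by auto
    have ev: "\<forall>\<^sub>F s in nhds t. fst (b s) \<noteq> 0 \<and> change k (b s) = c s"
      using b c
    proof eventually_elim
      case (elim s)
      then show ?case using E_pt_diff[of "b s" "c s" k] i by simp
    qed
    have t: "fst (b t) \<noteq> 0" "change k (b t) = c t" using eventually_nhds_x_imp_x[OF ev] by auto
    have "((\<lambda>s. change k (b s)) has_vector_derivative dchange k (b t) (field_in k (b t))) (at t)"
      using has_derivative_compose[OF d[unfolded has_vector_derivative_def] change_hd[OF t(1)], of k]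
        linear_cmul[OF has_derivative_linear[OF change_hd[OF t(1), of k]]]
      by (simp add: has_vector_derivative_def)
    then have "((\<lambda>s. change k (b s)) has_vector_derivative field_in i (c t)) (at t)"
      using field_in_change[OF bt(1) t(1), of k] i t by simp
    moreover have "\<forall>\<^sub>F s in nhds t. change k (b s) = c s" using ev by (rule eventually_mono) simp
    ultimately show ?thesis by (rule trans)
  qed
qed

text \<open>Local uniqueness in a chart around \<open>\<gamma>(t)\<close> gives \<open>\<gamma>(s) = \<Phi>\<^bsub>s - t\<^esub>(\<gamma>(t))\<close> for \<open>s\<close> near \<open>t\<close>. By the group law
  \<open>\<Phi>\<^bsub>- s\<^esub>(\<gamma>(s))\<close> is then locally constant on \<open>\<real>\<close>, hence constant.\<close>

lemma integral_curve_unique: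
  assumes \<gamma>: "integral_curve h j X \<gamma>"
  shows "\<gamma> 0 \<in> E h j" "\<gamma> t = Phi t (\<gamma> 0)"
proof -
  have rep: "\<exists>i c. \<forall>\<^sub>F s in nhds t. c s \<in> M \<and> \<gamma> s = E_pt h j i (c s)" for t
    using \<gamma> unfolding integral_curve_def has_velocity_def by blast
  have \<gamma>E: "\<gamma> t \<in> E h j" for t
  proof -
    obtain i c where "\<forall>\<^sub>F s in nhds t. c s \<in> M \<and> \<gamma> s = E_pt h j i (c s)" using rep by blast
    from eventually_nhds_x_imp_x[OF this] show ?thesis by (simp add: E_pt_E)
  qed
  then show "\<gamma> 0 \<in> E h j" .
  have loc: "\<forall>\<^sub>F s in nhds t. \<gamma> s = Phi (s - t) (\<gamma> t)" for t
  proof -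
    obtain i c where c: "\<forall>\<^sub>F s in nhds t. c s \<in> M \<and> \<gamma> s = E_pt h j i (c s)" using rep by blast
    have ct: "c t \<in> M" "\<gamma> t = E_pt h j i (c t)" using eventually_nhds_x_imp_x[OF c] by auto
    obtain U g where U: "c t \<in> U" "open_smooth U g" "\<And>y. y \<in> U \<Longrightarrow> y \<in> M \<Longrightarrow> g y = field_in i y"
      using smooth_onE[OF field_in_smooth ct(1)] by metis
    define b where "b s = flow_in i (s - t) (c t)" for s
    have b': "(b has_vector_derivative field_in i (b s)) (at s)" for s
    proof -
      have "((\<lambda>s. s - t) has_vector_derivative 1) (at s)" by (auto intro!: derivative_eq_intros)
      from vector_diff_chain_at[OF this flow_in_field_in[OF ct(1), of i "s - t"]] show ?thesis
        unfolding b_def[abs_def] by (simp add: o_def)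
    qed
    have c': "\<forall>\<^sub>F s in nhds t. (c has_vector_derivative field_in i (c s)) (at s) \<and> c s \<in> M"
    proof -
      have "\<forall>\<^sub>F s in nhds t. \<forall>\<^sub>F r in nhds s. c r \<in> M \<and> \<gamma> r = E_pt h j i (c r)"
        using c by (simp only: eventually_eventually)
      then show ?thesis
      proof (rule eventually_mono)
        fix s assume s: "\<forall>\<^sub>F r in nhds s. c r \<in> M \<and> \<gamma> r = E_pt h j i (c r)"
        show "(c has_vector_derivative field_in i (c s)) (at s) \<and> c s \<in> M"
          using chart_velocity[OF \<gamma> s] eventually_nhds_x_imp_x[OF s] by simp
      qed
    qed
    have bM: "b s \<in> M" for s by (simp add: b_def flow_in_M ct)
    have inU: "\<forall>\<^sub>F s in nhds t. f s \<in> U" if "f t = c t" "(f has_vector_derivative v) (at t)" for f v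
    proof -
      have "isCont f t" using that(2) has_vector_derivative_continuous by blast
      then have "(f \<longlongrightarrow> f t) (nhds t)" by (simp only: isCont_def tendsto_at_iff_tendsto_nhds)
      then show ?thesis by (rule topological_tendstoD) (use U open_smooth_open that in auto)
    qed
    have bt: "b t = c t" by (simp add: b_def FF0 ct)
    have "\<forall>\<^sub>F s in nhds t. c s = b s"
    proof (rule ode_local_unique[of U g c t b, OF U(2,1)])
      show "c t = b t" using bt by simp
      show "\<forall>\<^sub>F s in nhds t. (c has_vector_derivative g (c s)) (at s)"
        using c' inU[OF refl conjunct1[OF eventually_nhds_x_imp_x[OF c']]]
        by eventually_elim (use U(3) in auto)
      show "\<forall>\<^sub>F s in nhds t. (b has_vector_derivative g (b s)) (at s)"
        using inU[OF bt b'] by eventually_elim (use U(3) bM b' in auto)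
    qed
    then show ?thesis
      using c by eventually_elim (simp add: ct(2) Phi_pt[OF ct(1)] b_def)
  qed
  define q where "q s = Phi (- s) (\<gamma> s)" for s
  have qc: "\<forall>\<^sub>F s in nhds t. q s = q t" for t
    using loc[of t] by eventually_elim (simp add: q_def Phi_add \<gamma>E)
  have "q constant_on UNIV"
  proof (rule locally_constant_imp_constant)
    show "connected (UNIV :: real set)" by simp
    fix a :: real
    obtain T where T: "open T" "a \<in> T" "\<forall>x\<in>T. q x = q a" using qc[of a] unfolding eventually_nhds by blast
    from T(1) have "openin (top_of_set UNIV) T" by simp
    with T(2,3) show "\<exists>T. openin (top_of_set UNIV) T \<and> a \<in> T \<and> (\<forall>x\<in>T. q x = q a)" by blast
  qed
  then have "q t = q 0" unfolding constant_on_def by auto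
  then have "Phi t (q t) = Phi t (q 0)" by simp
  then show "\<gamma> t = Phi t (\<gamma> 0)" by (simp add: q_def Phi_add \<gamma>E Phi_0)
qed

lemma Phi_closed: assumes "p \<in> E h j" shows "closed_curve (\<lambda>t. Phi t p)"
proof -
  obtain i x where x: "x \<in> M" and p: "p = E_pt h j i x" using assms by (rule E_cases)
  obtain \<tau> where \<tau>: "\<tau> > 0" "flow_in i \<tau> x = x" using flow_in_closed[OF x] by blast
  have "Phi (t + \<tau>) p = Phi t p" for t
    using Phi_add[OF assms, of t \<tau>] Phi_pt[OF x, of \<tau> i] \<tau> p by simp
  then show ?thesis unfolding closed_curve_def using \<tau>(1) by blast
qed

lemma foliation_X: "foliation_by_circles h j X"
  unfolding foliation_by_circles_def
proof (intro conjI ballI allI impI)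
  show "nowhere_vanishing h j X" by (rule nowhere_vanishing_X)
  show "\<exists>\<gamma>. integral_curve h j X \<gamma> \<and> \<gamma> 0 = p" if "p \<in> E h j" for p
    using integral_curve_Phi[OF that] Phi_0[OF that] by (intro exI[of _ "\<lambda>t. Phi t p"]) simp
  show "closed_curve \<gamma>" if "integral_curve h j X \<gamma>" for \<gamma>
  proof -
    have "\<gamma> = (\<lambda>t. Phi t (\<gamma> 0))" using integral_curve_unique(2)[OF that] by blast
    then show ?thesis using Phi_closed[OF integral_curve_unique(1)[OF that]] by simp
  qed
qed

lemma period_X:
  assumes x: "x \<in> M" and \<tau>: "\<tau> > 0" "F \<tau> x = x" and min: "\<And>\<tau>'. \<tau>' > 0 \<Longrightarrow> F \<tau>' x = x \<Longrightarrow> \<tau> \<le> \<tau>'"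
  shows "period h j X (E_pt h j First x) = \<tau>"
proof -
  let ?p = "E_pt h j First x"
  have p: "?p \<in> E h j" by (rule E_pt_E[OF x])
  have "(THE \<gamma>. integral_curve h j X \<gamma> \<and> \<gamma> 0 = ?p) = (\<lambda>t. Phi t ?p)"
  proof (rule the_equality)
    show "integral_curve h j X (\<lambda>t. Phi t ?p) \<and> Phi 0 ?p = ?p" using integral_curve_Phi[OF p] Phi_0[OF p] by simp
    show "\<gamma> = (\<lambda>t. Phi t ?p)" if "integral_curve h j X \<gamma> \<and> \<gamma> 0 = ?p" for \<gamma>
      using integral_curve_unique(2)[of \<gamma>] that by (intro ext) metis
  qed
  moreover have "minimal_period (\<lambda>t. Phi t ?p) = \<tau>"
    unfolding minimal_period_def
  proof (rule Least_equality)
    show "0 < \<tau> \<and> (\<forall>t. Phi (t + \<tau>) ?p = Phi t ?p)"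
      using \<tau> Phi_add[OF p, of _ \<tau>] Phi_pt[OF x, of \<tau> First] by (metis flow_in.simps(1))
    show "\<tau> \<le> \<tau>'" if "0 < \<tau>' \<and> (\<forall>t. Phi (t + \<tau>') ?p = Phi t ?p)" for \<tau>'
    proof -
      have "Phi \<tau>' ?p = ?p" using that[THEN conjunct2, rule_format, of 0] Phi_0[OF p] by simp
      then have "F \<tau>' x = x" using Phi_pt[OF x, of \<tau>' First] E_pt_same[OF F_M[OF x] x, of First \<tau>'] by simp
      then show ?thesis using min that by blast
    qed
  qed
  ultimately show ?thesis unfolding period_def by simp
qed

lemma unbounded_X: "unbounded_periods h j X"
  unfolding unbounded_periods_def bdd_above_def
proof (intro notI, elim exE)
  fix B assume B: "\<forall>y\<in>period h j X ` E h j. y \<le> B"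
  obtain x \<tau> where "x \<in> M" "\<tau> > B" "\<tau> > 0" "F \<tau> x = x" "\<forall>\<tau>'>0. F \<tau>' x = x \<longrightarrow> \<tau> \<le> \<tau>'"
    using F_unbounded[of B] by blast
  then show False using period_X[of x \<tau>] B E_pt_E[of x First] by force
qed

theorem glued_flow_conclusion:
  "\<exists>X. smooth_vector_field h j X \<and> foliation_by_circles h j X \<and> unbounded_periods h j X"
  using smooth_vector_field_X foliation_X unbounded_X by blast

end

section \<open>Quaternions, the gluing maps and the circle action\<close>

lemma vector4_nth [simp]:
  "(vector [a, b, c, d] :: 'a::zero^4) $ 1 = a" "(vector [a, b, c, d] :: 'a::zero^4) $ 2 = b"
  "(vector [a, b, c, d] :: 'a::zero^4) $ 3 = c" "(vector [a, b, c, d] :: 'a::zero^4) $ 4 = d"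
  by (simp_all add: vector_def)

lemma quat_eq_iff: "(p :: quat) = q \<longleftrightarrow> p$1 = q$1 \<and> p$2 = q$2 \<and> p$3 = q$3 \<and> p$4 = q$4"
  by (simp add: vec_eq_iff forall_4)

lemma qmul_nth [simp]:
  "(p \<bullet>\<^sub>H q) $ 1 = p$1 * q$1 - p$2 * q$2 - p$3 * q$3 - p$4 * q$4"
  "(p \<bullet>\<^sub>H q) $ 2 = p$1 * q$2 + p$2 * q$1 + p$3 * q$4 - p$4 * q$3"
  "(p \<bullet>\<^sub>H q) $ 3 = p$1 * q$3 - p$2 * q$4 + p$3 * q$1 + p$4 * q$2"
  "(p \<bullet>\<^sub>H q) $ 4 = p$1 * q$4 + p$2 * q$3 - p$3 * q$2 + p$4 * q$1"
  by (simp_all add: qmul_def)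

definition qcnj :: "quat \<Rightarrow> quat" where "qcnj p = vector [p$1, - p$2, - p$3, - p$4]"
definition qi :: quat where "qi = vector [0, 1, 0, 0]"
definition qexp :: "real \<Rightarrow> quat" where "qexp t = vector [cos t, sin t, 0, 0]"

lemma qcnj_nth [simp]: "qcnj p $ 1 = p$1" "qcnj p $ 2 = - p$2" "qcnj p $ 3 = - p$3" "qcnj p $ 4 = - p$4"
  by (simp_all add: qcnj_def)
lemma qone_nth [simp]: "qone $ 1 = 1" "qone $ 2 = 0" "qone $ 3 = 0" "qone $ 4 = 0"
  by (simp_all add: qone_def)
lemma qi_nth [simp]: "qi $ 1 = 0" "qi $ 2 = 1" "qi $ 3 = 0" "qi $ 4 = 0"
  by (simp_all add: qi_def)
lemma qexp_nth [simp]: "qexp t $ 1 = cos t" "qexp t $ 2 = sin t" "qexp t $ 3 = 0" "qexp t $ 4 = 0"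
  by (simp_all add: qexp_def)

lemma qnorm2: "(norm (p :: quat))\<^sup>2 = (p$1)\<^sup>2 + (p$2)\<^sup>2 + (p$3)\<^sup>2 + (p$4)\<^sup>2"
  unfolding power2_norm_eq_inner by (simp add: inner_vec_def sum_4 power2_eq_square)

lemma qmul_assoc: "p \<bullet>\<^sub>H q \<bullet>\<^sub>H r = p \<bullet>\<^sub>H (q \<bullet>\<^sub>H r)"
  unfolding quat_eq_iff by (simp add: algebra_simps)

lemma qone_mul [simp]: "qone \<bullet>\<^sub>H p = p" "p \<bullet>\<^sub>H qone = p"
  unfolding quat_eq_iff by simp_all

lemma norm_qmul: "norm (p \<bullet>\<^sub>H q) = norm p * norm q"
proof -
  have "(norm (p \<bullet>\<^sub>H q))\<^sup>2 = (norm p * norm q)\<^sup>2"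
    unfolding power_mult_distrib qnorm2 qmul_nth by algebra
  then show ?thesis by simp
qed

lemma norm_qcnj [simp]: "norm (qcnj p) = norm p"
proof -
  have "(norm (qcnj p))\<^sup>2 = (norm p)\<^sup>2" unfolding qnorm2 by simp
  then show ?thesis by simp
qed

lemma norm_qexp [simp]: "norm (qexp t) = 1"
proof -
  have "(norm (qexp t))\<^sup>2 = 1\<^sup>2" unfolding qnorm2 by simp
  then show ?thesis using power2_eq_imp_eq[of "norm (qexp t)" 1] by simp
qed

lemma qmul_qcnj: "p \<bullet>\<^sub>H qcnj p = (norm p)\<^sup>2 *\<^sub>R qone" "qcnj p \<bullet>\<^sub>H p = (norm p)\<^sup>2 *\<^sub>R qone"
  unfolding quat_eq_iff qnorm2 by (simp_all add: power2_eq_square)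

lemma qcnj_qmul: "qcnj (p \<bullet>\<^sub>H q) = qcnj q \<bullet>\<^sub>H qcnj p"
  unfolding quat_eq_iff by (simp add: algebra_simps)
lemma qcnj_qcnj [simp]: "qcnj (qcnj p) = p" unfolding quat_eq_iff by simp
lemma qcnj_qone [simp]: "qcnj qone = qone" unfolding quat_eq_iff by simp
lemma qcnj_scaleR: "qcnj (c *\<^sub>R p) = c *\<^sub>R qcnj p" unfolding quat_eq_iff by simp
lemma qcnj_add: "qcnj (p + q) = qcnj p + qcnj q" unfolding quat_eq_iff by simp
lemma qcnj_eq_0 [simp]: "qcnj p = 0 \<longleftrightarrow> p = 0" unfolding quat_eq_iff by simp

lemma bounded_linear_qcnj: "bounded_linear qcnj"
  by (rule bounded_linear_intro[where K = 1]) (simp_all add: qcnj_add qcnj_scaleR)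

lemma bounded_bilinear_qmul: "bounded_bilinear (\<bullet>\<^sub>H)"
proof
  show "\<exists>K. \<forall>a b. norm (a \<bullet>\<^sub>H b) \<le> norm a * norm b * K"
    by (intro exI[of _ 1]) (simp add: norm_qmul)
qed (unfold quat_eq_iff, simp_all add: algebra_simps)

lemmas qmul_scaleR_left = bounded_bilinear.scaleR_left[OF bounded_bilinear_qmul]
  and qmul_scaleR_right = bounded_bilinear.scaleR_right[OF bounded_bilinear_qmul]
  and qmul_zero_right = bounded_bilinear.zero_right[OF bounded_bilinear_qmul]

lemmas open_smooth_qmul [open_smooth_intros] = open_smooth_bilinear[OF bounded_bilinear_qmul]
  and open_smooth_qcnj [open_smooth_intros] = open_smooth_linear[OF bounded_linear_qcnj]

lemma open_smooth_vector4 [open_smooth_intros]: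
  fixes a b c d :: "'a::real_normed_vector \<Rightarrow> real"
  assumes "open_smooth U a" "open_smooth U b" "open_smooth U c" "open_smooth U d"
  shows "open_smooth U (\<lambda>x. vector [a x, b x, c x, d x] :: quat)"
proof -
  have "open_smooth U (\<lambda>x. a x *\<^sub>R vector [1, 0, 0, 0] + b x *\<^sub>R vector [0, 1, 0, 0] + c x *\<^sub>R vector [0, 0, 1, 0] + d x *\<^sub>R (vector [0, 0, 0, 1] :: quat))"
    by (intro open_smooth_add open_smooth_scaleR open_smooth_const open_smooth_open[OF assms(1)] assms)
  then show ?thesis by (rule open_smooth_cong) (simp add: quat_eq_iff)
qed

lemma open_smooth_qexp [open_smooth_intros]: "open_smooth U f \<Longrightarrow> open_smooth U (\<lambda>x. qexp (f x))"
  unfolding qexp_def by (intro open_smooth_vector4 open_smooth_sin open_smooth_cos open_smooth_const open_smooth_open)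

lemma qexp_add: "qexp (a + b) = qexp a \<bullet>\<^sub>H qexp b"
  unfolding quat_eq_iff by (simp add: cos_add sin_add)
lemma qexp_0 [simp]: "qexp 0 = qone" unfolding quat_eq_iff by simp
lemma qexp_2pi [simp]: "qexp (2 * pi) = qone" unfolding quat_eq_iff by simp
lemma qexp_int: "qexp (a + 2 * pi * of_int n) = qexp a"
  unfolding quat_eq_iff using sin_cos_eq_iff[of "a + 2 * pi * of_int n" a]
  by (metis qexp_nth add.commute)
lemma qcnj_qexp: "qcnj (qexp a) = qexp (- a)" unfolding quat_eq_iff by simp

lemma qexp_derivative: "(qexp has_vector_derivative qi \<bullet>\<^sub>H qexp t) (at t)"
proof -
  have e: "qexp = (\<lambda>t. cos t *\<^sub>R qone + sin t *\<^sub>R qi)" by (intro ext) (simp add: quat_eq_iff)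
  have "((\<lambda>t. cos t *\<^sub>R qone + sin t *\<^sub>R qi) has_vector_derivative (- sin t) *\<^sub>R qone + cos t *\<^sub>R qi) (at t)"
    by (auto intro!: derivative_eq_intros)
  moreover have "(- sin t) *\<^sub>R qone + cos t *\<^sub>R qi = qi \<bullet>\<^sub>H qexp t" by (simp add: quat_eq_iff)
  ultimately show ?thesis unfolding e by simp
qed

lemma trans_01: "trans_map 0 1 (v, w) = ((1 / (norm v)\<^sup>2) *\<^sub>R v, (1 / norm v) *\<^sub>R (w \<bullet>\<^sub>H v))"
  by (simp add: trans_map_def qpow_def)

lemma trans_10: "trans_map 1 0 (v, w) = ((1 / (norm v)\<^sup>2) *\<^sub>R v, (1 / norm v) *\<^sub>R (v \<bullet>\<^sub>H w))"
  by (simp add: trans_map_def qpow_def)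

text \<open>The inverse of the gluing map: multiplication by the conjugate of \<open>v\<close> divided by the modulus
  undoes multiplication by \<open>v\<close> divided by the modulus.\<close>

definition S01 :: "quat \<times> quat \<Rightarrow> quat \<times> quat" where
  "S01 = (\<lambda>(v, w). ((1 / (norm v)\<^sup>2) *\<^sub>R v, (1 / norm v) *\<^sub>R (w \<bullet>\<^sub>H qcnj v)))"

lemma open_smooth_trans_01: "open_smooth punctured (trans_map 0 1)"
proof -
  have e: "trans_map 0 1 = (\<lambda>x. ((1 / (norm (fst x))\<^sup>2) *\<^sub>R fst x, (1 / norm (fst x)) *\<^sub>R (snd x \<bullet>\<^sub>H fst x)))"
    using trans_01 by (intro ext) (metis prod.collapse)
  show ?thesis
    unfolding e by (intro open_smooth_Pair open_smooth_scaleR open_smooth_divide open_smooth_power open_smooth_norm open_smooth_qmul open_smooth_fst open_smooth_snd open_smooth_id open_smooth_const open_punctured; simp)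
qed

lemma open_smooth_S01: "open_smooth punctured S01"
proof -
  have e: "S01 = (\<lambda>x. ((1 / (norm (fst x))\<^sup>2) *\<^sub>R fst x, (1 / norm (fst x)) *\<^sub>R (snd x \<bullet>\<^sub>H qcnj (fst x))))"
    by (intro ext) (simp add: S01_def split_beta)
  show ?thesis
    unfolding e by (intro open_smooth_Pair open_smooth_scaleR open_smooth_divide open_smooth_power open_smooth_norm open_smooth_qmul open_smooth_qcnj open_smooth_fst open_smooth_snd open_smooth_id open_smooth_const open_punctured; simp)
qed

lemma trans_S01: assumes "fst x \<noteq> 0" shows "trans_map 0 1 (S01 x) = x" "S01 (trans_map 0 1 x) = x"
proof -
  obtain v w where x: "x = (v, w)" by (cases x)
  have v: "norm v \<noteq> 0" using assms x by simp
  show "trans_map 0 1 (S01 x) = x" "S01 (trans_map 0 1 x) = x"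
    unfolding x S01_def trans_01 using v
    by (simp_all add: trans_01 qmul_scaleR_left qmul_scaleR_right qmul_assoc qmul_qcnj qcnj_scaleR power2_eq_square divide_simps)
qed

lemma norm_snd_trans_01: "fst x \<noteq> 0 \<Longrightarrow> norm (snd (trans_map 0 1 x)) = norm (snd x)"
  by (cases x) (simp add: trans_01 norm_qmul)

definition rot :: "real \<Rightarrow> quat \<times> quat \<Rightarrow> quat \<times> quat" where
  "rot t x = (fst x, qexp t \<bullet>\<^sub>H snd x)"
definition rotV :: "quat \<times> quat \<Rightarrow> quat \<times> quat" where
  "rotV x = (0, qi \<bullet>\<^sub>H snd x)"

lemma rot_0: "rot 0 x = x" by (simp add: rot_def)
lemma rot_add: "rot s (rot t x) = rot (s + t) x" by (simp add: rot_def qexp_add qmul_assoc)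
lemma rot_M: "x \<in> R4xS3 \<Longrightarrow> rot t x \<in> R4xS3"
  by (simp add: rot_def R4xS3_def mem_Times_iff norm_qmul)
lemma fst_rot [simp]: "fst (rot t x) = fst x" by (simp add: rot_def)
lemma trans_rot: "trans_map 0 1 (rot t x) = rot t (trans_map 0 1 x)"
  by (cases x) (simp add: rot_def trans_01 qmul_scaleR_right qmul_assoc)
lemma rot_derivative: "((\<lambda>t. rot t x) has_vector_derivative rotV (rot t x)) (at t)"
proof -
  have "((\<lambda>t. qexp t \<bullet>\<^sub>H snd x) has_vector_derivative qi \<bullet>\<^sub>H qexp t \<bullet>\<^sub>H snd x) (at t)"
    using bounded_linear.has_vector_derivative[OF bounded_bilinear.bounded_linear_left[OF bounded_bilinear_qmul] qexp_derivative] .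
  from has_vector_derivative_Pair[OF has_vector_derivative_const this, of "fst x"]
  show ?thesis by (simp add: rot_def[abs_def] rotV_def qmul_assoc)
qed
lemma rotV_nz: "x \<in> R4xS3 \<Longrightarrow> rotV x \<noteq> 0"
proof
  assume x: "x \<in> R4xS3" "rotV x = 0"
  then have "norm (qi \<bullet>\<^sub>H snd x) = 0" by (simp add: rotV_def zero_prod_def)
  moreover have "norm qi = 1" using norm_qexp[of "pi/2"] by (metis qexp_def qi_def cos_pi_half sin_pi_half)
  ultimately show False using x by (simp add: norm_qmul R4xS3_def mem_Times_iff)
qed
lemma open_smooth_rotV: "open_smooth UNIV rotV"
  unfolding rotV_def[abs_def] by (intro open_smooth_Pair open_smooth_const open_smooth_qmul open_smooth_snd open_smooth_id open_UNIV)
lemma rot_closed: "rot (2 * pi) x = x" by (simp add: rot_def)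

section \<open>A flat function\<close>

text \<open>The functions \<open>t\<^sup>-\<^sup>n e\<^sup>-\<^sup>1\<^sup>/\<^sup>t\<close>, extended by \<open>0\<close>. Only \<open>n = 0\<close> is of interest, but the derivative of
  each of them is a combination of others, so that the whole family is smooth by induction on the order.\<close>

definition flat :: "nat \<Rightarrow> real \<Rightarrow> real" where
  "flat n t = (if t > 0 then (1 / t) ^ n * exp (- (1 / t)) else 0)"

lemma flat_tendsto: "(flat n \<longlongrightarrow> 0) (at_right 0)"
proof -
  have "((\<lambda>x::real. x ^ n / exp x) \<longlongrightarrow> 0) at_top" by (rule tendsto_power_div_exp_0)
  then have "((\<lambda>t. (inverse t) ^ n / exp (inverse t)) \<longlongrightarrow> (0::real)) (at_right 0)"
    by (rule filterlim_compose[OF _ filterlim_inverse_at_top_right])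
  then show ?thesis
  proof (rule Lim_transform_eventually)
    show "\<forall>\<^sub>F t in at_right 0. (inverse t) ^ n / exp (inverse t) = flat n t"
      by (auto simp: eventually_at_right_field flat_def exp_minus divide_inverse intro!: exI[of _ 1])
  qed
qed

lemma flat_derivative: "(flat n has_real_derivative (flat (n + 2) t - real n * flat (n + 1) t)) (at t)"
proof -
  consider "t > 0" | "t < 0" | "t = 0" by linarith
  then show ?thesis
  proof cases
    case 1
    define u where "u = 1 / t"
    have u: "((\<lambda>t. 1 / t) has_real_derivative - u\<^sup>2) (at t)"
      using 1 by (auto intro!: derivative_eq_intros simp: u_def power2_eq_square)
    have "((\<lambda>t. (1 / t) ^ n * exp (- (1 / t))) has_real_derivative
        (real n * (- u\<^sup>2 * u ^ (n - 1))) * exp (- u) + exp (- u) * - (- u\<^sup>2) * u ^ n) (at t)"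
      using DERIV_mult[OF DERIV_power[OF u, of n] DERIV_fun_exp[OF DERIV_minus[OF u]]] by (simp add: u_def)
    moreover have "(real n * (- u\<^sup>2 * u ^ (n - 1))) * exp (- u) + exp (- u) * - (- u\<^sup>2) * u ^ n
        = flat (n + 2) t - real n * flat (n + 1) t"
      using 1 by (cases n) (simp_all add: flat_def u_def[symmetric] power2_eq_square algebra_simps)
    ultimately have "((\<lambda>t. (1 / t) ^ n * exp (- (1 / t))) has_real_derivative flat (n + 2) t - real n * flat (n + 1) t) (at t)"
      by simp
    then show ?thesis
      by (rule has_field_derivative_transform_within_open[of _ _ _ "{0<..}"]) (use 1 in \<open>auto simp: flat_def\<close>)
  next
    case 2
    have "((\<lambda>t. 0) has_real_derivative flat (n + 2) t - real n * flat (n + 1) t) (at t)"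
      using 2 by (simp add: flat_def)
    then show ?thesis
      by (rule has_field_derivative_transform_within_open[of _ _ _ "{..<0}"]) (use 2 in \<open>auto simp: flat_def\<close>)
  next
    case 3
    have "((\<lambda>y. (flat n y - flat n 0) / (y - 0)) \<longlongrightarrow> 0) (at 0)"
    proof (rule filterlim_split_at)
      show "((\<lambda>y. (flat n y - flat n 0) / (y - 0)) \<longlongrightarrow> 0) (at_left 0)"
        by (rule Lim_transform_eventually[OF tendsto_const])
           (auto simp: eventually_at_left_field flat_def intro!: exI[of _ "-1"])
      show "((\<lambda>y. (flat n y - flat n 0) / (y - 0)) \<longlongrightarrow> 0) (at_right 0)"
        by (rule Lim_transform_eventually[OF flat_tendsto[of "Suc n"]])
           (auto simp: eventually_at_right_field flat_def intro!: exI[of _ 1])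
    qed
    then show ?thesis using 3 by (simp add: has_field_derivative_iff flat_def)
  qed
qed

lemma open_smooth_flat_aux: "open_smooth UNIV (flat n)"
proof -
  have "Ck_on k UNIV (flat n)" for k n
  proof (induction k arbitrary: n)
    case 0
    show ?case using flat_derivative by (auto intro!: continuous_at_imp_continuous_on DERIV_isCont)
  next
    case (Suc k)
    have "Ck_on k UNIV (\<lambda>t. flat (n + 2) t + (- real n) * flat (n + 1) t)"
      by (intro Ck_on_add open_UNIV Suc Ck_on_bilinear[OF open_UNIV bounded_bilinear_mult] Ck_on_const)
    then show ?case
      by (rule Ck_on_Suc_realI[OF open_UNIV, rotated])
         (use flat_derivative[of n] in \<open>simp add: has_real_derivative_iff_has_vector_derivative\<close>)
  qed
  then show ?thesis by (simp add: open_smooth_def)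
qed

lemmas open_smooth_flat [open_smooth_intros] = open_smooth_compose[OF open_smooth_flat_aux _ UNIV_I]

section \<open>Bump and step functions\<close>

lemma flat0_nonneg: "0 \<le> flat 0 t"
  and flat0_zero: "flat 0 t = 0 \<longleftrightarrow> t \<le> 0"
  by (auto simp: flat_def)

text \<open>The product \<open>u (2 - u)\<close> has maximum \<open>1\<close>, attained at \<open>u = 1\<close>, and is nonpositive for \<open>u \<ge> 2\<close>. Since \<open>flat 0\<close> increases
  to \<open>e\<^sup>-\<^sup>1\<close> at \<open>1\<close>, the factor \<open>e\<close> makes \<open>1\<close> the maximum of \<open>bump\<close>.\<close>

definition bump :: "real \<Rightarrow> real" where "bump u = exp 1 * flat 0 (u * (2 - u))"

lemma open_smooth_bump [open_smooth_intros]: assumes "open_smooth U f" shows "open_smooth U (\<lambda>x. bump (f x))"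
  unfolding bump_def by (intro open_smooth_mult open_smooth_flat open_smooth_diff open_smooth_const open_smooth_open[OF assms] assms)

lemma bump_zero: "u \<ge> 2 \<Longrightarrow> bump u = 0"
  using mult_nonneg_nonpos[of u "2 - u"] by (simp add: bump_def flat0_zero)

lemma
  shows bump_le_1: "bump u \<le> 1" and bump_eq_1: "bump u = 1 \<longleftrightarrow> u = 1"
proof -
  have sq: "u * (2 - u) = 1 - (u - 1)\<^sup>2" by (simp add: power2_eq_square algebra_simps)
  have "bump u \<le> 1 \<and> (bump u = 1 \<longleftrightarrow> u = 1)"
  proof (cases "u * (2 - u) > 0")
    case False
    then show ?thesis by (auto simp: bump_def flat_def)
  next
    case True
    define t where "t = u * (2 - u)"
    have b: "bump u = exp (1 - 1 / t)" using True by (simp add: bump_def flat_def t_def exp_diff exp_minus field_simps)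
    have "t \<le> 1" by (simp add: t_def sq)
    then have "1 / t \<ge> 1" using True by (simp add: t_def[symmetric])
    moreover have "1 / t = 1 \<longleftrightarrow> u = 1" using True unfolding t_def[symmetric] by (auto simp: t_def sq)
    ultimately show ?thesis unfolding b by auto
  qed
  then show "bump u \<le> 1" "bump u = 1 \<longleftrightarrow> u = 1" by auto
qed

text \<open>The constant pieces extend inside the interval from \<open>0\<close> to \<open>1\<close>; this makes \<open>gauge\<close> below smooth at
  the integers.\<close>

definition step :: "real \<Rightarrow> real" where
  "step x = flat 0 (3 * x - 1) / (flat 0 (3 * x - 1) + flat 0 (2 - 3 * x))"

lemma step_0: "x \<le> 1/3 \<Longrightarrow> step x = 0" and step_1: "x \<ge> 2/3 \<Longrightarrow> step x = 1"
proof -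
  show "x \<le> 1/3 \<Longrightarrow> step x = 0" using flat0_zero[of "3 * x - 1"] by (simp add: step_def)
  show "x \<ge> 2/3 \<Longrightarrow> step x = 1" using flat0_zero[of "2 - 3 * x"] flat0_zero[of "3 * x - 1"] by (simp add: step_def)
qed

lemma open_smooth_step [open_smooth_intros]: assumes "open_smooth U f" shows "open_smooth U (\<lambda>x. step (f x))"
proof -
  have "flat 0 (3 * x - 1) + flat 0 (2 - 3 * x) \<noteq> 0" for x
    using flat0_nonneg[of "3 * x - 1"] flat0_nonneg[of "2 - 3 * x"] flat0_zero[of "3 * x - 1"] flat0_zero[of "2 - 3 * x"]
    by linarith
  then show ?thesis unfolding step_def
    by (intro open_smooth_divide open_smooth_add open_smooth_mult open_smooth_flat open_smooth_diff open_smooth_const open_smooth_open[OF assms] assms)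
qed

section \<open>A quasi-periodic family of unit quaternions\<close>

definition qj :: "real \<Rightarrow> quat" where "qj t = vector [cos t, 0, sin t, 0]"
text \<open>Conjugation by \<open>j\<close> reverses \<open>i\<close>. As the step function grows from \<open>0\<close> to \<open>1\<close>, the loop
  \<open>e\<^sup>i\<^sup>y (q e\<^sup>-\<^sup>i\<^sup>y q\<^sup>-\<^sup>1)\<close>, with \<open>q\<close> moving from \<open>1\<close> to \<open>j\<close>, is therefore deformed from the constant loop \<open>1\<close>
  into \<open>e\<^sup>2\<^sup>i\<^sup>y\<close>.\<close>

definition gauge_step :: "real \<Rightarrow> real \<Rightarrow> quat" where
  "gauge_step x y = qexp y \<bullet>\<^sub>H qj (pi / 2 * step x) \<bullet>\<^sub>H qexp (- y) \<bullet>\<^sub>H qcnj (qj (pi / 2 * step x))"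
definition gauge :: "real \<Rightarrow> real \<Rightarrow> quat" where
  "gauge x y = qexp (2 * of_int \<lfloor>x\<rfloor> * y) \<bullet>\<^sub>H gauge_step (x - of_int \<lfloor>x\<rfloor>) y"

lemma open_smooth_gauge_step [open_smooth_intros]:
  assumes "open_smooth U a" "open_smooth U b" shows "open_smooth U (\<lambda>p. gauge_step (a p) (b p))"
  unfolding gauge_step_def qj_def
  by (intro open_smooth_qmul open_smooth_qcnj open_smooth_qexp open_smooth_vector4 open_smooth_uminus open_smooth_sin open_smooth_cos open_smooth_mult open_smooth_step open_smooth_const open_smooth_open[OF assms(1)] assms)

lemma gauge_step_0: "x \<le> 1/3 \<Longrightarrow> gauge_step x y = qone"
proof -
  assume "x \<le> 1/3"
  moreover have "qj 0 = qone" by (simp add: qj_def quat_eq_iff)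
  ultimately show ?thesis by (simp add: gauge_step_def step_0 qexp_add[symmetric])
qed

lemma gauge_step_1: "x \<ge> 2/3 \<Longrightarrow> gauge_step x y = qexp (2 * y)"
proof -
  assume "x \<ge> 2/3"
  then have "gauge_step x y = qexp y \<bullet>\<^sub>H qj (pi / 2) \<bullet>\<^sub>H qexp (- y) \<bullet>\<^sub>H qcnj (qj (pi / 2))" by (simp add: gauge_step_def step_1)
  also have "\<dots> = qexp (y + y)"
    unfolding qexp_add by (simp add: quat_eq_iff qj_def)
  finally show ?thesis by simp
qed

lemma norm_gauge_step: "norm (gauge_step x y) = 1"
proof -
  have "norm (qj t) = 1" for t
  proof -
    have "(norm (qj t))\<^sup>2 = 1" unfolding qnorm2 by (simp add: qj_def)
    then show ?thesis using power2_eq_imp_eq[of "norm (qj t)" 1] by simp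
  qed
  then show ?thesis by (simp add: gauge_step_def norm_qmul)
qed

lemma norm_gauge [simp]: "norm (gauge x y) = 1" by (simp add: gauge_def norm_qmul norm_gauge_step)

text \<open>On an open interval reaching beyond the unit interval the integer part may be replaced by a
  constant, because \<open>gauge_step\<close> is \<open>1\<close> near its left end and \<open>e\<^sup>2\<^sup>i\<^sup>y\<close> near its right end. Thus
  \<open>gauge\<close> is smooth although the integer part jumps.\<close>

lemma gauge_local:
  assumes "of_int n - 1/3 < x" "x < of_int n + 4/3"
  shows "gauge x y = qexp (2 * of_int n * y) \<bullet>\<^sub>H gauge_step (x - of_int n) y"
proof -
  consider "\<lfloor>x\<rfloor> = n - 1" | "\<lfloor>x\<rfloor> = n" | "\<lfloor>x\<rfloor> = n + 1" using assms by linarith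
  then show ?thesis
  proof cases
    case 1
    then have "x < of_int n" by linarith
    then have "gauge_step (x - of_int n) y = qone" "gauge_step (x - of_int \<lfloor>x\<rfloor>) y = qexp (2 * y)"
      using 1 assms by (auto intro!: gauge_step_0 gauge_step_1)
    moreover have "qexp (2 * of_int (n - 1) * y) \<bullet>\<^sub>H qexp (2 * y) = qexp (2 * of_int n * y)"
      by (simp add: qexp_add[symmetric] algebra_simps)
    ultimately show ?thesis unfolding gauge_def 1 by simp
  next
    case 3
    then have "x \<ge> of_int n + 1" by linarith
    then have "gauge_step (x - of_int \<lfloor>x\<rfloor>) y = qone" "gauge_step (x - of_int n) y = qexp (2 * y)"
      using 3 assms by (auto intro!: gauge_step_0 gauge_step_1)
    moreover have "qexp (2 * of_int n * y) \<bullet>\<^sub>H qexp (2 * y) = qexp (2 * of_int (n + 1) * y)"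
      by (simp add: qexp_add[symmetric] algebra_simps)
    ultimately show ?thesis unfolding gauge_def 3 by simp
  qed (simp add: gauge_def)
qed

lemma gauge_shift: "gauge (x + of_int n) y = qexp (2 * of_int n * y) \<bullet>\<^sub>H gauge x y"
  by (simp add: gauge_def qmul_assoc[symmetric] qexp_add[symmetric] algebra_simps)

lemma qexp_int': "qexp (2 * of_int k * (y + 2 * pi * of_int m)) = qexp (2 * of_int k * y)"
  using qexp_int[of "2 * of_int k * y" "2 * k * m"] by (simp add: algebra_simps)

lemma gauge_periodic: "gauge x (y + 2 * pi * of_int m) = gauge x y"
proof -
  have "qexp (- (y + 2 * pi * of_int m)) = qexp (- y)" using qexp_int[of "- y" "- m"] by simp
  then show ?thesis unfolding gauge_def gauge_step_def qexp_int' qexp_int by simp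
qed

lemma open_smooth_gauge_aux: "open_smooth UNIV (\<lambda>p. gauge (fst p) (snd p))"
proof (rule open_smooth_locally[OF open_UNIV])
  fix p :: "real \<times> real"
  define n where "n = \<lfloor>fst p\<rfloor>"
  define W where "W = {q :: real \<times> real. of_int n - 1/3 < fst q} \<inter> {q. fst q < of_int n + 4/3}"
  have W: "open W" unfolding W_def by (intro open_Int open_Collect_less continuous_intros)
  have "open_smooth W (\<lambda>q. qexp (2 * of_int n * snd q) \<bullet>\<^sub>H gauge_step (fst q - of_int n) (snd q))"
    by (intro open_smooth_qmul open_smooth_qexp open_smooth_mult open_smooth_const open_smooth_snd open_smooth_fst open_smooth_id W open_smooth_gauge_step open_smooth_diff)
  then have "open_smooth W (\<lambda>p. gauge (fst p) (snd p))"
    by (rule open_smooth_cong) (simp add: gauge_local[symmetric] W_def)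
  moreover have "p \<in> W" unfolding W_def n_def by (simp; linarith)
  ultimately show "\<exists>W. p \<in> W \<and> W \<subseteq> UNIV \<and> open_smooth W (\<lambda>p. gauge (fst p) (snd p))" by blast
qed

lemma open_smooth_gauge [open_smooth_intros]:
  assumes "open_smooth U a" "open_smooth U b" shows "open_smooth U (\<lambda>p. gauge (a p) (b p))"
  using open_smooth_compose[OF open_smooth_gauge_aux open_smooth_Pair[OF assms]] by simp

lemma gauge_inverse: "gauge x y \<bullet>\<^sub>H (qcnj (gauge x y) \<bullet>\<^sub>H z) = z" "qcnj (gauge x y) \<bullet>\<^sub>H (gauge x y \<bullet>\<^sub>H z) = z"
  by (simp_all add: qmul_assoc[symmetric] qmul_qcnj)

lemma qexp_inverse: "qexp (- a) \<bullet>\<^sub>H (qexp a \<bullet>\<^sub>H z) = z"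
  by (simp add: qmul_assoc[symmetric] qexp_add[symmetric])

section \<open>A flow with closed orbits modulo deck transformations\<close>

text \<open>A point is \<open>(x, y, \<phi>, \<zeta>)\<close>.\<close>

type_synonym cov = "real \<times> real \<times> real \<times> quat"

text \<open>Along an orbit \<open>\<phi>\<close> grows at rate \<open>r\<^sup>2\<close> and \<open>(x, y)\<close> moves on a circle of radius \<open>\<rho> = s / r\<close>, whose
  centre has abscissa \<open>X\<close>. With \<open>\<phi>\<close> as parameter the angle of \<open>\<zeta>\<close> has derivative
  \<open>2 X \<rho> sin \<phi> - \<rho>\<^sup>2 cos 2\<phi>\<close>, of which \<open>- Xi\<close> is an antiderivative. It is periodic: there is no term
  linear in \<open>\<phi>\<close>, which is why the orbits close up.\<close>

definition Xi :: "real \<Rightarrow> real \<Rightarrow> real \<Rightarrow> real" where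
  "Xi X \<rho> p = 2 * X * \<rho> * cos p + \<rho>\<^sup>2 * sin p * cos p"

text \<open>Where \<open>r = 0\<close> the circle of radius \<open>s / r\<close> makes no sense; there \<open>s = 1\<close>, and \<open>\<zeta>\<close>
  rotates backwards at unit speed.\<close>

definition cover_flow :: "real \<Rightarrow> cov \<Rightarrow> cov" where
  "cover_flow t = (\<lambda>(x, y, p, z). let s = bump (z \<bullet> z); r = 1 - s in
     if r = 0 then (x, y, p, qexp (- t) \<bullet>\<^sub>H z)
     else let \<rho> = s / r; X = x - \<rho> * sin p; p' = p + r\<^sup>2 * t in
       (X + \<rho> * sin p', y + \<rho> * cos p - \<rho> * cos p', p', qexp (Xi X \<rho> p - Xi X \<rho> p') \<bullet>\<^sub>H z))"

definition cover_field :: "cov \<Rightarrow> cov" where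
  "cover_field = (\<lambda>(x, y, p, z). let s = bump (z \<bullet> z); r = 1 - s in
     (r * s * cos p, r * s * sin p, r\<^sup>2, (2 * x * (r * s * sin p) - s\<^sup>2) *\<^sub>R (qi \<bullet>\<^sub>H z)))"

text \<open>Replacing \<open>x\<close> by \<open>x + n\<close> adds \<open>2 n y'\<close> to the angular velocity \<open>2 x y' - s\<^sup>2\<close> of \<open>\<zeta>\<close>. The accompanying
  rotation of \<open>\<zeta>\<close> by \<open>e\<^sup>2\<^sup>i\<^sup>n\<^sup>y\<close> has just this angular velocity, so that the field is invariant.\<close>

definition deck :: "int \<Rightarrow> int \<Rightarrow> int \<Rightarrow> cov \<Rightarrow> cov" where
  "deck n m l = (\<lambda>(x, y, p, z). (x + of_int n, y + 2 * pi * of_int m, p + 2 * pi * of_int l, qexp (2 * of_int n * y) \<bullet>\<^sub>H z))"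

lemma inner_qexp_mul: "(qexp t \<bullet>\<^sub>H z) \<bullet> (qexp t \<bullet>\<^sub>H z) = z \<bullet> z"
  by (simp add: power2_norm_eq_inner[symmetric] norm_qmul)

lemma cover_flow_0: "cover_flow 0 q = q"
  by (cases q) (auto simp: cover_flow_def Let_def)

lemma cover_flow_add: "cover_flow s (cover_flow t q) = cover_flow (s + t) q"
proof -
  obtain x y p z where q: "q = (x, y, p, z)" by (cases q) auto
  show ?thesis unfolding q cover_flow_def
    by (auto simp: Let_def inner_qexp_mul qmul_assoc[symmetric] qexp_add[symmetric] algebra_simps)
qed

lemma open_smooth_cover_field: "open_smooth UNIV cover_field"
  unfolding cover_field_def split_beta Let_def
  by (intro open_smooth_Pair open_smooth_mult open_smooth_diff open_smooth_power open_smooth_scaleR open_smooth_qmul open_smooth_bump open_smooth_inner open_smooth_cos open_smooth_sin open_smooth_const open_smooth_fst open_smooth_snd open_smooth_id open_UNIV)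

lemma cover_flow_cover_field: "((\<lambda>t. cover_flow t q) has_vector_derivative cover_field q) (at 0)"
proof -
  obtain x y p z where q: "q = (x, y, p, z)" by (cases q) auto
  define s r where sr: "s = bump (z \<bullet> z)" "r = 1 - s"
  have Z: "((\<lambda>t. qexp (f t) \<bullet>\<^sub>H z) has_vector_derivative f' *\<^sub>R (qi \<bullet>\<^sub>H z)) (at 0)"
    if "(f has_real_derivative f') (at 0)" "f 0 = 0" for f f'
  proof -
    have "(f has_vector_derivative f') (at 0)" using that by (simp add: has_real_derivative_iff_has_vector_derivative)
    from vector_diff_chain_at[OF this qexp_derivative]
    have "((\<lambda>t. qexp (f t)) has_vector_derivative f' *\<^sub>R qi) (at 0)" by (simp add: o_def that(2))
    from bounded_linear.has_vector_derivative[OF bounded_bilinear.bounded_linear_left[OF bounded_bilinear_qmul] this, of z]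
    show ?thesis by (simp add: qmul_scaleR_left)
  qed
  show ?thesis
  proof (cases "r = 0")
    case True
    have "((\<lambda>t. (x, y, p, qexp (- t) \<bullet>\<^sub>H z)) has_vector_derivative (0, 0, 0, (- 1) *\<^sub>R (qi \<bullet>\<^sub>H z))) (at 0)"
      by (intro has_vector_derivative_Pair has_vector_derivative_const Z) (auto intro!: derivative_eq_intros)
    then show ?thesis using True by (simp add: q cover_flow_def cover_field_def Let_def sr)
  next
    case False
    define \<rho> X where rX: "\<rho> = s / r" "X = x - \<rho> * sin p"
    have rr: "\<rho> * r\<^sup>2 = r * s" "\<rho>\<^sup>2 * r\<^sup>2 = s\<^sup>2" using False by (simp_all add: rX power2_eq_square)
    have "((\<lambda>t. (X + \<rho> * sin (p + r\<^sup>2 * t), y + \<rho> * cos p - \<rho> * cos (p + r\<^sup>2 * t), p + r\<^sup>2 * t,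
           qexp (Xi X \<rho> p - Xi X \<rho> (p + r\<^sup>2 * t)) \<bullet>\<^sub>H z)) has_vector_derivative
         (r * s * cos p, r * s * sin p, r\<^sup>2, (2 * x * (r * s * sin p) - s\<^sup>2) *\<^sub>R (qi \<bullet>\<^sub>H z))) (at 0)"
    proof (intro has_vector_derivative_Pair Z)
      show "((\<lambda>t. X + \<rho> * sin (p + r\<^sup>2 * t)) has_vector_derivative r * s * cos p) (at 0)"
        unfolding has_real_derivative_iff_has_vector_derivative[symmetric]
        by (auto intro!: derivative_eq_intros simp: rr[symmetric])
      show "((\<lambda>t. y + \<rho> * cos p - \<rho> * cos (p + r\<^sup>2 * t)) has_vector_derivative r * s * sin p) (at 0)"
        unfolding has_real_derivative_iff_has_vector_derivative[symmetric]
        by (auto intro!: derivative_eq_intros simp: rr[symmetric])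
      show "((\<lambda>t. p + r\<^sup>2 * t) has_vector_derivative r\<^sup>2) (at 0)"
        unfolding has_real_derivative_iff_has_vector_derivative[symmetric]
        by (auto intro!: derivative_eq_intros)
      have "((\<lambda>t. Xi X \<rho> p - Xi X \<rho> (p + r\<^sup>2 * t)) has_real_derivative
          2 * X * \<rho> * sin p * r\<^sup>2 - \<rho>\<^sup>2 * ((cos p)\<^sup>2 - (sin p)\<^sup>2) * r\<^sup>2) (at 0)"
        unfolding Xi_def by (auto intro!: derivative_eq_intros simp: power2_eq_square algebra_simps)
      moreover have "2 * X * \<rho> * sin p * r\<^sup>2 - \<rho>\<^sup>2 * ((cos p)\<^sup>2 - (sin p)\<^sup>2) * r\<^sup>2 = 2 * x * (r * s * sin p) - s\<^sup>2"
      proof -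
        have "2 * X * \<rho> * sin p * r\<^sup>2 - \<rho>\<^sup>2 * ((cos p)\<^sup>2 - (sin p)\<^sup>2) * r\<^sup>2
            = 2 * x * sin p * (\<rho> * r\<^sup>2) - (\<rho>\<^sup>2 * r\<^sup>2) * ((sin p)\<^sup>2 + (cos p)\<^sup>2)"
          unfolding rX(2) by algebra
        then show ?thesis unfolding rr by simp
      qed
      ultimately show "((\<lambda>t. Xi X \<rho> p - Xi X \<rho> (p + r\<^sup>2 * t)) has_real_derivative 2 * x * (r * s * sin p) - s\<^sup>2) (at 0)"
        by simp
    qed simp
    then show ?thesis using False by (simp add: q cover_flow_def cover_field_def Let_def sr rX)
  qed
qed

lemma cover_flow_regular:
  assumes "r = 1 - bump (z \<bullet> z)" "r \<noteq> 0" "\<rho> = bump (z \<bullet> z) / r" "p' = p + r\<^sup>2 * t"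
  shows "cover_flow t (x, y, p, z) = (x - \<rho> * sin p + \<rho> * sin p', y + \<rho> * cos p - \<rho> * cos p', p',
      qexp (Xi (x - \<rho> * sin p) \<rho> p - Xi (x - \<rho> * sin p) \<rho> p') \<bullet>\<^sub>H z)"
  using assms by (simp add: cover_flow_def Let_def)

lemma cover_flow_singular: "bump (z \<bullet> z) = 1 \<Longrightarrow> cover_flow t (x, y, p, z) = (x, y, p, qexp (- t) \<bullet>\<^sub>H z)"
  by (simp add: cover_flow_def)

lemma sin_cos_2pi_int: "sin (a + 2 * pi * of_int k) = sin a" "cos (a + 2 * pi * of_int k) = cos a"
  using qexp_int[of a k] by (simp_all add: quat_eq_iff)

text \<open>The shift of \<open>x\<close> by \<open>n\<close> adds \<open>2 n\<close> times the change of \<open>y\<close> to the angle of \<open>\<zeta>\<close>. This is exactly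
  the difference between the rotations \<open>e\<^sup>2\<^sup>i\<^sup>n\<^sup>y\<close> at the end and at the start of the orbit piece.\<close>

lemma cover_flow_deck: "cover_flow t (deck n m l q) = deck n m l (cover_flow t q)"
proof -
  obtain x y p z where q: "q = (x, y, p, z)" by (cases q) auto
  show ?thesis
  proof (cases "bump (z \<bullet> z) = 1")
    case True
    then show ?thesis unfolding q
      by (simp add: deck_def cover_flow_singular inner_qexp_mul qmul_assoc[symmetric] qexp_add[symmetric] add.commute)
  next
    case False
    define r where "r = 1 - bump (z \<bullet> z)"
    define \<rho> where "\<rho> = bump (z \<bullet> z) / r"
    define p' where "p' = p + r\<^sup>2 * t"
    have r: "r \<noteq> 0" using False by (simp add: r_def)
    have fl1: "cover_flow t (x, y, p, z) = (x - \<rho> * sin p + \<rho> * sin p', y + \<rho> * cos p - \<rho> * cos p', p',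
      qexp (Xi (x - \<rho> * sin p) \<rho> p - Xi (x - \<rho> * sin p) \<rho> p') \<bullet>\<^sub>H z)"
      by (rule cover_flow_regular[OF r_def r \<rho>_def p'_def])
    have fl2: "cover_flow t (x + of_int n, y + 2 * pi * of_int m, p + 2 * pi * of_int l, qexp (2 * of_int n * y) \<bullet>\<^sub>H z)
      = (x + of_int n - \<rho> * sin p + \<rho> * sin p', y + 2 * pi * of_int m + \<rho> * cos p - \<rho> * cos p', p' + 2 * pi * of_int l,
      qexp (Xi (x + of_int n - \<rho> * sin p) \<rho> p - Xi (x + of_int n - \<rho> * sin p) \<rho> p') \<bullet>\<^sub>H (qexp (2 * of_int n * y) \<bullet>\<^sub>H z))"
      by (subst cover_flow_regular[of r _ \<rho> "p' + 2 * pi * of_int l"])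
         (simp_all add: inner_qexp_mul r_def[symmetric] r \<rho>_def p'_def sin_cos_2pi_int Xi_def)
    have "Xi (x + of_int n - \<rho> * sin p) \<rho> p - Xi (x + of_int n - \<rho> * sin p) \<rho> p' + 2 * of_int n * y
      = 2 * of_int n * (y + \<rho> * cos p - \<rho> * cos p') + (Xi (x - \<rho> * sin p) \<rho> p - Xi (x - \<rho> * sin p) \<rho> p')"
      by (simp add: Xi_def algebra_simps)
    then show ?thesis unfolding q deck_def split fl1 fl2
      by (simp add: qmul_assoc[symmetric] qexp_add[symmetric])
  qed
qed

section \<open>An embedded product of a torus and Euclidean space\<close>

text \<open>The branch near \<open>a\<close> of the argument of \<open>z\<^sub>1 + i z\<^sub>2\<close>, defined where \<open>z\<^sub>1 + i z\<^sub>2\<close> has positive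
  inner product with \<open>e\<^sup>i\<^sup>a\<close>.\<close>

definition ang :: "real \<Rightarrow> real \<Rightarrow> real \<Rightarrow> real" where
  "ang a z1 z2 = a + arctan ((z2 * cos a - z1 * sin a) / (z1 * cos a + z2 * sin a))"

lemma ang_polar:
  assumes "z1 * cos a + z2 * sin a > 0"
  shows "sqrt (z1\<^sup>2 + z2\<^sup>2) * cos (ang a z1 z2) = z1" "sqrt (z1\<^sup>2 + z2\<^sup>2) * sin (ang a z1 z2) = z2"
proof -
  define X Y R where XY: "X = z1 * cos a + z2 * sin a" "Y = z2 * cos a - z1 * sin a" "R = sqrt (z1\<^sup>2 + z2\<^sup>2)"
  have X: "X > 0" using assms XY by simp
  have sc: "(sin a)\<^sup>2 = 1 - (cos a)\<^sup>2" by (simp add: sin_squared_eq)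
  have "X\<^sup>2 + Y\<^sup>2 = z1\<^sup>2 + z2\<^sup>2" unfolding XY using sc by algebra
  then have R: "R = sqrt (X\<^sup>2 + Y\<^sup>2)" by (simp add: XY)
  have R0: "R > 0" unfolding R using X by (intro real_sqrt_gt_zero add_pos_nonneg) auto
  have "1 + (Y / X)\<^sup>2 = (X\<^sup>2 + Y\<^sup>2) / X\<^sup>2" using X by (simp add: field_simps)
  then have s: "sqrt (1 + (Y / X)\<^sup>2) = R / X" using X by (simp add: real_sqrt_divide R)
  have c: "cos (arctan (Y / X)) = X / R" "sin (arctan (Y / X)) = Y / R"
    unfolding cos_arctan sin_arctan s using X R0 by simp_all
  have z: "X * cos a - Y * sin a = z1" "X * sin a + Y * cos a = z2" unfolding XY using sc by algebra+
  show "sqrt (z1\<^sup>2 + z2\<^sup>2) * cos (ang a z1 z2) = z1" "sqrt (z1\<^sup>2 + z2\<^sup>2) * sin (ang a z1 z2) = z2"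
    unfolding ang_def XY(1,2)[symmetric] XY(3)[symmetric] cos_add sin_add c using R0 z
    by (simp_all add: field_simps)
qed

lemma polar_exists:
  assumes "(a::real)\<^sup>2 + b\<^sup>2 \<noteq> 0"
  obtains t where "a * cos t + b * sin t > 0"
proof -
  have "a\<^sup>2 + b\<^sup>2 \<ge> 0" by simp
  then have p: "a\<^sup>2 + b\<^sup>2 > 0" using assms by linarith
  have s: "(sqrt (a\<^sup>2 + b\<^sup>2))\<^sup>2 = a\<^sup>2 + b\<^sup>2" by simp
  have "(a / sqrt (a\<^sup>2 + b\<^sup>2))\<^sup>2 + (b / sqrt (a\<^sup>2 + b\<^sup>2))\<^sup>2 = 1"
    unfolding power_divide s add_divide_distrib[symmetric] by (rule divide_self[OF assms])
  then obtain t where t: "a / sqrt (a\<^sup>2 + b\<^sup>2) = cos t" "b / sqrt (a\<^sup>2 + b\<^sup>2) = sin t"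
    using sincos_total_2pi by metis
  have "a * cos t + b * sin t = (a\<^sup>2 + b\<^sup>2) / sqrt (a\<^sup>2 + b\<^sup>2)"
    unfolding t[symmetric] by (simp add: power2_eq_square add_divide_distrib)
  also have "\<dots> > 0" by (rule divide_pos_pos[OF p real_sqrt_gt_zero[OF p]])
  finally have "a * cos t + b * sin t > 0" .
  then show thesis by (rule that)
qed

definition v12_sq :: "quat \<times> quat \<Rightarrow> real" where "v12_sq p = (fst p $ 1)\<^sup>2 + (fst p $ 2)\<^sup>2"
definition v34_sq :: "quat \<times> quat \<Rightarrow> real" where "v34_sq p = (fst p $ 3)\<^sup>2 + (fst p $ 4)\<^sup>2"
definition w12_sq :: "quat \<times> quat \<Rightarrow> real" where "w12_sq p = (snd p $ 1)\<^sup>2 + (snd p $ 2)\<^sup>2"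

definition torus_region :: "(quat \<times> quat) set" where "torus_region = {p. v12_sq p \<noteq> 0 \<and> v34_sq p \<noteq> 0 \<and> w12_sq p \<noteq> 0}"

text \<open>With \<open>v\<close> and \<open>w\<close> read as pairs of complex numbers, the coordinates are \<open>ln \<bar>v\<^sub>1\<bar>\<close>, \<open>ln \<bar>v\<^sub>2\<bar>\<close> and the
  real and imaginary part of \<open>w\<^sub>2 / w\<^sub>1\<close>.\<close>

definition eta :: "quat \<times> quat \<Rightarrow> quat" where
  "eta p = vector [ln (v12_sq p) / 2, ln (v34_sq p) / 2,
     (snd p $ 1 * snd p $ 3 + snd p $ 2 * snd p $ 4) / w12_sq p,
     (snd p $ 1 * snd p $ 4 - snd p $ 2 * snd p $ 3) / w12_sq p]"

definition emb :: "real \<Rightarrow> real \<Rightarrow> real \<Rightarrow> quat \<Rightarrow> quat \<times> quat" where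
  "emb x y p e = (vector [exp (e $ 1) * cos (2 * pi * x), exp (e $ 1) * sin (2 * pi * x), exp (e $ 2) * cos y, exp (e $ 2) * sin y],
     qexp p \<bullet>\<^sub>H ((1 / sqrt (1 + (e $ 3)\<^sup>2 + (e $ 4)\<^sup>2)) *\<^sub>R vector [1, 0, e $ 3, e $ 4]))"

definition cover_map :: "cov \<Rightarrow> quat \<times> quat" where
  "cover_map = (\<lambda>(x, y, p, z). emb x y p (qcnj (gauge x y) \<bullet>\<^sub>H z))"

text \<open>A smooth local section of \<open>cover_map\<close>, one for each choice of branches of the three arguments.\<close>

definition local_lift :: "real \<Rightarrow> real \<Rightarrow> real \<Rightarrow> quat \<times> quat \<Rightarrow> cov" where
  "local_lift a b c p = (let x = ang a (fst p $ 1) (fst p $ 2) / (2 * pi); y = ang b (fst p $ 3) (fst p $ 4) in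
     (x, y, ang c (snd p $ 1) (snd p $ 2), gauge x y \<bullet>\<^sub>H eta p))"

definition lift_dom :: "real \<Rightarrow> real \<Rightarrow> real \<Rightarrow> (quat \<times> quat) set" where
  "lift_dom a b c = {p. fst p $ 1 * cos a + fst p $ 2 * sin a > 0} \<inter> {p. fst p $ 3 * cos b + fst p $ 4 * sin b > 0}
     \<inter> {p. snd p $ 1 * cos c + snd p $ 2 * sin c > 0}"

lemma A_nonneg: "v12_sq p \<ge> 0" "v34_sq p \<ge> 0" "w12_sq p \<ge> 0" by (simp_all add: v12_sq_def v34_sq_def w12_sq_def)

lemma open_lift_dom: "open (lift_dom a b c)"
  unfolding lift_dom_def by (intro open_Int open_Collect_less continuous_intros)

lemma lift_dom_torus_region: "lift_dom a b c \<subseteq> torus_region"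
  by (auto simp: lift_dom_def torus_region_def v12_sq_def v34_sq_def w12_sq_def sum_power2_eq_zero_iff)

lemma lift_dom_exists: assumes "p \<in> torus_region" obtains a b c where "p \<in> lift_dom a b c"
proof -
  have A: "v12_sq p \<noteq> 0" "v34_sq p \<noteq> 0" "w12_sq p \<noteq> 0" using assms by (simp_all add: torus_region_def)
  obtain a where "fst p $ 1 * cos a + fst p $ 2 * sin a > 0" using polar_exists[OF A(1)[unfolded v12_sq_def]] .
  moreover obtain b where "fst p $ 3 * cos b + fst p $ 4 * sin b > 0" using polar_exists[OF A(2)[unfolded v34_sq_def]] .
  moreover obtain c where "snd p $ 1 * cos c + snd p $ 2 * sin c > 0" using polar_exists[OF A(3)[unfolded w12_sq_def]] .
  ultimately show thesis by (intro that[of a b c]) (simp add: lift_dom_def)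
qed

lemma open_smooth_A: "open U \<Longrightarrow> open_smooth U v12_sq" "open U \<Longrightarrow> open_smooth U v34_sq" "open U \<Longrightarrow> open_smooth U w12_sq"
  unfolding v12_sq_def[abs_def] v34_sq_def[abs_def] w12_sq_def[abs_def]
  by (intro open_smooth_add open_smooth_power open_smooth_nth open_smooth_fst open_smooth_snd open_smooth_id; assumption)+

lemma open_smooth_eta: "open_smooth (lift_dom a b c) eta"
proof -
  have pos: "v12_sq x > 0" "v34_sq x > 0" "w12_sq x > 0" if "x \<in> lift_dom a b c" for x
    using that lift_dom_torus_region A_nonneg[of x] by (fastforce simp: torus_region_def)+
  have nz: "w12_sq x \<noteq> 0" if "x \<in> lift_dom a b c" for x using pos[OF that] by simp
  show ?thesis unfolding eta_def[abs_def]
    by (intro open_smooth_vector4 open_smooth_divide open_smooth_ln open_smooth_A open_smooth_add open_smooth_diff open_smooth_mult open_smooth_nth open_smooth_fst open_smooth_snd open_smooth_id open_smooth_const open_lift_dom)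
       (use pos nz in auto)
qed

lemma open_smooth_ang:
  assumes "open_smooth U f" "open_smooth U g" "\<And>p. p \<in> U \<Longrightarrow> f p * cos a + g p * sin a > 0"
  shows "open_smooth U (\<lambda>p. ang a (f p) (g p))"
proof -
  have "f p * cos a + g p * sin a \<noteq> 0" if "p \<in> U" for p using assms(3)[OF that] by simp
  then show ?thesis unfolding ang_def
    by (intro open_smooth_add open_smooth_arctan open_smooth_divide open_smooth_diff open_smooth_mult open_smooth_const open_smooth_open[OF assms(1)] assms(1,2))
qed

lemma open_smooth_local_lift: "open_smooth (lift_dom a b c) (local_lift a b c)"
  unfolding local_lift_def Let_def
  by (intro open_smooth_Pair open_smooth_divide open_smooth_qmul open_smooth_gauge open_smooth_ang open_smooth_eta open_smooth_nth open_smooth_fst open_smooth_snd open_smooth_id open_smooth_const open_lift_dom)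
     (auto simp: lift_dom_def)

lemma open_smooth_cover_map: "open_smooth UNIV cover_map"
proof -
  have nz: "1 + (s::real)\<^sup>2 + t\<^sup>2 > 0" for s t by (simp add: add_pos_nonneg)
  have nz': "sqrt (1 + (s::real)\<^sup>2 + t\<^sup>2) \<noteq> 0" for s t using nz[of s t] by simp
  show ?thesis unfolding cover_map_def split_beta emb_def
    by (intro open_smooth_Pair open_smooth_vector4 open_smooth_mult open_smooth_exp open_smooth_cos open_smooth_sin open_smooth_scaleR open_smooth_divide open_smooth_sqrt open_smooth_add open_smooth_power open_smooth_qmul open_smooth_qexp
          open_smooth_qcnj open_smooth_gauge open_smooth_nth open_smooth_fst open_smooth_snd open_smooth_id open_smooth_const open_UNIV) (use nz nz' in auto)
qed

lemma emb_M: "emb x y p e \<in> R4xS3"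
proof -
  have "(norm (vector [1, 0, e $ 3, e $ 4] :: quat))\<^sup>2 = 1 + (e $ 3)\<^sup>2 + (e $ 4)\<^sup>2" by (simp add: qnorm2)
  then have n: "norm (vector [1, 0, e $ 3, e $ 4] :: quat) = sqrt (1 + (e $ 3)\<^sup>2 + (e $ 4)\<^sup>2)"
    by (metis norm_ge_zero real_sqrt_unique)
  have "1 + (e $ 3)\<^sup>2 + (e $ 4)\<^sup>2 > 0" by (simp add: add_pos_nonneg)
  then show ?thesis by (simp add: emb_def R4xS3_def mem_Times_iff norm_qmul n)
qed

lemma cover_map_M: "cover_map q \<in> R4xS3" by (cases q) (simp add: cover_map_def emb_M)

lemma emb_A: "v12_sq (emb x y p e) = (exp (e $ 1))\<^sup>2" "v34_sq (emb x y p e) = (exp (e $ 2))\<^sup>2"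
  "w12_sq (emb x y p e) = 1 / (1 + (e $ 3)\<^sup>2 + (e $ 4)\<^sup>2)"
proof -
  have "(a * cos t)\<^sup>2 + (a * sin t)\<^sup>2 = a\<^sup>2" for a t :: real
    by (simp add: power_mult_distrib distrib_left[symmetric])
  then show "v12_sq (emb x y p e) = (exp (e $ 1))\<^sup>2" "v34_sq (emb x y p e) = (exp (e $ 2))\<^sup>2"
    by (simp_all add: v12_sq_def v34_sq_def emb_def)
  have "1 + (e $ 3)\<^sup>2 + (e $ 4)\<^sup>2 > 0" by (simp add: add_pos_nonneg)
  then show "w12_sq (emb x y p e) = 1 / (1 + (e $ 3)\<^sup>2 + (e $ 4)\<^sup>2)"
    by (simp add: w12_sq_def emb_def power_divide add_divide_distrib[symmetric])
qed

lemma emb_torus_region: "emb x y p e \<in> torus_region"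
proof -
  have "1 + (e $ 3)\<^sup>2 + (e $ 4)\<^sup>2 > 0" by (simp add: add_pos_nonneg)
  then show ?thesis by (simp add: torus_region_def emb_A)
qed

lemma cover_map_torus_region: "cover_map q \<in> torus_region" by (cases q) (simp add: cover_map_def emb_torus_region)

lemma eta_emb: "eta (emb x y p e) = e"
proof -
  define d where "d = 1 + (e $ 3)\<^sup>2 + (e $ 4)\<^sup>2"
  have d: "d > 0" by (simp add: d_def add_pos_nonneg)
  define k where "k = 1 / sqrt d"
  have k: "k * k = 1 / d" using d by (simp add: k_def)
  have s: "snd (emb x y p e) $ 1 = k * cos p" "snd (emb x y p e) $ 2 = k * sin p"
    "snd (emb x y p e) $ 3 = k * (cos p * e $ 3 - sin p * e $ 4)"
    "snd (emb x y p e) $ 4 = k * (cos p * e $ 4 + sin p * e $ 3)"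
    unfolding emb_def d_def[symmetric] k_def[symmetric] by (simp_all add: algebra_simps)
  have sc: "(sin p)\<^sup>2 = 1 - (cos p)\<^sup>2" by (simp add: sin_squared_eq)
  have 3: "snd (emb x y p e) $ 1 * snd (emb x y p e) $ 3 + snd (emb x y p e) $ 2 * snd (emb x y p e) $ 4 = (k * k) * e $ 3"
    unfolding s using sc by algebra
  have 4: "snd (emb x y p e) $ 1 * snd (emb x y p e) $ 4 - snd (emb x y p e) $ 2 * snd (emb x y p e) $ 3 = (k * k) * e $ 4"
    unfolding s using sc by algebra
  show ?thesis
    unfolding eta_def 3 4 emb_A d_def[symmetric] k using d by (simp add: quat_eq_iff ln_realpow)
qed

lemma eta_cover_map: "eta (cover_map (x, y, p, z)) = qcnj (gauge x y) \<bullet>\<^sub>H z"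
  by (simp add: cover_map_def eta_emb)

lemma cover_map_local_lift: assumes "p \<in> lift_dom a b c" "p \<in> R4xS3" shows "cover_map (local_lift a b c p) = p"
proof -
  obtain v w where p: "p = (v, w)" by (cases p)
  have pos: "v12_sq p > 0" "v34_sq p > 0" "w12_sq p > 0"
    using assms lift_dom_torus_region A_nonneg[of p] by (fastforce simp: torus_region_def)+
  have D: "v $ 1 * cos a + v $ 2 * sin a > 0" "v $ 3 * cos b + v $ 4 * sin b > 0" "w $ 1 * cos c + w $ 2 * sin c > 0"
    using assms p by (auto simp: lift_dom_def)
  have "exp (ln A / 2) = sqrt A" if "A > 0" for A :: real
    using that by (simp add: powr_half_sqrt[symmetric] powr_def)
  from this[OF pos(1)] this[OF pos(2)]
  have E: "exp (ln (v12_sq p) / 2) = sqrt ((v $ 1)\<^sup>2 + (v $ 2)\<^sup>2)" "exp (ln (v34_sq p) / 2) = sqrt ((v $ 3)\<^sup>2 + (v $ 4)\<^sup>2)"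
    by (simp_all add: p v12_sq_def v34_sq_def)
  define h where "h = sqrt (w12_sq p)"
  have h: "h * h = w12_sq p" "h > 0" using pos by (simp_all add: h_def)
  have w: "(w$1)\<^sup>2 + (w$2)\<^sup>2 + (w$3)\<^sup>2 + (w$4)\<^sup>2 = 1"
    using assms(2) qnorm2[of w] by (simp add: p R4xS3_def)
  have w12_sq: "w12_sq p = (w$1)\<^sup>2 + (w$2)\<^sup>2" by (simp add: w12_sq_def p)
  define e where "e = eta p"
  have e3: "e $ 3 = (w$1 * w$3 + w$2 * w$4) / w12_sq p" and e4: "e $ 4 = (w$1 * w$4 - w$2 * w$3) / w12_sq p"
    by (simp_all add: e_def eta_def p)
  have e3': "e $ 3 * w12_sq p = w$1 * w$3 + w$2 * w$4" and e4': "e $ 4 * w12_sq p = w$1 * w$4 - w$2 * w$3"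
    using pos(3) by (simp_all add: e3 e4)
  \<comment> \<open>The identity \<open>1 + \<bar>w2 / w1\<bar>\<^sup>2 = 1 / \<bar>w1\<bar>\<^sup>2\<close> on the unit sphere.\<close>
  have "(1 + (e $ 3)\<^sup>2 + (e $ 4)\<^sup>2) * w12_sq p * w12_sq p = (w12_sq p)\<^sup>2 + (w$1 * w$3 + w$2 * w$4)\<^sup>2 + (w$1 * w$4 - w$2 * w$3)\<^sup>2"
    unfolding e3'[symmetric] e4'[symmetric] by algebra
  also have "\<dots> = w12_sq p * ((w$1)\<^sup>2 + (w$2)\<^sup>2 + (w$3)\<^sup>2 + (w$4)\<^sup>2)" unfolding w12_sq by algebra
  finally have "(1 + (e $ 3)\<^sup>2 + (e $ 4)\<^sup>2) * w12_sq p = 1" using pos(3) w by simp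
  then have "1 + (e $ 3)\<^sup>2 + (e $ 4)\<^sup>2 = 1 / w12_sq p" using pos(3) by (simp add: field_simps)
  then have k: "1 / sqrt (1 + (e $ 3)\<^sup>2 + (e $ 4)\<^sup>2) = h" by (simp add: real_sqrt_divide h_def)
  define t where "t = ang c (w $ 1) (w $ 2)"
  have ht: "h * cos t = w $ 1" "h * sin t = w $ 2"
    using ang_polar[OF D(3)] by (simp_all add: h_def w12_sq t_def)
  have w3: "w $ 3 = w$1 * e $ 3 - w$2 * e $ 4" and w4: "w $ 4 = w$1 * e $ 4 + w$2 * e $ 3"
  proof -
    have "w12_sq p * w $ 3 = w$1 * (e $ 3 * w12_sq p) - w$2 * (e $ 4 * w12_sq p)"
      unfolding e3' e4' unfolding w12_sq by algebra
    then have "w12_sq p * w $ 3 = w12_sq p * (w$1 * e $ 3 - w$2 * e $ 4)" by (simp add: algebra_simps)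
    then show "w $ 3 = w$1 * e $ 3 - w$2 * e $ 4" using pos(3) by simp
    have "w12_sq p * w $ 4 = w$1 * (e $ 4 * w12_sq p) + w$2 * (e $ 3 * w12_sq p)"
      unfolding e3' e4' unfolding w12_sq by algebra
    then have "w12_sq p * w $ 4 = w12_sq p * (w$1 * e $ 4 + w$2 * e $ 3)" by (simp add: algebra_simps)
    then show "w $ 4 = w$1 * e $ 4 + w$2 * e $ 3" using pos(3) by simp
  qed
  have W: "qexp t \<bullet>\<^sub>H (h *\<^sub>R vector [1, 0, e $ 3, e $ 4]) = w"
    unfolding quat_eq_iff by (simp add: w3 w4 ht[symmetric] algebra_simps)
  have V: "vector [exp (e $ 1) * cos (2 * pi * (ang a (v $ 1) (v $ 2) / (2 * pi))), exp (e $ 1) * sin (2 * pi * (ang a (v $ 1) (v $ 2) / (2 * pi))),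
      exp (e $ 2) * cos (ang b (v $ 3) (v $ 4)), exp (e $ 2) * sin (ang b (v $ 3) (v $ 4))] = v"
    unfolding quat_eq_iff using ang_polar[OF D(1)] ang_polar[OF D(2)] E by (simp add: e_def eta_def)
  have "cover_map (local_lift a b c p) = emb (ang a (v $ 1) (v $ 2) / (2 * pi)) (ang b (v $ 3) (v $ 4)) t e"
    by (simp add: cover_map_def local_lift_def Let_def gauge_inverse e_def t_def p)
  also have "\<dots> = p" unfolding emb_def k W V p ..
  finally show ?thesis .
qed

lemma cover_map_surj: assumes "p \<in> torus_region" "p \<in> R4xS3" obtains q where "cover_map q = p"
  using lift_dom_exists[OF assms(1)] cover_map_local_lift assms(2) by metis

lemma cover_map_deck: "cover_map (deck n m l q) = cover_map q"
proof -
  obtain x y p z where q: "q = (x, y, p, z)" by (cases q) auto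
  have e: "qcnj (gauge (x + of_int n) (y + 2 * pi * of_int m)) \<bullet>\<^sub>H (qexp (2 * of_int n * y) \<bullet>\<^sub>H z) = qcnj (gauge x y) \<bullet>\<^sub>H z"
    unfolding gauge_periodic gauge_shift qcnj_qmul qcnj_qexp qmul_assoc qexp_inverse ..
  have x: "2 * pi * (x + of_int n) = 2 * pi * x + 2 * pi * of_int n" by (simp add: algebra_simps)
  show ?thesis unfolding q deck_def cover_map_def split e emb_def x sin_cos_2pi_int qexp_int ..
qed

lemma polar_inj:
  assumes "c > 0" "c' > 0" "c * cos t = c' * cos t'" "c * sin t = c' * sin t'"
  shows "\<exists>k::int. t' = t + 2 * pi * of_int k"
proof -
  have sq: "c\<^sup>2 = (c * cos t)\<^sup>2 + (c * sin t)\<^sup>2" for c t :: real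
    by (simp add: power_mult_distrib distrib_left[symmetric])
  have "c\<^sup>2 = c'\<^sup>2" using sq[of c t] sq[of c' t'] assms by simp
  then have "c = c'" using assms by simp
  then have "sin t' = sin t \<and> cos t' = cos t" using assms by simp
  then show ?thesis using sin_cos_eq_iff[of t' t] by simp
qed

lemma cover_map_inj: assumes "cover_map q = cover_map q'" shows "\<exists>n m l. q' = deck n m l q"
proof -
  obtain x y p z where q: "q = (x, y, p, z)" by (cases q) auto
  obtain x' y' p' z' where q': "q' = (x', y', p', z')" by (cases q') auto
  define e where "e = qcnj (gauge x y) \<bullet>\<^sub>H z"
  have e': "qcnj (gauge x' y') \<bullet>\<^sub>H z' = e" using eta_cover_map assms q q' e_def by metis
  have eq: "emb x y p e = emb x' y' p' e" using assms by (simp add: q q' cover_map_def e' e_def)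
  have "exp (e $ 1) * cos (2 * pi * x) = exp (e $ 1) * cos (2 * pi * x')" "exp (e $ 1) * sin (2 * pi * x) = exp (e $ 1) * sin (2 * pi * x')"
    "exp (e $ 2) * cos y = exp (e $ 2) * cos y'" "exp (e $ 2) * sin y = exp (e $ 2) * sin y'"
    using eq unfolding emb_def quat_eq_iff prod.inject by simp_all
  note v = this
  obtain n :: int where "2 * pi * x' = 2 * pi * x + 2 * pi * of_int n" using polar_inj[OF _ _ v(1,2)] by auto
  then have "2 * pi * x' = 2 * pi * (x + of_int n)" by (simp add: algebra_simps)
  then have n: "x' = x + of_int n" by simp
  obtain m :: int where m: "y' = y + 2 * pi * of_int m" using polar_inj[OF _ _ v(3,4)] by auto
  define k where "k = 1 / sqrt (1 + (e $ 3)\<^sup>2 + (e $ 4)\<^sup>2)"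
  have "1 + (e $ 3)\<^sup>2 + (e $ 4)\<^sup>2 > 0" by (simp add: add_pos_nonneg)
  then have k: "k > 0" by (simp add: k_def)
  have "k * cos p = k * cos p'" "k * sin p = k * sin p'"
    using eq unfolding emb_def k_def[symmetric] quat_eq_iff prod.inject by simp_all
  then obtain l :: int where l: "p' = p + 2 * pi * of_int l" using polar_inj[OF k k] by auto
  have "z' = gauge x' y' \<bullet>\<^sub>H e" unfolding e'[symmetric] by (simp add: gauge_inverse)
  also have "\<dots> = qexp (2 * of_int n * y) \<bullet>\<^sub>H z" unfolding n m gauge_periodic gauge_shift e_def by (simp add: qmul_assoc gauge_inverse)
  finally have "q' = deck n m l q" unfolding q q' deck_def using n m l by simp
  then show ?thesis by blast
qed

section \<open>The perturbed circle action on the first copy\<close>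

definition some_lift :: "quat \<times> quat \<Rightarrow> cov" where "some_lift p = (SOME q. cover_map q = p)"

definition chart_flow :: "real \<Rightarrow> quat \<times> quat \<Rightarrow> quat \<times> quat" where
  "chart_flow t p = (if p \<in> torus_region then cover_map (cover_flow t (some_lift p)) else rot t p)"

definition chart_field :: "quat \<times> quat \<Rightarrow> quat \<times> quat" where
  "chart_field p = (if p \<in> torus_region then frechet_derivative cover_map (at (some_lift p)) (cover_field (some_lift p)) else rotV p)"

lemma cover_map_some_lift: "cover_map (some_lift (cover_map q)) = cover_map q" unfolding some_lift_def by (rule someI[of _ q]) simp

text \<open>Two lifts of a point differ by a deck transformation, which commutes with the flow upstairs.\<close>

lemma chart_flow_cover_map: "chart_flow t (cover_map q) = cover_map (cover_flow t q)"
proof -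
  obtain n m l where "q = deck n m l (some_lift (cover_map q))" using cover_map_inj[OF cover_map_some_lift[of q]] by blast
  then have "cover_map (cover_flow t q) = cover_map (cover_flow t (some_lift (cover_map q)))" using cover_flow_deck cover_map_deck by metis
  then show ?thesis by (simp add: chart_flow_def cover_map_torus_region)
qed

lemma cover_map_cover_flow_derivative:
  "((\<lambda>t. cover_map (cover_flow t q)) has_vector_derivative frechet_derivative cover_map (at q) (cover_field q)) (at 0)"
proof -
  have P: "(cover_map has_derivative frechet_derivative cover_map (at q)) (at (cover_flow 0 q))"
    unfolding cover_flow_0 by (rule open_smooth_has_derivative[OF open_smooth_cover_map UNIV_I])
  from has_derivative_compose[OF cover_flow_cover_field[unfolded has_vector_derivative_def] P]
  show ?thesis
    by (simp add: has_vector_derivative_def linear_cmul[OF has_derivative_linear[OF P]])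
qed

lemma chart_field_cover_map: "chart_field (cover_map q) = frechet_derivative cover_map (at q) (cover_field q)"
proof -
  have "((\<lambda>t. chart_flow t (cover_map q)) has_vector_derivative frechet_derivative cover_map (at q) (cover_field q)) (at 0)"
    unfolding chart_flow_cover_map by (rule cover_map_cover_flow_derivative)
  moreover have "((\<lambda>t. chart_flow t (cover_map q)) has_vector_derivative chart_field (cover_map q)) (at 0)"
    using cover_map_cover_flow_derivative[of "some_lift (cover_map q)"] by (simp add: chart_flow_def chart_field_def cover_map_torus_region)
  ultimately show ?thesis using vector_derivative_unique_at by blast
qed

lemma chart_flow_cases:
  assumes "p \<in> R4xS3"
  obtains (inside) q where "p = cover_map q" "p \<in> torus_region" | (outside) "p \<notin> torus_region"
  using cover_map_surj[OF _ assms] by metis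

lemma rot_torus_region: "rot t p \<in> torus_region \<longleftrightarrow> p \<in> torus_region"
proof -
  have sc: "(sin t)\<^sup>2 = 1 - (cos t)\<^sup>2" by (simp add: sin_squared_eq)
  have "w12_sq (rot t p) = w12_sq p" unfolding w12_sq_def rot_def snd_conv qmul_nth qexp_nth using sc by algebra
  then show ?thesis by (simp add: torus_region_def v12_sq_def v34_sq_def)
qed

lemma chart_flow_0: "p \<in> R4xS3 \<Longrightarrow> chart_flow 0 p = p"
  by (erule chart_flow_cases) (simp_all add: chart_flow_cover_map cover_flow_0, simp add: chart_flow_def rot_0)

lemma chart_flow_add: "p \<in> R4xS3 \<Longrightarrow> chart_flow s (chart_flow t p) = chart_flow (s + t) p"
  by (erule chart_flow_cases) (simp_all add: chart_flow_cover_map cover_flow_add, simp add: chart_flow_def rot_add rot_torus_region)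

lemma chart_flow_M: assumes "p \<in> R4xS3" shows "chart_flow t p \<in> R4xS3"
  using assms by (cases rule: chart_flow_cases) (simp_all add: chart_flow_cover_map cover_map_M, simp add: chart_flow_def rot_M assms)

lemma chart_flow_chart_field: "p \<in> R4xS3 \<Longrightarrow> ((\<lambda>t. chart_flow t p) has_vector_derivative chart_field p) (at 0)"
proof (erule chart_flow_cases)
  fix q assume "p = cover_map q"
  then show ?thesis using cover_map_cover_flow_derivative[of q] by (simp add: chart_flow_cover_map chart_field_cover_map)
next
  assume "p \<notin> torus_region"
  then show ?thesis using rot_derivative[of p 0] by (simp add: chart_flow_def chart_field_def rot_0)
qed

text \<open>Where \<open>\<bar>\<eta>\<bar>\<^sup>2 \<ge> 2\<close> the bump function vanishes, and only \<open>\<phi>\<close> moves, at unit speed.\<close>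

lemma chart_flow_rot:
  assumes "p \<in> R4xS3" "p \<in> torus_region \<Longrightarrow> eta p \<bullet> eta p \<ge> 2"
  shows "chart_flow t p = rot t p"
  using assms(1)
proof (cases rule: chart_flow_cases)
  case (inside q)
  obtain x y a z where q: "q = (x, y, a, z)" by (cases q) auto
  have "z \<bullet> z \<ge> 2"
    using assms(2)[OF inside(2)] by (simp add: inside(1) q eta_cover_map power2_norm_eq_inner[symmetric] norm_qmul)
  then have "cover_flow t q = (x, y, a + t, z)" unfolding q by (simp add: cover_flow_def bump_zero Let_def Xi_def)
  then show ?thesis
    using chart_flow_cover_map[of t q] by (simp add: inside q cover_map_def emb_def rot_def qexp_add qmul_assoc add.commute[of a t])
qed (simp add: chart_flow_def)

lemma inner_quat: "(p :: quat) \<bullet> p = (p$1)\<^sup>2 + (p$2)\<^sup>2 + (p$3)\<^sup>2 + (p$4)\<^sup>2"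
  using qnorm2 by (simp add: power2_norm_eq_inner)

lemma ln_sq_big: assumes "A < exp (- 4)" "A > 0" shows "(ln A / 2)\<^sup>2 \<ge> (2::real)"
proof -
  have "ln A < -4" using assms by (metis ln_exp ln_less_cancel_iff exp_gt_zero)
  then have "2\<^sup>2 \<le> (- (ln A / 2))\<^sup>2" by (intro power_mono) auto
  then show ?thesis by simp
qed

text \<open>The coordinates \<open>\<eta>\<close> are large near the boundary of the embedded product. Together with \<open>chart_flow_rot\<close>
  this shows that the field extends smoothly by the velocity of the circle action. The bounds amount
  to \<open>ln \<bar>v\<^sub>1\<bar> < - 2\<close>, \<open>ln \<bar>v\<^sub>2\<bar> < - 2\<close> and, as \<open>w\<close> is a unit vector, \<open>\<bar>w\<^sub>2 / w\<^sub>1\<bar>\<^sup>2 > 2\<close>.\<close>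

lemma eta_big:
  assumes p: "p \<in> R4xS3" "p \<in> torus_region" and "v12_sq p < exp (- 4) \<or> v34_sq p < exp (- 4) \<or> w12_sq p < 1 / 3"
  shows "eta p \<bullet> eta p \<ge> 2"
proof -
  have pos: "v12_sq p > 0" "v34_sq p > 0" "w12_sq p > 0"
    using p A_nonneg[of p] by (auto simp: torus_region_def less_le)
  have s: "eta p \<bullet> eta p = (eta p $ 1)\<^sup>2 + (eta p $ 2)\<^sup>2 + (eta p $ 3)\<^sup>2 + (eta p $ 4)\<^sup>2" by (rule inner_quat)
  have nn: "(eta p $ 1)\<^sup>2 \<ge> 0" "(eta p $ 2)\<^sup>2 \<ge> 0" "(eta p $ 3)\<^sup>2 \<ge> 0" "(eta p $ 4)\<^sup>2 \<ge> 0" by simp_all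
  consider "v12_sq p < exp (- 4)" | "v34_sq p < exp (- 4)" | "w12_sq p < 1 / 3" using assms by blast
  then show ?thesis
  proof cases
    case 1
    then have "(eta p $ 1)\<^sup>2 \<ge> 2" using ln_sq_big pos by (simp add: eta_def)
    then show ?thesis using s nn by linarith
  next
    case 2
    then have "(eta p $ 2)\<^sup>2 \<ge> 2" using ln_sq_big pos by (simp add: eta_def)
    then show ?thesis using s nn by linarith
  next
    case 3
    obtain q where q: "cover_map q = p" using cover_map_surj p by metis
    obtain x y a z where q': "q = (x, y, a, z)" by (cases q) auto
    have "w12_sq p = 1 / (1 + (eta p $ 3)\<^sup>2 + (eta p $ 4)\<^sup>2)"
      unfolding q[symmetric] q' eta_cover_map by (simp add: cover_map_def emb_A)
    then have "1 / (1 + (eta p $ 3)\<^sup>2 + (eta p $ 4)\<^sup>2) < 1 / 3" using 3 by simp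
    then have "1 + (eta p $ 3)\<^sup>2 + (eta p $ 4)\<^sup>2 > 3" using nn by (simp add: divide_simps split: if_splits)
    then show ?thesis using s nn by linarith
  qed
qed

lemma norm_fst_A: "(norm (fst p))\<^sup>2 = v12_sq p + v34_sq p"
  by (simp add: qnorm2 v12_sq_def v34_sq_def)

text \<open>If \<open>\<parallel>v\<parallel>\<close> is large, so is \<open>\<bar>v\<^sub>1\<bar>\<close> or \<open>\<bar>v\<^sub>2\<bar>\<close>: the perturbation stays away from infinity, hence from the
  zero fibre of the second copy. From \<open>\<parallel>v\<parallel>\<^sup>2 \<ge> 4 e\<^sup>4\<close> it follows that \<open>ln \<bar>v\<^sub>1\<bar>\<close> or \<open>ln \<bar>v\<^sub>2\<bar>\<close> is at least \<open>2\<close>.\<close>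

lemma eta_far:
  assumes p: "p \<in> torus_region" and "norm (fst p) \<ge> 2 * exp 2"
  shows "eta p \<bullet> eta p \<ge> 2"
proof -
  have pos: "v12_sq p > 0" "v34_sq p > 0"
    using p A_nonneg[of p] by (auto simp: torus_region_def less_le)
  have nn: "(eta p $ 1)\<^sup>2 \<ge> 0" "(eta p $ 2)\<^sup>2 \<ge> 0" "(eta p $ 3)\<^sup>2 \<ge> 0" "(eta p $ 4)\<^sup>2 \<ge> 0" by simp_all
  have "(2 * exp 2)\<^sup>2 \<le> (norm (fst p))\<^sup>2" using assms by (intro power_mono) auto
  then have "4 * exp 4 \<le> v12_sq p + v34_sq p" unfolding norm_fst_A by (simp add: power2_eq_square exp_add[symmetric])
  then have "v12_sq p \<ge> exp 4 \<or> v34_sq p \<ge> exp 4" using exp_gt_zero[of "4::real"] by linarith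
  then have "ln (v12_sq p) \<ge> 4 \<or> ln (v34_sq p) \<ge> 4" using pos by (metis exp_gt_zero ln_exp ln_le_cancel_iff)
  then have "2\<^sup>2 \<le> (ln (v12_sq p) / 2)\<^sup>2 \<or> 2\<^sup>2 \<le> (ln (v34_sq p) / 2)\<^sup>2"
    using power_mono[of 2 "ln (v12_sq p) / 2" 2] power_mono[of 2 "ln (v34_sq p) / 2" 2] by auto
  then have "4 \<le> (eta p $ 1)\<^sup>2 \<or> 4 \<le> (eta p $ 2)\<^sup>2" by (simp add: eta_def)
  then show ?thesis using inner_quat[of "eta p"] nn by linarith
qed

lemma chart_field_rot: assumes "p \<in> R4xS3" "p \<in> torus_region \<Longrightarrow> eta p \<bullet> eta p \<ge> 2" shows "chart_field p = rotV p"
proof -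
  have "((\<lambda>t. rot t p) has_vector_derivative chart_field p) (at 0)"
    using chart_flow_chart_field[OF assms(1)] chart_flow_rot[OF assms] by simp
  moreover have "((\<lambda>t. rot t p) has_vector_derivative rotV p) (at 0)"
    using rot_derivative[of p 0] by (simp add: rot_0)
  ultimately show ?thesis by (rule vector_derivative_unique_at)
qed

text \<open>Inside the embedded product the field is pushed forward along a local lift; around any other point
  it is the velocity of the circle action, by \<open>eta_big\<close>.\<close>

lemma chart_field_smooth: "smooth_on R4xS3 chart_field"
proof (rule smooth_onI)
  fix p assume p: "p \<in> R4xS3"
  show "\<exists>U g. p \<in> U \<and> open_smooth U g \<and> (\<forall>y\<in>U \<inter> R4xS3. g y = chart_field y)"
  proof (cases "p \<in> torus_region")
    case True
    then obtain a b c where D: "p \<in> lift_dom a b c" by (rule lift_dom_exists)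
    have "open_smooth (lift_dom a b c) (\<lambda>y. frechet_derivative cover_map (at (local_lift a b c y)) (cover_field (local_lift a b c y)))"
      by (rule open_smooth_frechet[OF open_smooth_cover_map open_smooth_local_lift open_smooth_compose[OF open_smooth_cover_field open_smooth_local_lift UNIV_I] UNIV_I])
    moreover have "frechet_derivative cover_map (at (local_lift a b c y)) (cover_field (local_lift a b c y)) = chart_field y" if "y \<in> lift_dom a b c \<inter> R4xS3" for y
      using that chart_field_cover_map[of "local_lift a b c y"] cover_map_local_lift[of y a b c] by simp
    ultimately show ?thesis using D by blast
  next
    case False
    define U where "U = {p. v12_sq p < exp (- 4)} \<union> {p. v34_sq p < exp (- 4)} \<union> {p. w12_sq p < 1 / 3}"
    have "open U" unfolding U_def v12_sq_def v34_sq_def w12_sq_def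
      by (intro open_Un open_Collect_less continuous_intros)
    then have "open_smooth U rotV" using open_smooth_subset[OF open_smooth_rotV] by simp
    moreover have "p \<in> U" using False by (auto simp: U_def torus_region_def)
    moreover have "rotV y = chart_field y" if "y \<in> U \<inter> R4xS3" for y
      using that chart_field_rot[of y] eta_big[of y] by (auto simp: U_def)
    ultimately show ?thesis by blast
  qed
qed

text \<open>A vanishing velocity downstairs is detected by the coordinate that moves upstairs: by \<open>\<zeta>\<close> through
  \<open>eta\<close> if \<open>r = 0\<close>, and by the argument \<open>\<phi>\<close> of \<open>w\<^sub>1\<close> otherwise.\<close>

lemma chart_field_nz: assumes "p \<in> R4xS3" shows "chart_field p \<noteq> 0"
  using assms
proof (cases rule: chart_flow_cases)
  case outside
  then show ?thesis using rotV_nz[OF assms] by (simp add: chart_field_def)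
next
  case (inside q)
  obtain x y a z where q: "q = (x, y, a, z)" by (cases q) auto
  show ?thesis
  proof
    assume 0: "chart_field p = 0"
    have D: "((\<lambda>t. cover_map (cover_flow t q)) has_vector_derivative 0) (at 0)"
      using cover_map_cover_flow_derivative[of q] chart_field_cover_map[of q] 0 inside by simp
    show False
    proof (cases "bump (z \<bullet> z) = 1")
      case True
      then have zz: "z \<bullet> z = 1" by (simp add: bump_eq_1)
      obtain A B C where Dm: "p \<in> lift_dom A B C" using inside(2) by (rule lift_dom_exists)
      have "(eta has_derivative frechet_derivative eta (at p)) (at (cover_map (cover_flow 0 q)))"
        using open_smooth_has_derivative[OF open_smooth_eta Dm] inside(1) by (simp add: cover_flow_0)
      from has_derivative_compose[OF D[unfolded has_vector_derivative_def] this]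
      have "((\<lambda>t. eta (cover_map (cover_flow t q))) has_vector_derivative 0) (at 0)"
        by (simp add: has_vector_derivative_def linear_0[OF has_derivative_linear[OF open_smooth_has_derivative[OF open_smooth_eta Dm]]])
      then have "((\<lambda>t. qcnj (gauge x y) \<bullet>\<^sub>H (qexp (- t) \<bullet>\<^sub>H z)) has_vector_derivative 0) (at 0)"
        unfolding q cover_flow_singular[OF True] eta_cover_map .
      from bounded_linear.has_vector_derivative[OF bounded_bilinear.bounded_linear_right[OF bounded_bilinear_qmul] this, of "gauge x y"]
      have "((\<lambda>t. qexp (- t) \<bullet>\<^sub>H z) has_vector_derivative 0) (at 0)"
        by (simp add: gauge_inverse qmul_zero_right)
      moreover have "((\<lambda>t. qexp (- t) \<bullet>\<^sub>H z) has_vector_derivative snd (snd (snd (cover_field q)))) (at 0)"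
        using bounded_linear.has_vector_derivative[OF bounded_linear_compose[OF bounded_linear_snd bounded_linear_compose[OF bounded_linear_snd bounded_linear_snd]] cover_flow_cover_field[of q]]
        unfolding q cover_flow_singular[OF True] by simp
      ultimately have "snd (snd (snd (cover_field q))) = 0" using vector_derivative_unique_at by blast
      then have "norm (qi \<bullet>\<^sub>H z) = 0" using True by (simp add: q cover_field_def)
      moreover have "norm qi = 1" using norm_qexp[of "pi/2"] by (metis qexp_def qi_def cos_pi_half sin_pi_half)
      moreover have "norm z = 1" using zz by (simp add: norm_eq_sqrt_inner)
      ultimately show False by (simp add: norm_qmul)
    next
      case False
      define r where "r = 1 - bump (z \<bullet> z)"
      have r: "r \<noteq> 0" using False by (simp add: r_def)
      define P where "P t = a + r\<^sup>2 * t" for t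
      define k where "k t = 1 / sqrt (1 + (eta (cover_map (cover_flow t q)) $ 3)\<^sup>2 + (eta (cover_map (cover_flow t q)) $ 4)\<^sup>2)" for t
      have w: "snd (cover_map (cover_flow t q)) $ 1 = k t * cos (P t)" "snd (cover_map (cover_flow t q)) $ 2 = k t * sin (P t)" for t
      proof -
        obtain x' y' z' where f: "cover_flow t q = (x', y', P t, z')"
          unfolding q using cover_flow_regular[OF r_def r refl refl, where x = x and y = y and t = t and p = a] by (metis P_def)
        show "snd (cover_map (cover_flow t q)) $ 1 = k t * cos (P t)" "snd (cover_map (cover_flow t q)) $ 2 = k t * sin (P t)"
          unfolding k_def f eta_cover_map by (simp_all add: cover_map_def emb_def)
      qed
      have k0: "k 0 \<noteq> 0"
      proof -
        have "1 + (s::real)\<^sup>2 + t\<^sup>2 > 0" for s t by (simp add: add_pos_nonneg)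
        then show ?thesis by (simp add: k_def less_imp_neq[symmetric])
      qed
      have Dw: "((\<lambda>t. snd (cover_map (cover_flow t q)) $ i) has_real_derivative 0) (at 0)" for i
        using bounded_linear.has_vector_derivative[OF bounded_linear_compose[OF bounded_linear_vec_nth bounded_linear_snd] D, of i]
        by (simp add: has_real_derivative_iff_has_vector_derivative)
      \<comment> \<open>The vector \<open>(w1, w2)\<close> is parallel to \<open>(cos \<phi>, sin \<phi>)\<close> at all times, so this expression vanishes identically.\<close>
      have "((\<lambda>t. snd (cover_map (cover_flow t q)) $ 2 * cos (P t) - snd (cover_map (cover_flow t q)) $ 1 * sin (P t)) has_real_derivative
           - (snd (cover_map (cover_flow 0 q)) $ 2 * sin (P 0) * r\<^sup>2) - snd (cover_map (cover_flow 0 q)) $ 1 * cos (P 0) * r\<^sup>2) (at 0)"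
        unfolding P_def by (auto intro!: derivative_eq_intros Dw)
      moreover have "(\<lambda>t. snd (cover_map (cover_flow t q)) $ 2 * cos (P t) - snd (cover_map (cover_flow t q)) $ 1 * sin (P t)) = (\<lambda>t. 0)"
        unfolding w by simp
      ultimately have "((\<lambda>t. 0) has_real_derivative
           - (snd (cover_map (cover_flow 0 q)) $ 2 * sin (P 0) * r\<^sup>2) - snd (cover_map (cover_flow 0 q)) $ 1 * cos (P 0) * r\<^sup>2) (at 0)" by simp
      from DERIV_unique[OF this DERIV_const]
      have "k 0 * r\<^sup>2 * ((sin (P 0))\<^sup>2 + (cos (P 0))\<^sup>2) = 0" unfolding w by algebra
      then show False using k0 r by simp
    qed
  qed
qed

lemma cover_flow_period: assumes "bump (z \<bullet> z) \<noteq> 1"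
  shows "cover_flow (2 * pi / (1 - bump (z \<bullet> z))\<^sup>2) (x, y, p, z) = deck 0 0 1 (x, y, p, z)"
proof -
  define r where "r = 1 - bump (z \<bullet> z)"
  have r: "r \<noteq> 0" using assms by (simp add: r_def)
  have P: "p + 2 * pi = p + r\<^sup>2 * (2 * pi / r\<^sup>2)" using r by simp
  show ?thesis
    unfolding r_def[symmetric] cover_flow_regular[OF r_def r refl P]
    by (simp add: deck_def Xi_def)
qed

lemma chart_flow_closed: assumes "p \<in> R4xS3" shows "\<exists>\<tau>>0. chart_flow \<tau> p = p"
  using assms
proof (cases rule: chart_flow_cases)
  case (inside q)
  obtain x y a z where q: "q = (x, y, a, z)" by (cases q) auto
  show ?thesis
  proof (cases "bump (z \<bullet> z) = 1")
    case True
    have "qexp (- (2 * pi)) = qone" using qexp_int[of 0 "-1"] by simp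
    then have "cover_flow (2 * pi) q = q" by (simp add: q cover_flow_singular[OF True])
    then show ?thesis using chart_flow_cover_map[of "2 * pi" q] inside by (intro exI[of _ "2 * pi"]) simp
  next
    case False
    then show ?thesis using chart_flow_cover_map[of "2 * pi / (1 - bump (z \<bullet> z))\<^sup>2" q] inside cover_flow_period[OF False, of x y a] cover_map_deck[of 0 0 1 q]
      by (intro exI[of _ "2 * pi / (1 - bump (z \<bullet> z))\<^sup>2"]) (simp add: q)
  qed
next
  case outside
  then show ?thesis using rot_closed by (intro exI[of _ "2 * pi"]) (simp add: chart_flow_def)
qed

text \<open>Start at \<open>\<zeta>\<close> with \<open>\<bar>\<zeta>\<bar>\<^sup>2\<close> close to, but different from, \<open>1\<close>. Every return moves \<open>\<phi>\<close> by a positive multiple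
  of \<open>2 \<pi>\<close>, which takes time at least \<open>2 \<pi> / r\<^sup>2\<close>.\<close>

lemma chart_flow_unbounded:
  "\<exists>p\<in>R4xS3. \<exists>\<tau>>B. \<tau> > 0 \<and> chart_flow \<tau> p = p \<and> (\<forall>\<tau>'>0. chart_flow \<tau>' p = p \<longrightarrow> \<tau> \<le> \<tau>')"
proof -
  \<comment> \<open>Chosen so that \<open>0 < r < \<epsilon>\<close> makes the period \<open>2 \<pi> / r\<^sup>2\<close> larger than \<open>\<bar>B\<bar> + 1\<close>.\<close>
  define \<epsilon> where "\<epsilon> = sqrt (2 * pi / (\<bar>B\<bar> + 1))"
  have e: "\<epsilon> > 0" by (simp add: \<epsilon>_def)
  have "open_smooth UNIV bump" using open_smooth_bump[OF open_smooth_id[OF open_UNIV]] .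
  then have "isCont bump 1" using open_smooth_continuous_on continuous_on_eq_continuous_at[OF open_UNIV] by blast
  then obtain d where d: "d > 0" "\<And>u. dist u 1 < d \<Longrightarrow> dist (bump u) (bump 1) < \<epsilon>"
    using e unfolding continuous_at_eps_delta by blast
  define u where "u = 1 + d / 2"
  have u: "u > 0" "u \<noteq> 1" "dist u 1 < d" using d(1) by (auto simp: u_def dist_real_def)
  have b1: "bump 1 = 1" by (simp add: bump_eq_1)
  define r where "r = 1 - bump u"
  have r: "r > 0" "r < \<epsilon>"
    using d(2)[OF u(3)] bump_le_1[of u] bump_eq_1[of u] u(2) by (auto simp: r_def dist_real_def b1)
  define z :: quat where "z = sqrt u *\<^sub>R qone"
  have z: "z \<bullet> z = u" using u(1) by (simp add: inner_quat z_def)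
  have bz: "bump (z \<bullet> z) \<noteq> 1" using z u(2) bump_eq_1 by simp
  define q where "q = (0::real, 0::real, 0::real, z)"
  define \<tau> where "\<tau> = 2 * pi / r\<^sup>2"
  have tpos: "\<tau> > 0" using r by (simp add: \<tau>_def)
  have "r\<^sup>2 < \<epsilon>\<^sup>2" using r by (intro power_strict_mono) auto
  then have "r\<^sup>2 < 2 * pi / (\<bar>B\<bar> + 1)" by (simp add: \<epsilon>_def)
  then have "\<bar>B\<bar> + 1 < \<tau>" using r by (simp add: \<tau>_def field_simps)
  then have tB: "\<tau> > B" by linarith
  have cl: "chart_flow \<tau> (cover_map q) = cover_map q"
    using cover_flow_period[OF bz, of 0 0 0] cover_map_deck[of 0 0 1 q] by (simp add: chart_flow_cover_map q_def \<tau>_def r_def z)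
  have "\<tau> \<le> \<tau>'" if t': "\<tau>' > 0" "chart_flow \<tau>' (cover_map q) = cover_map q" for \<tau>'
  proof -
    have rz: "r = 1 - bump (z \<bullet> z)" "r \<noteq> 0" using r by (auto simp: r_def z)
    have f: "fst (snd (snd (cover_flow \<tau>' q))) = r\<^sup>2 * \<tau>'"
      unfolding q_def cover_flow_regular[OF rz refl refl] by simp
    obtain n m l where "cover_flow \<tau>' q = deck n m l q" using cover_map_inj[of q "cover_flow \<tau>' q"] t' by (auto simp: chart_flow_cover_map)
    then have "r\<^sup>2 * \<tau>' = 2 * pi * of_int l" using f by (simp add: q_def deck_def)
    moreover have "r\<^sup>2 * \<tau>' > 0" using r t' by simp
    ultimately have "of_int l > (0::real)" "r\<^sup>2 * \<tau>' = 2 * pi * of_int l" by (simp_all add: zero_less_mult_iff)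
    then have "of_int l \<ge> (1::real)" by simp
    then have "2 * pi * 1 \<le> 2 * pi * of_int l" by (intro mult_left_mono) auto
    then have "2 * pi \<le> r\<^sup>2 * \<tau>'" using \<open>r\<^sup>2 * \<tau>' = 2 * pi * of_int l\<close> by simp
    then show ?thesis using r by (simp add: \<tau>_def divide_le_eq mult.commute)
  qed
  then show ?thesis using tB tpos cl cover_map_M by blast
qed

lemma glued_flow_01: "glued_flow 0 1 S01 chart_flow rot chart_field rotV (2 * exp 2)"
proof
  fix x :: "quat \<times> quat" and t
  assume x: "x \<in> R4xS3" and "fst x = 0 \<or> 2 * exp 2 \<le> norm (fst x)"
  then show "chart_flow t x = rot t x"
  proof (elim disjE)
    assume "fst x = 0"
    then have "x \<notin> torus_region" by (simp add: torus_region_def v12_sq_def)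
    then show ?thesis by (simp add: chart_flow_def)
  next
    assume "2 * exp 2 \<le> norm (fst x)"
    then show ?thesis using chart_flow_rot[OF x] eta_far[of x] by blast
  qed
next
  fix x assume "x \<in> R4xS3"
  then show "((\<lambda>t. rot t x) has_vector_derivative rotV x) (at 0)"
    using rot_derivative[of x 0] by (simp add: rot_0)
next
  fix x :: "quat \<times> quat"
  show "\<exists>\<tau>>0. rot \<tau> x = x" using rot_closed[of x] by (intro exI[of _ "2 * pi"]) simp
next
  fix x :: "quat \<times> quat" assume "fst x \<noteq> 0"
  then show "fst (S01 x) = (1 / (norm (fst x))\<^sup>2) *\<^sub>R fst x" by (cases x) (simp add: S01_def)
qed (simp_all add: open_smooth_trans_01 open_smooth_S01 trans_S01 norm_snd_trans_01 chart_flow_0 chart_flow_add chart_flow_M chart_flow_chart_field chart_field_smooth chart_field_nz chart_flow_closed chart_flow_unbounded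
   rot_0 rot_add rot_M open_smooth_rotV rotV_nz trans_rot)

section \<open>From one Hopf bundle to the other\<close>

text \<open>Conjugation reverses products, so conjugating both components transforms the gluing map
  \<open>w \<mapsto> w v / \<parallel>v\<parallel>\<close> into \<open>w \<mapsto> v w / \<parallel>v\<parallel>\<close>.\<close>

definition conj_pair :: "quat \<times> quat \<Rightarrow> quat \<times> quat" where "conj_pair x = (qcnj (fst x), qcnj (snd x))"

lemma conj_pair_conj_pair [simp]: "conj_pair (conj_pair x) = x" by (simp add: conj_pair_def)
lemma fst_conj_pair [simp]: "fst (conj_pair x) = qcnj (fst x)" and snd_conj_pair [simp]: "snd (conj_pair x) = qcnj (snd x)"
  by (simp_all add: conj_pair_def)
lemma conj_pair_M [simp]: "conj_pair x \<in> R4xS3 \<longleftrightarrow> x \<in> R4xS3" by (simp add: R4xS3_def mem_Times_iff)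
lemma conj_pair_eq_iff: "conj_pair x = y \<longleftrightarrow> x = conj_pair y" by auto
lemma conj_pair_0 [simp]: "conj_pair x = 0 \<longleftrightarrow> x = 0" by (cases x) (simp add: conj_pair_def zero_prod_def)

lemma bounded_linear_conj_pair: "bounded_linear conj_pair"
  unfolding conj_pair_def
  by (intro bounded_linear_Pair bounded_linear_compose[OF bounded_linear_qcnj] bounded_linear_fst bounded_linear_snd)

lemmas open_smooth_conj_pair = open_smooth_linear[OF bounded_linear_conj_pair]

lemma trans_10_conj_pair: "trans_map 1 0 x = conj_pair (trans_map 0 1 (conj_pair x))"
  by (cases x) (simp add: conj_pair_def trans_01 trans_10 qcnj_scaleR qcnj_qmul)

lemma smooth_on_conj_pair:
  assumes "smooth_on R4xS3 V" shows "smooth_on R4xS3 (\<lambda>x. conj_pair (V (conj_pair x)))"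
proof (rule smooth_onI)
  fix x assume "x \<in> R4xS3"
  then obtain U g where U: "conj_pair x \<in> U" "open_smooth U g" "\<And>y. y \<in> U \<Longrightarrow> y \<in> R4xS3 \<Longrightarrow> g y = V y"
    using smooth_onE[OF assms, of "conj_pair x"] by auto
  have o: "open (conj_pair -` U)"
    by (rule open_vimage[OF open_smooth_open[OF U(2)] linear_continuous_on[OF bounded_linear_conj_pair]])
  have "open_smooth (conj_pair -` U) (\<lambda>y. conj_pair (g (conj_pair y)))"
    by (rule open_smooth_conj_pair, rule open_smooth_compose[OF U(2) open_smooth_conj_pair[OF open_smooth_id[OF o]]]) simp
  then show "\<exists>U g. x \<in> U \<and> open_smooth U g \<and> (\<forall>y\<in>U \<inter> R4xS3. g y = conj_pair (V (conj_pair y)))"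
    using U(1,3) by (intro exI[of _ "conj_pair -` U"] exI[of _ "\<lambda>y. conj_pair (g (conj_pair y))"]) simp
qed

lemma glued_flow_10:
  "glued_flow 1 0 (\<lambda>x. conj_pair (S01 (conj_pair x))) (\<lambda>t x. conj_pair (chart_flow t (conj_pair x))) (\<lambda>t x. conj_pair (rot t (conj_pair x)))
     (\<lambda>x. conj_pair (chart_field (conj_pair x))) (\<lambda>x. conj_pair (rotV (conj_pair x))) (2 * exp 2)"
proof -
  interpret A: glued_flow 0 1 S01 chart_flow rot chart_field rotV "2 * exp 2" by (rule glued_flow_01)
  have D: "open_smooth punctured (\<lambda>x. conj_pair (f (conj_pair x)))" if "open_smooth punctured f" for f
    by (rule open_smooth_conj_pair, rule open_smooth_compose[OF that open_smooth_conj_pair[OF open_smooth_id[OF open_punctured]]]) simp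
  show ?thesis
  proof
    have e: "trans_map 1 0 = (\<lambda>x. conj_pair (trans_map 0 1 (conj_pair x)))" by (intro ext trans_10_conj_pair)
    show "open_smooth punctured (trans_map 1 0)" unfolding e by (rule D[OF A.T_open_smooth])
    show "open_smooth punctured (\<lambda>x. conj_pair (S01 (conj_pair x)))" by (rule D[OF A.S_open_smooth])
    show "open_smooth UNIV (\<lambda>x. conj_pair (rotV (conj_pair x)))"
      by (rule open_smooth_conj_pair, rule open_smooth_compose[OF A.J_open_smooth open_smooth_conj_pair[OF open_smooth_id[OF open_UNIV]]]) simp
    show "\<exists>x\<in>R4xS3. \<exists>\<tau>>B. 0 < \<tau> \<and> conj_pair (chart_flow \<tau> (conj_pair x)) = x \<and> (\<forall>\<tau>'>0. conj_pair (chart_flow \<tau>' (conj_pair x)) = x \<longrightarrow> \<tau> \<le> \<tau>')" for B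
    proof -
      obtain x \<tau> where "x \<in> R4xS3" "\<tau> > B" "\<tau> > 0" "chart_flow \<tau> x = x" "\<forall>\<tau>'>0. chart_flow \<tau>' x = x \<longrightarrow> \<tau> \<le> \<tau>'"
        using A.F_unbounded[of B] by blast
      then show ?thesis by (intro bexI[of _ "conj_pair x"] exI[of _ \<tau>]) (simp_all add: conj_pair_eq_iff)
    qed
    fix x :: "quat \<times> quat" and t :: real
    show "fst x \<noteq> 0 \<Longrightarrow> fst (conj_pair (S01 (conj_pair x))) = (1 / (norm (fst x))\<^sup>2) *\<^sub>R fst x"
      using A.fst_S[of "conj_pair x"] by (simp add: qcnj_scaleR)
    show "fst x \<noteq> 0 \<Longrightarrow> norm (snd (trans_map 1 0 x)) = norm (snd x)"
      using A.norm_snd_T[of "conj_pair x"] by (simp add: trans_10_conj_pair)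
    show "x \<in> R4xS3 \<Longrightarrow> ((\<lambda>t. conj_pair (chart_flow t (conj_pair x))) has_vector_derivative conj_pair (chart_field (conj_pair x))) (at 0)"
      using bounded_linear.has_vector_derivative[OF bounded_linear_conj_pair A.F_V[of "conj_pair x"]] by simp
    show "x \<in> R4xS3 \<Longrightarrow> ((\<lambda>t. conj_pair (rot t (conj_pair x))) has_vector_derivative conj_pair (rotV (conj_pair x))) (at 0)"
      using bounded_linear.has_vector_derivative[OF bounded_linear_conj_pair A.R_J[of "conj_pair x"]] by simp
    show "x \<in> R4xS3 \<Longrightarrow> \<exists>\<tau>>0. conj_pair (chart_flow \<tau> (conj_pair x)) = x" using A.F_closed[of "conj_pair x"] by (simp add: conj_pair_eq_iff)
    show "x \<in> R4xS3 \<Longrightarrow> \<exists>\<tau>>0. conj_pair (rot \<tau> (conj_pair x)) = x" using A.R_closed[of "conj_pair x"] by (simp add: conj_pair_eq_iff)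
    show "x \<in> R4xS3 \<Longrightarrow> fst x = 0 \<or> 2 * exp 2 \<le> norm (fst x) \<Longrightarrow> conj_pair (chart_flow t (conj_pair x)) = conj_pair (rot t (conj_pair x))"
      using A.F_R[of "conj_pair x" t] by auto
  qed (simp_all add: trans_10_conj_pair A.T_S A.S_T A.F0 A.F_add A.F_M A.V_nz A.R0 A.R_add A.R_M A.J_nz A.T_R smooth_on_conj_pair A.V_smooth)
qed

theorem theorem3p1:
  shows "(\<exists>X. smooth_vector_field 0 1 X \<and> foliation_by_circles 0 1 X \<and> unbounded_periods 0 1 X) \<and>
         (\<exists>X. smooth_vector_field 1 0 X \<and> foliation_by_circles 1 0 X \<and> unbounded_periods 1 0 X)"
  using glued_flow.glued_flow_conclusion[OF glued_flow_01] glued_flow.glued_flow_conclusion[OF glued_flow_10] by blast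

end
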